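(* Let $\xi_n:=1-(2\zeta(3)/n)^{1/3}$, where $\zeta$ is the Riemann zeta function. (1) Exact size. For an integer $n\ge 3$, let $\textsc{SamplePartitions}[n]$ be the procedure that repeatedly and independently runs the sampler $\Gamma M(\xi_n)$ until the generated diagram has size exactly $n$, and then applies Pak's transform to that diagram. Then $\textsc{SamplePartitions}[n]$ is an exact-size sampler for plane partitions, i.e. its output is a uniformly random plane partition of size $n$, and its expected running time is $O(n^{4/3})$ as $n\to\infty$. (2) Approximate size. For an integer $n\ge 3$ and $\varepsilon\in(0,1)$, let $\textsc{SamplePartitions}[n,\varepsilon]$ be the procedure that repeatedly and independently runs $\Gamma M(\xi_n)$ until the generated diagram has size in $[n(1-\varepsilon),n(1+\varepsilon)]$, and then applies Pak's transform to that diagram. Then $\textsc{SamplePartitions}[n,\varepsilon]$ is an approximate-size sampler for plane partitions, i.e. its output is a random plane partition of size in $[n(1-\varepsilon),n(1+\varepsilon)]$ such that any two plane partitions of the same size have the same probability of being output. Moreover its expected running time is $O(n(\ln n)^3)$ as $n\to\infty$ for fixed $\varepsilon$, with a constant in the big $O$ not depending on $\varepsilon$: there is a constant $c>0$ such that for every $\varepsilon\in(0,1)$ there is $n_0(\varepsilon)$ such that the expected running time is at most $c\,n(\ln n)^3$ for all $n\ge n_0(\varepsilon)$.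
   Context: $\mathbb{N}=\{0,1,2,\dots\}$. A plane partition is an array $(a_{i,j})_{(i,j)\in\mathbb{N}^2}$ of nonnegative integers with finitely many nonzero entries such that $a_{i,j}\ge a_{i,j+1}$ and $a_{i,j}\ge a_{i+1,j}$ for all $i,j$; its size is $\sum_{i,j}a_{i,j}$. A diagram is an array $D=(D[i,j])_{(i,j)\in\mathbb{N}^2}$ of nonnegative integers with finitely many nonzero entries; its size is $|D|=\sum_{i,j}D[i,j](i+j+1)$. Diagrams represent finite multisets of pairs $(i,j)\in\mathbb{N}^2$, where the pair $(i,j)$ has size $i+j+1$ and $D[i,j]$ is its multiplicity. The bounding rectangle of $D$ is the smallest $[0..\ell-1]\times[0..w-1]$ outside of which $D$ vanishes. Pak's transform of a diagram $D$ with bounding rectangle $[0..\ell-1]\times[0..w-1]$: for $i=\ell-1$ down to $0$, and for each such $i$, for $j=w-1$ down to $0$, do: (1) $D[i,j]\leftarrow D[i,j]+\max(D[i+1,j],D[i,j+1])$; (2) for $c=1,\dots,\min(\ell-1-i,\,w-1-j)$, with $p=i+c$, $q=j+c$, set $D[p,q]\leftarrow\max(D[p+1,q],D[p,q+1])+\min(D[p-1,q],D[p,q-1])-D[p,q]$. Return $D$. Sampler $\Gamma M(x)$, $0<x<1$. Let $A(x)=x/(1-x)^2$. $\mathrm{Geom}(p)$ has law $\mathbb{P}(k)=p^k(1-p)$, $k\ge0$; $\mathrm{Pois}(\lambda)$ is the Poisson law; $\mathrm{Pois}_{\ge1}(\lambda)$ has law $\mathbb{P}(k)=(e^\lambda-1)^{-1}\lambda^k/k!$,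 $k\ge1$. All draws are independent. Start with the zero diagram. Draw $k_0\in\mathbb{N}$ with $\mathbb{P}(k_0\le k)=\prod_{j>k}\exp(-A(x^j)/j)$ for all $k\ge0$. If $k_0=0$, return the zero diagram. Otherwise, for $k=1,\dots,k_0-1$ draw $p_k\sim\mathrm{Pois}(A(x^k)/k)$, and draw $p_{k_0}\sim\mathrm{Pois}_{\ge1}(A(x^{k_0})/k_0)$; for each $k=1,\dots,k_0$, repeat $p_k$ times: draw $u,v\sim\mathrm{Geom}(x^k)$ and add $k$ to entry $(u,v)$ of the diagram. Return the diagram. Cost model (real arithmetic with oracle): exact values of the generating functions and probabilities involved are available at unit cost; drawing an integer from the law of $k_0$, from $\mathrm{Pois}$ or from $\mathrm{Pois}_{\ge1}$ costs $O(1+k)$, where $k$ is the value drawn; drawing from a geometric law costs $O(1)$; each arithmetic operation ($+,-,\max,\min$) and each read or update of an array entry costs $O(1)$; creating an all-zero diagram costs $O(1)$. The size and bounding rectangle of the diagram are maintained during generation. *)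

theory Defs
  imports "HOL-Probability.Probability" "HOL-Library.Monad_Syntax"
begin

section \<open>Plane partitions and diagrams\<close>

definition plane_partition :: "(nat \<times> nat \<Rightarrow> nat) \<Rightarrow> bool" where
  "plane_partition a \<longleftrightarrow>
     finite {p. a p \<noteq> 0} \<and> (\<forall>i j. a (i, j) \<ge> a (i, j + 1) \<and> a (i, j) \<ge> a (i + 1, j))"

definition pp_size :: "(nat \<times> nat \<Rightarrow> nat) \<Rightarrow> nat" where
  "pp_size a = (\<Sum>p | a p \<noteq> 0. a p)"

text \<open>
  Diagrams are arrays with finitely many nonzero entries.  Finiteness of the support is not built
  into the type: the programs below start from the zero array and update finitely many entries.
\<close>

type_synonym diagram = "nat \<times> nat \<Rightarrow> nat"

definition zero_diagram :: diagram where
  "zero_diagram = (\<lambda>_. 0)"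

definition diagram_size :: "diagram \<Rightarrow> nat" where
  "diagram_size D = (\<Sum>(i, j) | D (i, j) \<noteq> 0. D (i, j) * (i + j + 1))"

definition num_rows :: "diagram \<Rightarrow> nat" where
  "num_rows D = (LEAST l. \<forall>i j. D (i, j) \<noteq> 0 \<longrightarrow> i < l)"

definition num_cols :: "diagram \<Rightarrow> nat" where
  "num_cols D = (LEAST w. \<forall>i j. D (i, j) \<noteq> 0 \<longrightarrow> j < w)"

section \<open>Randomized programs with a running time\<close>

text \<open>
  A program is a subprobability distribution on pairs of a result and a running time; the missing
  mass is the probability of non-termination.
\<close>

type_synonym 'a prog = "('a \<times> nat) spmf"

definition return_prog :: "'a \<Rightarrow> 'a prog" where
  "return_prog x = return_spmf (x, 0)"

definition charge :: "nat \<Rightarrow> 'a prog \<Rightarrow> 'a prog" where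
  "charge c m = map_spmf (\<lambda>(x, t). (x, c + t)) m"

definition bind_prog :: "'a prog \<Rightarrow> ('a \<Rightarrow> 'b prog) \<Rightarrow> 'b prog" where
  "bind_prog m f = bind_spmf m (\<lambda>(x, t). charge t (f x))"

lemma charge_mono [partial_function_mono]:
  "mono_spmf B \<Longrightarrow> mono_spmf (\<lambda>g. charge c (B g))"
  unfolding charge_def by (rule map_spmf_mono)

lemma bind_prog_mono [partial_function_mono]:
  assumes "mono_spmf B" and "\<And>y. mono_spmf (\<lambda>g. C y g)"
  shows "mono_spmf (\<lambda>g. bind_prog (B g) (\<lambda>y. C y g))"
  unfolding bind_prog_def case_prod_beta
  by (intro bind_spmf_mono charge_mono assms)

no_adhoc_overloading Monad_Syntax.bind \<rightleftharpoons> bind_spmf bind_pmf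
adhoc_overloading Monad_Syntax.bind \<rightleftharpoons> bind_prog

definition output_law :: "'a prog \<Rightarrow> 'a spmf" where
  "output_law m = map_spmf fst m"

text \<open>A diverging run has infinite running time.\<close>

definition expected_time :: "'a prog \<Rightarrow> ennreal" where
  "expected_time m =
     (\<integral>\<^sup>+ r. (case r of None \<Rightarrow> \<infinity> | Some (_, t) \<Rightarrow> of_nat t) \<partial>measure_pmf m)"

text \<open>
  The constants hidden in the unit costs \<open>O(1)\<close> and \<open>O(1 + k)\<close> of the cost model.  An evaluation
  by the oracle is paid with \<open>oracle_cost\<close>; a value \<open>k\<close> drawn from the law of \<open>k\<^sub>0\<close> or from a
  (positive) Poisson law costs \<open>draw_cost * (1 + k)\<close>; \<open>access_cost\<close> is for a single read or
  write of an array entry, and \<open>arith_cost\<close> for a single operation or comparison on integers.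
\<close>

record cost_model =
  oracle_cost :: nat
  draw_cost :: nat
  geom_cost :: nat
  arith_cost :: nat
  access_cost :: nat
  create_cost :: nat

primrec for_each :: "cost_model \<Rightarrow> 'b list \<Rightarrow> ('b \<Rightarrow> 'a \<Rightarrow> 'a prog) \<Rightarrow> 'a \<Rightarrow> 'a prog" where
  "for_each M [] body s = charge (arith_cost M) (return_prog s)"
| "for_each M (i # is) body s =
     charge (2 * arith_cost M) (do { s' \<leftarrow> body i s; for_each M is body s' })"

section \<open>Pak's transform\<close>

text \<open>
  The subtraction does not truncate: whenever the second step is carried out, \<open>D (p, q)\<close> is at
  most \<open>min (D (p - 1, q)) (D (p, q - 1))\<close>, and \<open>p, q \<ge> 1\<close>.
  Charged are the array accesses, the operations on entries, and the index and loop bound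
  computations.
\<close>

definition pak_transform :: "cost_model \<Rightarrow> diagram \<Rightarrow> diagram prog" where
  "pak_transform M D\<^sub>0 = (let l = num_rows D\<^sub>0; w = num_cols D\<^sub>0 in
     for_each M (rev [0..<l]) (\<lambda>i.
       for_each M (rev [0..<w]) (\<lambda>j D.
         do {
           D' \<leftarrow> charge (4 * access_cost M + 9 * arith_cost M)
             (return_prog (D((i, j) := D (i, j) + max (D (i + 1, j)) (D (i, j + 1)))));
           for_each M [1..<min (l - 1 - i) (w - 1 - j) + 1] (\<lambda>c D.
             let p = i + c; q = j + c in
               charge (6 * access_cost M + 10 * arith_cost M)
                 (return_prog (D((p, q) :=
                    max (D (p + 1, q)) (D (p, q + 1)) + min (D (p - 1, q)) (D (p, q - 1))
                      - D (p, q)))))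
             D'
         })) D\<^sub>0)"

section \<open>The sampler\<close>

definition pair_gf :: "real \<Rightarrow> real" where
  "pair_gf x = x / (1 - x)\<^sup>2"

definition k0_cdf :: "real \<Rightarrow> nat \<Rightarrow> real" where
  "k0_cdf x k = (\<Prod>i. exp (- pair_gf (x ^ (k + 1 + i)) / real (k + 1 + i)))"

definition k0_pmf :: "real \<Rightarrow> nat pmf" where
  "k0_pmf x = embed_pmf (\<lambda>k. k0_cdf x k - (if k = 0 then 0 else k0_cdf x (k - 1)))"

definition pos_poisson_pmf :: "real \<Rightarrow> nat pmf" where
  "pos_poisson_pmf r = embed_pmf (\<lambda>k. if k = 0 then 0 else inverse (exp r - 1) * r ^ k / fact k)"

text \<open>
  The functions given to \<open>embed_pmf\<close> are probability mass functions for all parameters in use.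
\<close>

lemma pmf_embed_nat:
  fixes f :: "nat \<Rightarrow> real"
  assumes "\<And>k. 0 \<le> f k" and "f sums 1"
  shows "pmf (embed_pmf f) k = f k"
proof (rule pmf_embed_pmf)
  have "(\<integral>\<^sup>+k. ennreal (f k) \<partial>count_space UNIV) = (\<Sum>k. ennreal (f k))"
    by (simp add: nn_integral_count_space_nat)
  also have "\<dots> = ennreal 1"
    by (rule suminf_ennreal_eq[OF assms])
  finally show "(\<integral>\<^sup>+k. ennreal (f k) \<partial>count_space UNIV) = 1" by simp
qed (rule assms)

lemma pmf_pos_poisson:
  assumes "0 < r"
  shows "pmf (pos_poisson_pmf r) k = (if k = 0 then 0 else inverse (exp r - 1) * r ^ k / fact k)"
  unfolding pos_poisson_pmf_def
proof (rule pmf_embed_nat)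
  have "(\<lambda>k. r ^ k / fact k) sums exp r"
    using exp_converges[of r] by (simp add: field_simps)
  then have "(\<lambda>k. r ^ k / fact k - (if k = 0 then 1 else 0)) sums (exp r - 1)"
    by (intro sums_diff) (auto intro: sums_single[of 0 "\<lambda>_. 1", simplified])
  from sums_mult[OF this, of "inverse (exp r - 1)"] assms
  show "(\<lambda>k. if k = 0 then 0 else inverse (exp r - 1) * r ^ k / fact k) sums 1"
    by (simp add: if_distrib cong: if_cong)
qed (use assms in auto)

lemma prob_k0_atMost:
  assumes "0 < x" "x < 1"
  shows "measure_pmf.prob (k0_pmf x) {..k} = k0_cdf x k"
proof -
  define a where "a j = pair_gf (x ^ j) / real j" for j
  have nonneg: "0 \<le> a j" for j
    using assms by (auto simp: a_def pair_gf_def)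
  have le: "a j \<le> x ^ j / (1 - x)\<^sup>2" for j
  proof (cases "j = 0")
    case False
    then have "x ^ j \<le> x ^ 1" using assms by (intro power_decreasing) auto
    then have "x ^ j / (1 - x ^ j)\<^sup>2 \<le> x ^ j / (1 - x)\<^sup>2"
      using assms by (intro divide_left_mono power_mono mult_pos_pos) auto
    moreover have "a j \<le> x ^ j / (1 - x ^ j)\<^sup>2"
      using frac_le[of "x ^ j / (1 - x ^ j)\<^sup>2" "x ^ j / (1 - x ^ j)\<^sup>2" 1 "real j"] False assms
      by (simp add: a_def pair_gf_def)
    ultimately show ?thesis by linarith
  qed (use assms in \<open>auto simp: a_def\<close>)
  have summ: "summable a"
    by (rule summable_comparison_test'[where g = "\<lambda>j. x ^ j / (1 - x)\<^sup>2"])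
       (use assms nonneg le in \<open>auto intro!: summable_divide summable_geometric\<close>)
  have summ': "summable (\<lambda>i. a (k + 1 + i))" for k
    using summ summable_iff_shift[of a "k + 1"] by (simp add: add.commute add.left_commute)
  have F: "k0_cdf x k = exp (- (\<Sum>i. a (k + 1 + i)))" for k
    using prodinf_exp[OF summable_minus[OF summ'[of k]]] suminf_minus[OF summ'[of k]]
    by (simp add: k0_cdf_def a_def)
  have F': "k0_cdf x k = exp (- (suminf a - (\<Sum>i<k + 1. a i)))" for k
    using suminf_split_initial_segment[OF summ, of "k + 1"]
    by (simp add: F add.commute add.left_commute)
  have lim: "k0_cdf x \<longlonglongrightarrow> 1"
  proof -
    have "(\<lambda>k. \<Sum>i<k + 1. a i) \<longlonglongrightarrow> suminf a"
      using LIMSEQ_Suc[OF summable_LIMSEQ[OF summ]] by simp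
    from tendsto_exp[OF tendsto_minus[OF tendsto_diff[OF tendsto_const[of "suminf a"] this]]]
    show ?thesis by (simp add: F'[abs_def])
  qed
  let ?f = "\<lambda>k. k0_cdf x k - (if k = 0 then 0 else k0_cdf x (k - 1))"
  have tel: "(\<Sum>i\<le>k. ?f i) = k0_cdf x k" for k
    by (induction k) auto
  have "?f sums 1"
    unfolding sums_def_le using lim by (simp only: tel)
  moreover have "0 \<le> ?f k" for k
    using nonneg[of k] by (cases k) (auto simp: F')
  ultimately have "pmf (k0_pmf x) = ?f"
    unfolding k0_pmf_def by (intro ext pmf_embed_nat)
  then show ?thesis
    by (simp only: measure_measure_pmf_finite[OF finite_atMost] tel)
qed

text \<open>The library's \<open>geometric_pmf q\<close> gives mass \<open>(1 - q) ^ k * q\<close> to \<open>k\<close>.\<close>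

definition Geom :: "real \<Rightarrow> nat pmf" where
  "Geom p = geometric_pmf (1 - p)"

definition draw :: "cost_model \<Rightarrow> nat pmf \<Rightarrow> nat prog" where
  "draw M p = map_spmf (\<lambda>k. (k, oracle_cost M + draw_cost M * (1 + k))) (spmf_of_pmf p)"

definition draw_geom :: "cost_model \<Rightarrow> real \<Rightarrow> nat prog" where
  "draw_geom M p = map_spmf (\<lambda>k. (k, oracle_cost M + geom_cost M)) (spmf_of_pmf (Geom p))"

definition draw_multiplicities :: "cost_model \<Rightarrow> real \<Rightarrow> nat \<Rightarrow> (nat \<Rightarrow> nat) prog" where
  "draw_multiplicities M x k\<^sub>0 = do {
     p \<leftarrow> for_each M [1..<k\<^sub>0] (\<lambda>k p. do {
            m \<leftarrow> draw M (poisson_pmf (pair_gf (x ^ k) / real k));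
            charge (access_cost M) (return_prog (p(k := m)))
          }) (\<lambda>_. 0);
     m \<leftarrow> draw M (pos_poisson_pmf (pair_gf (x ^ k\<^sub>0) / real k\<^sub>0));
     charge (access_cost M) (return_prog (p(k\<^sub>0 := m)))
   }"

text \<open>
  Besides the update of the entry, this pays for maintaining the size, which grows by
  \<open>k * (u + v + 1)\<close>, and the bounding rectangle, whose sides become at least \<open>u + 1\<close> and \<open>v + 1\<close>.
\<close>

definition add_random_pair :: "cost_model \<Rightarrow> real \<Rightarrow> nat \<Rightarrow> diagram \<Rightarrow> diagram prog" where
  "add_random_pair M x k D = do {
     u \<leftarrow> draw_geom M (x ^ k);
     v \<leftarrow> draw_geom M (x ^ k);
     charge (2 * access_cost M + 9 * arith_cost M)
       (return_prog (D((u, v) := D (u, v) + k)))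
   }"

definition Gamma_M :: "cost_model \<Rightarrow> real \<Rightarrow> diagram prog" where
  "Gamma_M M x = do {
     k\<^sub>0 \<leftarrow> draw M (k0_pmf x);
     charge (2 * create_cost M + arith_cost M)
       (if k\<^sub>0 = 0 then return_prog zero_diagram
        else do {
          p \<leftarrow> draw_multiplicities M x k\<^sub>0;
          for_each M [1..<k\<^sub>0 + 1] (\<lambda>k D. charge (access_cost M)
            (for_each M [0..<p k] (\<lambda>_. add_random_pair M x k) D)) zero_diagram
        })
   }"

text \<open>Repeats \<open>m\<close> until its result satisfies \<open>P\<close>; a test consists of at most two comparisons.\<close>

partial_function (spmf) repeat_until :: "cost_model \<Rightarrow> 'a prog \<Rightarrow> ('a \<Rightarrow> bool) \<Rightarrow> 'a prog" where
  "repeat_until M m P = do {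
     x \<leftarrow> m;
     charge (2 * arith_cost M) (if P x then return_prog x else repeat_until M m P)
   }"

definition riemann_zeta :: "real \<Rightarrow> real" where
  "riemann_zeta s = (\<Sum>m. 1 / real (m + 1) powr s)"

definition xi :: "nat \<Rightarrow> real" where
  "xi n = 1 - (2 * riemann_zeta 3 / real n) powr (1 / 3)"

definition sample_partitions :: "cost_model \<Rightarrow> nat \<Rightarrow> diagram prog" where
  "sample_partitions M n = do {
     D \<leftarrow> repeat_until M (Gamma_M M (xi n)) (\<lambda>D. diagram_size D = n);
     pak_transform M D
   }"

definition sample_partitions_approx :: "cost_model \<Rightarrow> nat \<Rightarrow> real \<Rightarrow> diagram prog" where
  "sample_partitions_approx M n \<epsilon> = do {
     D \<leftarrow> repeat_until M (Gamma_M M (xi n))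
            (\<lambda>D. real (diagram_size D) \<in> {real n * (1 - \<epsilon>)..real n * (1 + \<epsilon>)});
     pak_transform M D
   }"

no_adhoc_overloading Monad_Syntax.bind \<rightleftharpoons> bind_prog
adhoc_overloading Monad_Syntax.bind \<rightleftharpoons> bind_spmf bind_pmf

end

theory Submission
  imports Defs "HOL-Complex_Analysis.Complex_Analysis" "HOL-Real_Asymp.Real_Asymp"
begin

text \<open>
  Mecke's formula for the Poisson draws shows that the sampler outputs a diagram \<open>D\<close> with probability
  proportional to \<open>x ^ diagram_size D\<close>, so that conditioning on the size gives a uniform diagram of that
  size. Pak's transform is a composition of invertible toggles; it preserves the equality of the
  weights on diagonals with the weights in quadrants, and hence maps diagrams bijectively and with
  preservation of the size to plane partitions.

  Write \<open>t = 1 - \<xi>\<^sub>n\<close>, so that \<open>n = 2 \<zeta>(3) / t ^ 3\<close>. One run of the sampler costs \<open>O(1 / t\<^sup>2)\<close> on average.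
  The mean size is \<open>n + O(1 / t\<^sup>2)\<close>, and Fourier inversion with dominated convergence shows that every
  size at distance \<open>O(1 / t\<^sup>2)\<close> from \<open>n\<close> has probability at least \<open>c * t\<^sup>2\<close>. Hence \<open>O(1 / t\<^sup>2)\<close> runs
  suffice for the exact size, and \<open>O(1)\<close> runs for a window of relative width \<open>\<epsilon>\<close>, since the window
  contains about \<open>1 / t\<^sup>2\<close> such sizes. The transform costs \<open>O(B ^ 3)\<close> when the diagram fits into a square of
  side \<open>B\<close>, and for \<open>B\<close> of order \<open>ln n / t\<close> the exceptional diagrams are too rare to matter, as a
  given cell \<open>c\<close> is occupied with probability at most \<open>x ^ cell_size c\<close>.
\<close>

section \<open>Expected running times\<close>

text \<open>The standard deviation of the size is itself of order \<open>1 / t\<^sup>2\<close>. So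
  an error of that order in the mean moves \<open>n\<close> by boundedly many standard deviations
  only and costs a constant factor in the local limit theorem. That the sampler's law has total mass
  1 identifies the generating function of the diagrams, on the interval (0,1), with the exponential
  of a power series with nonnegative coefficients; analytic continuation moves the identity to
  circles in the unit disc. The size is therefore compound Poisson. Its jump intensities lie between
  \<open>m * x ^ m\<close> and \<open>2 * m * x ^ m\<close>, so its cumulants and the decay of its
  characteristic function over a whole period come from elementary closed sums. The cubic cost of
  the transform is tamed by a cut-off at side \<open>B\<close>: conditioning on acceptance raises
  probabilities by at most the factor \<open>1 / success\<close>, polynomial in \<open>n\<close>,
  whereas each cell outside the square of side \<open>B\<close> is occupied with probability at most
  \<open>x ^ B \<le> 1 / n ^ 7\<close>.\<close>

lemma output_law_return [simp]: "output_law (return_prog x) = return_spmf x"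
  by (simp add: output_law_def return_prog_def)

lemma output_law_charge [simp]: "output_law (charge c m) = output_law m"
  by (simp add: output_law_def charge_def spmf.map_comp o_def split_def)

lemma output_law_bind [simp]:
  "output_law (bind_prog m f) = bind_spmf (output_law m) (\<lambda>x. output_law (f x))"
  by (simp add: output_law_def bind_prog_def map_spmf_bind_spmf bind_map_spmf o_def split_def
      charge_def spmf.map_comp)

text \<open>Moves an integral over results to \<open>measure_pmf\<close>, the space on which
  \<open>expected_time\<close> lives. There \<open>None\<close> counts 0 in one integrand and
  \<infinity> in the other, and the two can be added pointwise.\<close>

lemma nn_integral_measure_spmf_option:
  "(\<integral>\<^sup>+ x. f x \<partial>measure_spmf p) = (\<integral>\<^sup>+ r. (case r of None \<Rightarrow> 0 | Some x \<Rightarrow> f x) \<partial>measure_pmf p)"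
proof -
  have "(\<integral>\<^sup>+ x. f x \<partial>measure_spmf p) = (\<integral>\<^sup>+ r. f (the r) * indicator (range Some) r \<partial>measure_pmf p)"
    by (simp add: nn_integral_measure_spmf_conv_measure_pmf nn_integral_restrict_space)
  also have "\<dots> = (\<integral>\<^sup>+ r. (case r of None \<Rightarrow> 0 | Some x \<Rightarrow> f x) \<partial>measure_pmf p)"
    by (intro nn_integral_cong) (auto split: option.split simp: indicator_def)
  finally show ?thesis .
qed

lemma nn_integral_output_law:
  "(\<integral>\<^sup>+ x. f x \<partial>measure_spmf (output_law m)) = (\<integral>\<^sup>+ z. f (fst z) \<partial>measure_spmf m)"
  by (simp add: output_law_def o_def)

lemma nn_integral_measure_spmf_const_le: "(\<integral>\<^sup>+ x. c \<partial>measure_spmf p) \<le> c"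
  using mult_left_mono[OF measure_spmf.subprob_emeasure_le_1, of c p UNIV]
  by (simp add: space_measure_spmf)

lemma nn_integral_measure_spmf_le:
  assumes "\<And>x. x \<in> set_spmf p \<Longrightarrow> f x \<le> c"
  shows "(\<integral>\<^sup>+ x. f x \<partial>measure_spmf p) \<le> c"
proof -
  have "(\<integral>\<^sup>+ x. f x \<partial>measure_spmf p) \<le> (\<integral>\<^sup>+ x. c \<partial>measure_spmf p)"
    using assms by (intro nn_integral_mono_AE) (simp add: AE_measure_spmf_iff)
  also have "\<dots> \<le> c" by (rule nn_integral_measure_spmf_const_le)
  finally show ?thesis .
qed

lemma expected_time_return [simp]: "expected_time (return_prog x) = 0"
  by (simp add: expected_time_def return_prog_def)

lemma expected_time_return_spmf [simp]: "expected_time (return_spmf (x, t)) = of_nat t"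
  by (simp add: expected_time_def)

lemma expected_time_charge [simp]: "expected_time (charge c m) = of_nat c + expected_time m"
proof -
  have "expected_time (charge c m) =
      (\<integral>\<^sup>+ r. of_nat c + (case r of None \<Rightarrow> \<infinity> | Some (_, t) \<Rightarrow> of_nat t) \<partial>measure_pmf m)"
    unfolding expected_time_def charge_def nn_integral_map_pmf
    by (intro nn_integral_cong) (auto split: option.split)
  also have "\<dots> = of_nat c + expected_time m"
    by (subst nn_integral_add) (auto simp: expected_time_def)
  finally show ?thesis .
qed

text \<open>A diverging run of \<open>m\<close> already contributes \<infinity> to the first
  summand, so the second integral may ignore it; otherwise the times of the two phases add.\<close>

lemma expected_time_bind:
  "expected_time (bind_prog m f) =
     expected_time m + (\<integral>\<^sup>+ x. expected_time (f x) \<partial>measure_spmf (output_law m))"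
proof -
  have "expected_time (bind_prog m f) =
      (\<integral>\<^sup>+ r. (case r of None \<Rightarrow> \<infinity> | Some (x, t) \<Rightarrow> expected_time (charge t (f x))) \<partial>measure_pmf m)"
    unfolding expected_time_def bind_prog_def bind_spmf_def nn_integral_bind_pmf
    by (intro nn_integral_cong) (auto split: option.split)
  also have "\<dots> = (\<integral>\<^sup>+ r. (case r of None \<Rightarrow> \<infinity> | Some (_, t) \<Rightarrow> of_nat t) +
      (case r of None \<Rightarrow> 0 | Some z \<Rightarrow> expected_time (f (fst z))) \<partial>measure_pmf m)"
    by (intro nn_integral_cong) (auto split: option.split)
  also have "\<dots> = expected_time m + (\<integral>\<^sup>+ x. expected_time (f x) \<partial>measure_spmf (output_law m))"
    unfolding expected_time_def[of m] nn_integral_output_law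
    unfolding nn_integral_measure_spmf_option
    by (rule nn_integral_add) auto
  finally show ?thesis .
qed

lemma expected_time_bind_le:
  assumes "\<And>x. x \<in> set_spmf (output_law m) \<Longrightarrow> expected_time (f x) \<le> c"
  shows "expected_time (bind_prog m f) \<le> expected_time m + c"
  unfolding expected_time_bind by (intro add_left_mono nn_integral_measure_spmf_le assms)

lemma expected_time_for_each_le:
  assumes "\<And>i s. i \<in> set is \<Longrightarrow> expected_time (body i s) \<le> b i"
  shows "expected_time (for_each M is body s) \<le>
    of_nat (arith_cost M) + (\<Sum>i\<leftarrow>is. of_nat (2 * arith_cost M) + b i)"
  using assms
proof (induction "is" arbitrary: s)
  case (Cons i "is")
  have "expected_time (for_each M (i # is) body s) \<le> of_nat (2 * arith_cost M) +
      (b i + (of_nat (arith_cost M) + (\<Sum>i\<leftarrow>is. of_nat (2 * arith_cost M) + b i)))"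
  proof -
    have "expected_time (for_each M is body x) \<le>
        of_nat (arith_cost M) + (\<Sum>i\<leftarrow>is. of_nat (2 * arith_cost M) + b i)" for x
      using Cons.prems by (intro Cons.IH) auto
    then show ?thesis unfolding for_each.simps expected_time_charge
      by (intro add_left_mono order_trans[OF expected_time_bind_le] add_mono Cons.prems) auto
  qed
  then show ?case by (simp add: algebra_simps)
qed simp

lemma output_law_for_each_Cons [simp]:
  "output_law (for_each M (i # is) body s) =
     bind_spmf (output_law (body i s)) (\<lambda>s'. output_law (for_each M is body s'))"
  by simp

lemma output_law_for_each_Nil [simp]: "output_law (for_each M [] body s) = return_spmf s"
  by simp

lemma output_law_repeat_until:
  "output_law (repeat_until M m P) =
     bind_spmf (output_law m) (\<lambda>x. if P x then return_spmf x else output_law (repeat_until M m P))"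
  by (subst repeat_until.simps) (simp add: if_distrib cong: if_cong)

lemma measure_spmf_Collect_not:
  assumes "lossless_spmf p"
  shows "measure (measure_spmf p) {x. \<not> P x} = 1 - measure (measure_spmf p) {x. P x}"
proof -
  have "measure (measure_spmf p) (space (measure_spmf p) - {x. P x}) =
      measure (measure_spmf p) (space (measure_spmf p)) - measure (measure_spmf p) {x. P x}"
    by (rule measure_spmf.finite_measure_compl) simp
  moreover have "space (measure_spmf p) - {x. P x} = {x. \<not> P x}" by (auto simp: space_measure_spmf)
  ultimately show ?thesis using assms by (simp add: lossless_spmf_def space_measure_spmf)
qed

lemma affine_fixpoint: "s = a + (1 - p) * s \<Longrightarrow> 0 < p \<Longrightarrow> s = a / p" for a p s :: real
  by (simp add: field_simps)

text \<open>One unfolding of the loop gives, for every point probability, an affine equation with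
  slope \<open>1 - p P < 1\<close>; its unique solution is the law of \<open>m\<close> conditioned
  on \<open>P\<close>. The same equation for the total mass yields almost sure termination.\<close>

lemma spmf_repeat_until:
  fixes m :: "'a prog"
  defines "p \<equiv> \<lambda>P. measure (measure_spmf (output_law m)) {x. P x}"
  assumes lossless: "lossless_spmf (output_law m)" and pos: "0 < p P"
  shows "spmf (output_law (repeat_until M m P)) y = (if P y then spmf (output_law m) y else 0) / p P"
    and "lossless_spmf (output_law (repeat_until M m P))"
proof -
  let ?G = "output_law m" and ?O = "output_law (repeat_until M m P)"
  have integrable [simp]: "integrable (measure_spmf ?G) (indicat_real A)" for A
    by (rule integrable_real_indicator) (auto simp: measure_spmf.emeasure_eq_measure)
  have step: "spmf ?O y = (if P y then spmf ?G y else 0) + (1 - p P) * spmf ?O y" for y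
  proof -
    have "spmf ?O y = (\<integral>x. spmf (if P x then return_spmf x else ?O) y \<partial>measure_spmf ?G)"
      by (subst output_law_repeat_until) (simp add: spmf_bind)
    also have "\<dots> = (\<integral>x. indicator {x. P x \<and> x = y} x + spmf ?O y * indicator {x. \<not> P x} x \<partial>measure_spmf ?G)"
      by (intro Bochner_Integration.integral_cong) (auto simp: indicator_def)
    also have "\<dots> = measure (measure_spmf ?G) {x. P x \<and> x = y} + spmf ?O y * measure (measure_spmf ?G) {x. \<not> P x}"
      by (subst Bochner_Integration.integral_add) (auto simp: space_measure_spmf)
    also have "{x. P x \<and> x = y} = (if P y then {y} else {})" by auto
    also have "measure (measure_spmf ?G) \<dots> = (if P y then spmf ?G y else 0)"
      by (simp add: spmf_conv_measure_spmf)
    also have "measure (measure_spmf ?G) {x. \<not> P x} = 1 - p P"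
      by (simp add: measure_spmf_Collect_not[OF lossless] p_def)
    finally show ?thesis by (metis mult.commute)
  qed
  show "spmf ?O y = (if P y then spmf ?G y else 0) / p P"
    by (intro affine_fixpoint[OF step pos])
  have "weight_spmf ?O = (\<integral>x. weight_spmf (if P x then return_spmf x else ?O) \<partial>measure_spmf ?G)"
    using arg_cong[OF output_law_repeat_until, of weight_spmf M m P] by (simp only: weight_bind_spmf o_def)
  also have "\<dots> = (\<integral>x. indicator {x. P x} x + weight_spmf ?O * indicator {x. \<not> P x} x \<partial>measure_spmf ?G)"
    by (intro Bochner_Integration.integral_cong) (auto simp: indicator_def)
  also have "\<dots> = p P + weight_spmf ?O * (1 - p P)"
    by (subst Bochner_Integration.integral_add)
      (auto simp: space_measure_spmf p_def measure_spmf_Collect_not[OF lossless])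
  also have "\<dots> = p P + (1 - p P) * weight_spmf ?O" by simp
  finally have "weight_spmf ?O = p P / p P" by (rule affine_fixpoint[OF _ pos])
  then show "lossless_spmf ?O" using pos by (simp add: lossless_spmf_def)
qed

text \<open>Capping the running time at \<open>N\<close> makes the recursive inequality for a repeated program solvable.\<close>

definition capped_time :: "nat \<Rightarrow> 'a prog \<Rightarrow> ennreal" where
  "capped_time N m =
     (\<integral>\<^sup>+ r. min (of_nat N) (case r of None \<Rightarrow> \<infinity> | Some (_, t) \<Rightarrow> of_nat t) \<partial>measure_pmf m)"

lemma SUP_capped_time: "(SUP N. capped_time N m) = expected_time m"
proof -
  have "(SUP N::nat. min (of_nat N) x) = x" for x :: ennreal
  proof (rule antisym)
    show "x \<le> (SUP N::nat. min (of_nat N) x)"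
    proof (cases "x = top")
      case True
      then show ?thesis by (simp add: ennreal_SUP_of_nat_eq_top)
    next
      case False
      then obtain N :: nat where "x < of_nat N" using ennreal_Ex_less_of_nat[of x] by (auto simp: top.not_eq_extremum)
      then show ?thesis by (intro SUP_upper2[of N]) (auto simp: min_def)
    qed
  qed (auto intro!: SUP_least)
  then have "expected_time m = (\<integral>\<^sup>+ r. (SUP N::nat. min (of_nat N)
      (case r of None \<Rightarrow> \<infinity> | Some (_, t) \<Rightarrow> of_nat t)) \<partial>measure_pmf m)"
    by (simp add: expected_time_def)
  also have "\<dots> = (SUP N. capped_time N m)" unfolding capped_time_def
    by (intro nn_integral_monotone_convergence_SUP) (auto simp: incseq_def le_fun_def min_le_iff_disj)
  finally show ?thesis by simp
qed

lemma capped_time_le: "capped_time N m \<le> of_nat N"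
proof -
  have "capped_time N m \<le> (\<integral>\<^sup>+ r. of_nat N \<partial>measure_pmf m)"
    unfolding capped_time_def by (intro nn_integral_mono) simp
  then show ?thesis by (simp add: measure_pmf.emeasure_space_1)
qed

lemma capped_time_charge_le: "capped_time N (charge c m) \<le> of_nat c + capped_time N m"
proof -
  have "capped_time N (charge c m) \<le>
      (\<integral>\<^sup>+ r. of_nat c + min (of_nat N) (case r of None \<Rightarrow> \<infinity> | Some (_, t) \<Rightarrow> of_nat t) \<partial>measure_pmf m)"
    unfolding capped_time_def charge_def nn_integral_map_pmf
    by (intro nn_integral_mono) (auto split: option.split simp: min_def add_increasing intro: order_trans)
  also have "\<dots> = of_nat c + capped_time N m"
    by (subst nn_integral_add) (auto simp: capped_time_def)
  finally show ?thesis .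
qed

lemma capped_time_return [simp]: "capped_time N (return_prog x) = 0"
  by (simp add: capped_time_def return_prog_def)

text \<open>Since \<open>min N (a + b) \<le> a + min N b\<close>, the cap can be left on the
  continuation alone; the recursive call of a loop then enters with a finite value.\<close>

lemma capped_time_bind_le:
  "capped_time N (bind_prog m f) \<le>
     expected_time m + (\<integral>\<^sup>+ x. capped_time N (f x) \<partial>measure_spmf (output_law m))"
proof -
  have "capped_time N (bind_prog m f) \<le>
      (\<integral>\<^sup>+ r. (case r of None \<Rightarrow> \<infinity> | Some (x, t) \<Rightarrow> capped_time N (charge t (f x))) \<partial>measure_pmf m)"
    unfolding capped_time_def bind_prog_def bind_spmf_def nn_integral_bind_pmf
    by (intro nn_integral_mono) (auto split: option.split)
  also have "\<dots> \<le> (\<integral>\<^sup>+ r. (case r of None \<Rightarrow> \<infinity> | Some (_, t) \<Rightarrow> of_nat t) +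
      (case r of None \<Rightarrow> 0 | Some z \<Rightarrow> capped_time N (f (fst z))) \<partial>measure_pmf m)"
    by (intro nn_integral_mono) (auto split: option.split intro: capped_time_charge_le)
  also have "\<dots> = expected_time m + (\<integral>\<^sup>+ x. capped_time N (f x) \<partial>measure_spmf (output_law m))"
    unfolding expected_time_def[of m] nn_integral_output_law
    unfolding nn_integral_measure_spmf_option
    by (rule nn_integral_add) auto
  finally show ?thesis .
qed

text \<open>The capped time \<open>h\<close> satisfies \<open>h \<le> T + h * (1 - p P)\<close> and,
  being finite, can be cancelled; the value \<infinity> would satisfy the inequality as well. The
  bound does not depend on \<open>N\<close>, so it passes to the supremum.\<close>

theorem expected_time_repeat_until_le:
  fixes m :: "'a prog"
  defines "p \<equiv> \<lambda>P. measure (measure_spmf (output_law m)) {x. P x}"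
  assumes lossless: "lossless_spmf (output_law m)" and pos: "0 < p P"
    and time: "expected_time m + of_nat (2 * arith_cost M) \<le> ennreal T" and T: "0 \<le> T"
  shows "expected_time (repeat_until M m P) \<le> ennreal (T / p P)"
proof -
  let ?R = "repeat_until M m P" and ?G = "output_law m"
  have "capped_time N ?R \<le> ennreal (T / p P)" for N
  proof -
    have fin: "capped_time N ?R < top" using capped_time_le[of N ?R] by (rule le_less_trans) (simp add: ennreal_of_nat_eq_real_of_nat)
    obtain h where h: "capped_time N ?R = ennreal h" "0 \<le> h"
      using fin by (cases "capped_time N ?R") auto
    have "capped_time N ?R \<le> expected_time m +
        (\<integral>\<^sup>+ x. capped_time N (charge (2 * arith_cost M) (if P x then return_prog x else ?R)) \<partial>measure_spmf ?G)"
      by (subst repeat_until.simps) (rule capped_time_bind_le)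
    also have "\<dots> \<le> expected_time m + (\<integral>\<^sup>+ x. of_nat (2 * arith_cost M) + capped_time N ?R * indicator {x. \<not> P x} x \<partial>measure_spmf ?G)"
      by (intro add_left_mono nn_integral_mono order_trans[OF capped_time_charge_le]) (auto simp: indicator_def)
    also have "\<dots> = expected_time m + (\<integral>\<^sup>+ x. of_nat (2 * arith_cost M) \<partial>measure_spmf ?G) +
        capped_time N ?R * emeasure (measure_spmf ?G) {x. \<not> P x}"
      by (subst nn_integral_add) (auto simp: nn_integral_cmult_indicator add.assoc)
    also have "\<dots> \<le> expected_time m + of_nat (2 * arith_cost M) + capped_time N ?R * emeasure (measure_spmf ?G) {x. \<not> P x}"
      by (intro add_right_mono add_left_mono nn_integral_measure_spmf_const_le)
    also have "\<dots> \<le> ennreal T + ennreal h * ennreal (1 - p P)"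
      unfolding measure_spmf.emeasure_eq_measure measure_spmf_Collect_not[OF lossless] h(1) p_def
      by (intro add_right_mono time)
    also have "\<dots> = ennreal (T + h * (1 - p P))"
      using T h(2) by (simp add: p_def ennreal_mult'' measure_spmf.subprob_measure_le_1)
    finally have "h \<le> T + h * (1 - p P)"
      unfolding h(1) using T h(2) by (subst (asm) ennreal_le_iff) (auto simp: p_def measure_spmf.subprob_measure_le_1)
    then have "h \<le> T / p P" using pos by (simp add: field_simps)
    then show ?thesis unfolding h(1) by (rule ennreal_leI)
  qed
  then show ?thesis unfolding SUP_capped_time[symmetric] by (intro SUP_least)
qed

section \<open>The law of the sampled diagram\<close>

text \<open>The loop \<open>for_each\<close> stripped of its costs and with values in
  \<open>pmf\<close>, where the laws of the terminating loops can be compared.\<close>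

primrec fold_pmf :: "'b list \<Rightarrow> ('b \<Rightarrow> 'a \<Rightarrow> 'a pmf) \<Rightarrow> 'a \<Rightarrow> 'a pmf" where
  "fold_pmf [] f s = return_pmf s"
| "fold_pmf (i # is) f s = bind_pmf (f i s) (fold_pmf is f)"

lemma fold_pmf_append: "fold_pmf (is @ js) f s = bind_pmf (fold_pmf is f s) (fold_pmf js f)"
proof (induction "is" arbitrary: s)
  case (Cons i "is")
  then have "fold_pmf (is @ js) f = (\<lambda>s. bind_pmf (fold_pmf is f s) (fold_pmf js f))" by (rule ext)
  then show ?case by (simp add: bind_assoc_pmf)
qed (simp add: bind_return_pmf)

lemma fold_pmf_single: "fold_pmf [i] f = f i"
proof (rule ext)
  have "fold_pmf [] f = return_pmf" by (rule ext) simp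
  then show "fold_pmf [i] f s = f i s" for s by (simp add: bind_return_pmf')
qed

lemma fold_pmf_cong:
  "(\<And>i s. i \<in> set is \<Longrightarrow> f i s = g i s) \<Longrightarrow> fold_pmf is f s = fold_pmf is g s"
  by (induction "is" arbitrary: s) (simp_all cong: bind_pmf_cong)

lemma set_fold_pmf:
  assumes "\<And>i s. i \<in> set is \<Longrightarrow> s \<in> A \<Longrightarrow> set_pmf (f i s) \<subseteq> A" and "s \<in> A"
  shows "set_pmf (fold_pmf is f s) \<subseteq> A"
  using assms by (induction "is" arbitrary: s) (simp, fastforce simp: set_bind_pmf)

lemma output_law_for_each_eq:
  assumes "\<And>i s. i \<in> set is \<Longrightarrow> output_law (body i s) = spmf_of_pmf (f i s)"
  shows "output_law (for_each M is body s) = spmf_of_pmf (fold_pmf is f s)"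
  using assms by (induction "is" arbitrary: s) (simp_all del: for_each.simps add: spmf_of_pmf_bind)

text \<open>Size biasing: \<open>p * r ^ p / fact p = r * (r ^ (p - 1) / fact (p - 1))\<close>. It
  turns the factor \<open>p\<close>, the choice of one of \<open>p\<close> pairs, into the
  rate.\<close>

lemma nn_integral_poisson_shift:
  fixes f :: "nat \<Rightarrow> ennreal"
  assumes r: "0 < r"
  shows "(\<integral>\<^sup>+ p. of_nat p * f (p - 1) \<partial>poisson_pmf r) = ennreal r * (\<integral>\<^sup>+ p. f p \<partial>poisson_pmf r)"
proof -
  have "(\<integral>\<^sup>+ p. of_nat p * f (p - 1) \<partial>poisson_pmf r) =
      (\<integral>\<^sup>+ p. ennreal (pmf (poisson_pmf r) p) * (of_nat p * f (p - 1)) * indicator (range Suc) p \<partial>count_space UNIV)"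
    unfolding nn_integral_measure_pmf
  proof (intro nn_integral_cong)
    fix p :: nat
    show "ennreal (pmf (poisson_pmf r) p) * (of_nat p * f (p - 1)) =
      ennreal (pmf (poisson_pmf r) p) * (of_nat p * f (p - 1)) * indicator (range Suc) p"
      by (cases p) auto
  qed
  also have "\<dots> = (\<integral>\<^sup>+ p. ennreal (pmf (poisson_pmf r) p) * (of_nat p * f (p - 1)) \<partial>count_space (range Suc))"
    by (simp add: nn_integral_count_space_indicator)
  also have "\<dots> = (\<integral>\<^sup>+ p. ennreal (pmf (poisson_pmf r) (Suc p)) * (of_nat (Suc p) * f p) \<partial>count_space UNIV)"
    by (subst nn_integral_bij_count_space[of Suc UNIV, symmetric]) (auto simp: bij_betw_def)
  also have "\<dots> = (\<integral>\<^sup>+ p. ennreal r * (ennreal (pmf (poisson_pmf r) p) * f p) \<partial>count_space UNIV)"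
  proof (intro nn_integral_cong)
    fix p
    have "pmf (poisson_pmf r) (Suc p) * real (Suc p) = r * pmf (poisson_pmf r) p"
      using r by (simp add: divide_simps del: of_nat_Suc)
    then have "ennreal (pmf (poisson_pmf r) (Suc p)) * of_nat (Suc p) = ennreal r * ennreal (pmf (poisson_pmf r) p)"
      using r by (metis ennreal_mult ennreal_of_nat_eq_real_of_nat of_nat_0_le_iff pmf_nonneg less_imp_le)
    then show "ennreal (pmf (poisson_pmf r) (Suc p)) * (of_nat (Suc p) * f p) =
        ennreal r * (ennreal (pmf (poisson_pmf r) p) * f p)"
      by (metis mult.assoc)
  qed
  also have "\<dots> = ennreal r * (\<integral>\<^sup>+ p. f p \<partial>poisson_pmf r)"
    by (simp add: nn_integral_cmult nn_integral_measure_pmf)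
  finally show ?thesis .
qed

text \<open>A Poisson variable is zero with probability \<open>exp (- r)\<close>, and given that it
  is positive it has the positive Poisson law. This is what links the forced draw at the top level
  to an ordinary level.\<close>

lemma nn_integral_poisson_split:
  fixes f :: "nat \<Rightarrow> ennreal"
  assumes r: "0 < r"
  shows "(\<integral>\<^sup>+ p. f p \<partial>poisson_pmf r) =
    ennreal (exp (- r)) * f 0 + ennreal (1 - exp (- r)) * (\<integral>\<^sup>+ p. f p \<partial>pos_poisson_pmf r)"
proof -
  have "ennreal (pmf (poisson_pmf r) p) * f p =
      ennreal (exp (- r)) * f 0 * indicator {0} p + ennreal (1 - exp (- r)) * (ennreal (pmf (pos_poisson_pmf r) p) * f p)" for p
  proof (cases "p = 0")
    case False
    have "exp (- r) = (1 - exp (- r)) * inverse (exp r - 1)"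
      using r by (simp add: exp_minus field_simps)
    then have "pmf (poisson_pmf r) p = (1 - exp (- r)) * pmf (pos_poisson_pmf r) p"
      using r False by (simp add: pmf_pos_poisson)
    then show ?thesis using r False by (simp add: ennreal_mult mult.assoc)
  qed (use r in \<open>simp add: pmf_pos_poisson\<close>)
  then have "(\<integral>\<^sup>+ p. f p \<partial>poisson_pmf r) = (\<integral>\<^sup>+ p. ennreal (exp (- r)) * f 0 * indicator {0} p +
      ennreal (1 - exp (- r)) * (ennreal (pmf (pos_poisson_pmf r) p) * f p) \<partial>count_space UNIV)"
    by (simp only: nn_integral_measure_pmf)
  also have "\<dots> = (\<integral>\<^sup>+ p. ennreal (exp (- r)) * f 0 * indicator {0} p \<partial>count_space UNIV) +
      ennreal (1 - exp (- r)) * (\<integral>\<^sup>+ p. f p \<partial>pos_poisson_pmf r)"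
    by (subst nn_integral_add) (auto simp: nn_integral_cmult nn_integral_measure_pmf)
  finally show ?thesis by (simp add: nn_integral_cmult_indicator one_ennreal_def[symmetric])
qed

lemma nn_integral_poisson_mean:
  "0 < r \<Longrightarrow> (\<integral>\<^sup>+ p. of_nat p \<partial>poisson_pmf r) = ennreal r"
  using nn_integral_poisson_shift[of r "\<lambda>_. 1"] by (simp add: measure_pmf.emeasure_space_1)

text \<open>The exact mean is \<open>r / (1 - exp (- r))\<close>; the bound amounts to
  \<open>(1 + r) * exp (- r) \<le> 1\<close>.\<close>

lemma nn_integral_pos_poisson_mean_le:
  assumes r: "0 < r"
  shows "(\<integral>\<^sup>+ p. of_nat p \<partial>pos_poisson_pmf r) \<le> ennreal (1 + r)"
proof -
  let ?m = "\<integral>\<^sup>+ p. of_nat p \<partial>pos_poisson_pmf r"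
  have "0 < 1 - exp (- r)" using r by simp
  have *: "ennreal r = ennreal (1 - exp (- r)) * ?m"
    using nn_integral_poisson_split[OF r, of of_nat] nn_integral_poisson_mean[of r] r by simp
  have "?m \<noteq> top" using * \<open>0 < 1 - exp (- r)\<close> by (metis ennreal_mult_eq_top_iff ennreal_neq_top ennreal_eq_0_iff not_le)
  then obtain m where m: "?m = ennreal m" "0 \<le> m" by (cases ?m) auto
  have "r = (1 - exp (- r)) * m"
    using * r m \<open>0 < 1 - exp (- r)\<close> by (simp add: ennreal_mult'[symmetric])
  moreover have "r \<le> (1 - exp (- r)) * (1 + r)"
  proof -
    have "(1 + r) * exp (- r) \<le> exp r * exp (- r)" by (intro mult_right_mono) auto
    then show ?thesis by (simp add: exp_minus field_simps)
  qed
  ultimately have "(1 - exp (- r)) * m \<le> (1 - exp (- r)) * (1 + r)" by simp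
  then have "m \<le> 1 + r" using \<open>0 < 1 - exp (- r)\<close> by (rule mult_left_le_imp_le)
  then show ?thesis unfolding m(1) by (rule ennreal_leI)
qed

section \<open>Diagrams with one entry raised\<close>

definition raise_entry :: "nat \<times> nat \<Rightarrow> nat \<Rightarrow> diagram \<Rightarrow> diagram" where
  "raise_entry c k D = D(c := D c + k)"

definition cell_size :: "nat \<times> nat \<Rightarrow> nat" where
  "cell_size c = fst c + snd c + 1"

lemma raise_entry_commute: "raise_entry c k (raise_entry c' k' D) = raise_entry c' k' (raise_entry c k D)"
  by (auto simp: raise_entry_def fun_eq_iff)

lemma diagram_size_eq:
  assumes "finite A" "{c. D c \<noteq> 0} \<subseteq> A"
  shows "diagram_size D = (\<Sum>c\<in>A. D c * cell_size c)"
proof -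
  have "diagram_size D = (\<Sum>c | D c \<noteq> 0. D c * cell_size c)"
    unfolding diagram_size_def by (intro sum.cong) (auto simp: cell_size_def)
  also have "\<dots> = (\<Sum>c\<in>A. D c * cell_size c)"
    using assms by (intro sum.mono_neutral_left) auto
  finally show ?thesis .
qed

lemma finite_support_raise_entry:
  "finite {c. D c \<noteq> 0} \<Longrightarrow> finite {c'. raise_entry c k D c' \<noteq> 0}"
  by (rule finite_subset[of _ "insert c {c. D c \<noteq> 0}"]) (auto simp: raise_entry_def)

lemma diagram_size_raise_entry:
  assumes "finite {c. D c \<noteq> 0}"
  shows "diagram_size (raise_entry c k D) = diagram_size D + k * cell_size c"
proof -
  let ?A = "insert c {c. D c \<noteq> 0}"
  have "diagram_size (raise_entry c k D) = (\<Sum>c'\<in>?A. raise_entry c k D c' * cell_size c')"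
    using assms by (intro diagram_size_eq) (auto simp: raise_entry_def)
  also have "\<dots> = (\<Sum>c'\<in>?A. D c' * cell_size c' + (if c' = c then k * cell_size c else 0))"
    by (intro sum.cong) (auto simp: raise_entry_def algebra_simps)
  also have "\<dots> = (\<Sum>c'\<in>?A. D c' * cell_size c') + k * cell_size c"
    using assms by (simp add: sum.distrib sum.delta)
  also have "(\<Sum>c'\<in>?A. D c' * cell_size c') = diagram_size D"
    using assms by (intro diagram_size_eq[symmetric]) auto
  finally show ?thesis .
qed

lemma raise_entry_eq_iff: "raise_entry c k D = E \<longleftrightarrow> k \<le> E c \<and> D = E(c := E c - k)"
proof
  assume "raise_entry c k D = E"
  then show "k \<le> E c \<and> D = E(c := E c - k)" by (auto simp: raise_entry_def)
qed (auto simp: raise_entry_def)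

section \<open>The Poisson process of pairs, one level for each multiplicity\<close>

context
  fixes x :: real
  assumes x: "0 < x" "x < 1"
begin

text \<open>Division by zero gives \<open>rate 0 = 0\<close>, so sums over all \<open>k\<close> are
  sums over the multiplicities \<open>k \<ge> 1\<close>.\<close>

definition rate :: "nat \<Rightarrow> real" where "rate k = pair_gf (x ^ k) / real k"

definition random_pair :: "nat \<Rightarrow> (nat \<times> nat) pmf" where
  "random_pair k = pair_pmf (Geom (x ^ k)) (Geom (x ^ k))"

primrec add_pairs :: "nat \<Rightarrow> nat \<Rightarrow> diagram \<Rightarrow> diagram pmf" where
  "add_pairs k 0 D = return_pmf D"
| "add_pairs k (Suc p) D = bind_pmf (random_pair k) (\<lambda>y. add_pairs k p (raise_entry y k D))"

definition level :: "nat \<Rightarrow> diagram \<Rightarrow> diagram pmf" where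
  "level k D = bind_pmf (poisson_pmf (rate k)) (\<lambda>p. add_pairs k p D)"

definition levels :: "nat \<Rightarrow> diagram pmf" where
  "levels K = fold_pmf [1..<K + 1] level zero_diagram"

lemma power_lt_1: "1 \<le> k \<Longrightarrow> x ^ k < 1"
  using x power_less_one_iff[of x k] by auto

lemma rate_pos: "1 \<le> k \<Longrightarrow> 0 < rate k"
  using x power_lt_1[of k] by (auto simp: rate_def pair_gf_def intro!: divide_pos_pos)

lemma rate_nonneg: "0 \<le> rate k"
  using rate_pos[of k] by (cases "k = 0") (auto simp: rate_def)

text \<open>Here \<open>rate k * pmf (random_pair k) c\<close> is the mean number of copies of the
  pair \<open>c\<close> drawn at level \<open>k\<close>. The geometric normalizations
  \<open>(1 - x ^ k)\<^sup>2\<close> cancel the denominator of \<open>pair_gf\<close>, and the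
  factor \<open>k\<close>, by which each copy raises the entry, cancels the \<open>1 / k\<close> in
  the rate.\<close>

lemma pmf_random_pair:
  assumes "1 \<le> k"
  shows "real k * rate k * pmf (random_pair k) c = x ^ (k * cell_size c)"
proof -
  have g: "pmf (Geom (x ^ k)) u = x ^ (k * u) * (1 - x ^ k)" for u
    unfolding Geom_def using x power_lt_1[OF assms] by (subst geometric_pmf.rep_eq) (auto simp: power_mult)
  have "pmf (random_pair k) c = x ^ (k * fst c) * (1 - x ^ k) * (x ^ (k * snd c) * (1 - x ^ k))"
    by (cases c) (simp add: random_pair_def pmf_pair g)
  moreover have "real k * rate k = x ^ k / (1 - x ^ k)\<^sup>2" using assms by (simp add: rate_def pair_gf_def)
  ultimately have "real k * rate k * pmf (random_pair k) c = x ^ k * x ^ (k * fst c) * x ^ (k * snd c)"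
    using power_lt_1[OF assms] by (simp add: power2_eq_square)
  also have "\<dots> = x ^ (k * cell_size c)" by (simp add: cell_size_def power_add algebra_simps)
  finally show ?thesis .
qed

text \<open>The draws do not look at the diagram, so a raise made beforehand can be made
  afterwards.\<close>

lemma add_pairs_raise_entry: "add_pairs k p (raise_entry c k' D) = map_pmf (raise_entry c k') (add_pairs k p D)"
  by (induction p arbitrary: D) (simp_all add: map_bind_pmf raise_entry_commute[of _ k c])

lemma level_raise_entry: "level k (raise_entry c k' D) = map_pmf (raise_entry c k') (level k D)"
  by (simp add: level_def add_pairs_raise_entry map_bind_pmf)

text \<open>Mecke's formula: averaged over the Poisson number \<open>p\<close> of pairs and over all \<open>k\<close>, it gives the
  recursion \<open>E[D c * G D] = (\<Sum>k. x ^ (k * cell_size c) * E[G (raise_entry c k D)])\<close> that determines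
  the law of the diagram.\<close>

lemma nn_integral_add_pairs_entry:
  fixes G :: "diagram \<Rightarrow> ennreal"
  shows "(\<integral>\<^sup>+ D'. of_nat (D' c) * G D' \<partial>add_pairs k p D) =
    of_nat (D c) * (\<integral>\<^sup>+ D'. G D' \<partial>add_pairs k p D) +
    of_nat k * of_nat p * ennreal (pmf (random_pair k) c) * (\<integral>\<^sup>+ D'. G (raise_entry c k D') \<partial>add_pairs k (p - 1) D)"
proof (induction p arbitrary: D)
  case 0
  show ?case by simp
next
  case (Suc p)
  let ?w = "ennreal (pmf (random_pair k) c)"
  define I where "I y = (\<integral>\<^sup>+ D'. G D' \<partial>add_pairs k p (raise_entry y k D))" for y
  define J where "J y = (\<integral>\<^sup>+ D'. G (raise_entry c k D') \<partial>add_pairs k (p - 1) (raise_entry y k D))" for y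
  have Ic: "I c = (\<integral>\<^sup>+ D'. G (raise_entry c k D') \<partial>add_pairs k p D)"
    by (simp add: I_def add_pairs_raise_entry)
  \<comment> \<open>For \<open>p > 0\<close>, averaging \<open>J\<close> over the first pair
    restores a run with \<open>p\<close> pairs; for \<open>p = 0\<close> the factor \<open>p\<close>
    hides the truncated \<open>p - 1\<close>.\<close>
  have J: "of_nat p * (\<integral>\<^sup>+ y. J y \<partial>random_pair k) = of_nat p * I c"
    by (cases p) (simp_all add: J_def Ic)
  have "(\<integral>\<^sup>+ D'. of_nat (D' c) * G D' \<partial>add_pairs k (Suc p) D) =
      (\<integral>\<^sup>+ y. of_nat (raise_entry y k D c) * I y + of_nat k * of_nat p * ?w * J y \<partial>random_pair k)"
    by (simp add: Suc.IH I_def J_def)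
  also have "\<dots> = (\<integral>\<^sup>+ y. of_nat (D c) * I y + (of_nat k * I c * indicator {c} y + of_nat k * of_nat p * ?w * J y) \<partial>random_pair k)"
    by (intro nn_integral_cong) (auto simp: raise_entry_def indicator_def algebra_simps)
  also have "\<dots> = of_nat (D c) * (\<integral>\<^sup>+ y. I y \<partial>random_pair k) +
      (of_nat k * I c * ?w + of_nat k * of_nat p * ?w * (\<integral>\<^sup>+ y. J y \<partial>random_pair k))"
    by (simp add: nn_integral_add nn_integral_cmult nn_integral_cmult_indicator emeasure_pmf_single)
  also have "of_nat k * of_nat p * ?w * (\<integral>\<^sup>+ y. J y \<partial>random_pair k) = of_nat k * ?w * (of_nat p * I c)"
    by (subst J[symmetric]) (simp add: algebra_simps)
  finally show ?case by (simp add: I_def[symmetric] Ic[symmetric] algebra_simps)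
qed

text \<open>The factor \<open>p\<close> left by \<open>nn_integral_add_pairs_entry\<close> is
  absorbed by \<open>nn_integral_poisson_shift\<close>, which also turns \<open>p - 1\<close> pairs
  back into a full Poisson number.\<close>

lemma nn_integral_level_entry:
  fixes G :: "diagram \<Rightarrow> ennreal"
  assumes k: "1 \<le> k"
  shows "(\<integral>\<^sup>+ D'. of_nat (D' c) * G D' \<partial>level k D) =
    of_nat (D c) * (\<integral>\<^sup>+ D'. G D' \<partial>level k D) +
    ennreal (x ^ (k * cell_size c)) * (\<integral>\<^sup>+ D'. G (raise_entry c k D') \<partial>level k D)"
proof -
  let ?w = "ennreal (pmf (random_pair k) c)"
  define J where "J p = (\<integral>\<^sup>+ D'. G (raise_entry c k D') \<partial>add_pairs k p D)" for p
  have "(\<integral>\<^sup>+ D'. of_nat (D' c) * G D' \<partial>level k D) =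
      (\<integral>\<^sup>+ p. of_nat (D c) * (\<integral>\<^sup>+ D'. G D' \<partial>add_pairs k p D) + of_nat k * ?w * (of_nat p * J (p - 1)) \<partial>poisson_pmf (rate k))"
    unfolding level_def nn_integral_bind_pmf nn_integral_add_pairs_entry J_def
    by (intro nn_integral_cong) (simp add: mult_ac)
  also have "\<dots> = of_nat (D c) * (\<integral>\<^sup>+ D'. G D' \<partial>level k D) +
      of_nat k * ?w * (\<integral>\<^sup>+ p. of_nat p * J (p - 1) \<partial>poisson_pmf (rate k))"
    by (simp add: nn_integral_add nn_integral_cmult level_def)
  also have "(\<integral>\<^sup>+ p. of_nat p * J (p - 1) \<partial>poisson_pmf (rate k)) =
      ennreal (rate k) * (\<integral>\<^sup>+ D'. G (raise_entry c k D') \<partial>level k D)"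
    unfolding nn_integral_poisson_shift[OF rate_pos[OF k]] by (simp add: J_def[abs_def] level_def)
  also have "of_nat k * ?w * (ennreal (rate k) * (\<integral>\<^sup>+ D'. G (raise_entry c k D') \<partial>level k D)) =
      ennreal (real k * rate k * pmf (random_pair k) c) * (\<integral>\<^sup>+ D'. G (raise_entry c k D') \<partial>level k D)"
    by (simp add: ennreal_mult' rate_nonneg ennreal_of_nat_eq_real_of_nat mult_ac)
  finally show ?thesis unfolding pmf_random_pair[OF k] .
qed

lemma levels_Suc: "levels (Suc K) = bind_pmf (levels K) (level (Suc K))"
proof -
  have "[1..<Suc K + 1] = [1..<K + 1] @ [Suc K]" by simp
  then show ?thesis unfolding levels_def by (simp only: fold_pmf_append fold_pmf_single)
qed

lemma nn_integral_levels_entry: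
  fixes G :: "diagram \<Rightarrow> ennreal"
  shows "(\<integral>\<^sup>+ D. of_nat (D c) * G D \<partial>levels K) =
    (\<Sum>k=1..K. ennreal (x ^ (k * cell_size c)) * (\<integral>\<^sup>+ D. G (raise_entry c k D) \<partial>levels K))"
proof (induction K arbitrary: G)
  case 0
  show ?case by (simp add: levels_def zero_diagram_def)
next
  case (Suc K)
  let ?w = "\<lambda>k. ennreal (x ^ (k * cell_size c))"
  have "(\<integral>\<^sup>+ D. of_nat (D c) * G D \<partial>levels (Suc K)) =
     (\<integral>\<^sup>+ D. of_nat (D c) * (\<integral>\<^sup>+ D'. G D' \<partial>level (Suc K) D) \<partial>levels K) +
     ?w (Suc K) * (\<integral>\<^sup>+ D'. G (raise_entry c (Suc K) D') \<partial>levels (Suc K))"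
    by (simp add: levels_Suc nn_integral_level_entry nn_integral_add nn_integral_cmult del: mult_Suc)
  \<comment> \<open>The induction hypothesis is applied to the function that averages
    \<open>G\<close> over level \<open>Suc K\<close>; this is why \<open>G\<close> is arbitrary in
    the induction.\<close>
  also have "(\<integral>\<^sup>+ D. of_nat (D c) * (\<integral>\<^sup>+ D'. G D' \<partial>level (Suc K) D) \<partial>levels K) =
     (\<Sum>k=1..K. ?w k * (\<integral>\<^sup>+ D. G (raise_entry c k D) \<partial>levels (Suc K)))"
    unfolding Suc.IH by (simp add: level_raise_entry levels_Suc)
  finally show ?case by (simp add: add.commute)
qed

text \<open>The recursion for \<open>G\<close> the indicator of \<open>{E}\<close>: raising
  \<open>c\<close> by \<open>k\<close> leads to \<open>E\<close> from exactly one diagram if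
  \<open>k \<le> E c\<close>, and from none otherwise, where the subtraction would truncate.\<close>

lemma pmf_levels_entry:
  "real (E c) * pmf (levels K) E =
    (\<Sum>k=1..K. if k \<le> E c then x ^ (k * cell_size c) * pmf (levels K) (E(c := E c - k)) else 0)"
proof -
  have "(\<integral>\<^sup>+ D. of_nat (D c) * indicator {E} D \<partial>levels K) = (\<integral>\<^sup>+ D. of_nat (E c) * indicator {E} D \<partial>levels K)"
    by (intro nn_integral_cong) (auto simp: indicator_def)
  also have "\<dots> = ennreal (real (E c) * pmf (levels K) E)"
    by (simp add: nn_integral_cmult_indicator emeasure_pmf_single ennreal_mult' ennreal_of_nat_eq_real_of_nat)
  finally have 1: "(\<integral>\<^sup>+ D. of_nat (D c) * indicator {E} D \<partial>levels K) = ennreal (real (E c) * pmf (levels K) E)" .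
  have 2: "(\<integral>\<^sup>+ D. indicator {E} (raise_entry c k D) \<partial>levels K) = ennreal (if k \<le> E c then pmf (levels K) (E(c := E c - k)) else 0)" for k
  proof -
    have "(\<integral>\<^sup>+ D. indicator {E} (raise_entry c k D) \<partial>levels K) =
        (\<integral>\<^sup>+ D. indicator (if k \<le> E c then {E(c := E c - k)} else {}) D \<partial>levels K)"
      by (intro nn_integral_cong) (auto simp: indicator_def raise_entry_eq_iff)
    then show ?thesis by (simp add: emeasure_pmf_single)
  qed
  have "ennreal (real (E c) * pmf (levels K) E) =
      (\<Sum>k=1..K. ennreal (if k \<le> E c then x ^ (k * cell_size c) * pmf (levels K) (E(c := E c - k)) else 0))"
    unfolding 1[symmetric] nn_integral_levels_entry 2
    using x by (intro sum.cong) (auto simp: ennreal_mult')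
  also have "\<dots> = ennreal (\<Sum>k=1..K. if k \<le> E c then x ^ (k * cell_size c) * pmf (levels K) (E(c := E c - k)) else 0)"
    using x by (intro sum_ennreal) auto
  finally show ?thesis
    using x by (subst (asm) ennreal_inj) (auto intro!: sum_nonneg)
qed

text \<open>Strong induction over the size. Pick a cell \<open>c\<close> with
  \<open>E c \<noteq> 0\<close>: by the induction hypothesis all the \<open>E c\<close> terms of
  \<open>pmf_levels_entry\<close> have the same value
  \<open>x ^ diagram_size E * pmf (levels K) zero_diagram\<close>, and their number cancels the
  factor \<open>E c\<close> on the left. As \<open>E c \<le> diagram_size E \<le> K\<close>, none of
  these terms is cut off at level \<open>K\<close>.\<close>

lemma pmf_levels:
  assumes "finite {c. E c \<noteq> 0}" "diagram_size E \<le> K"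
  shows "pmf (levels K) E = x ^ diagram_size E * pmf (levels K) zero_diagram"
  using assms
proof (induction "diagram_size E" arbitrary: E rule: less_induct)
  case less
  show ?case
  proof (cases "E = zero_diagram")
    case True
    then show ?thesis by (simp add: diagram_size_def zero_diagram_def)
  next
    case False
    then obtain c where c: "E c \<noteq> 0" by (auto simp: zero_diagram_def fun_eq_iff)
    have sz: "diagram_size (E(c := E c - k)) + k * cell_size c = diagram_size E"
      and fin: "finite {c'. (E(c := E c - k)) c' \<noteq> 0}" if "k \<le> E c" for k
    proof -
      show *: "finite {c'. (E(c := E c - k)) c' \<noteq> 0}"
        by (rule finite_subset[OF _ less.prems(1)]) (use c in \<open>auto split: if_splits\<close>)
      have eq: "raise_entry c k (E(c := E c - k)) = E" using that by (simp add: raise_entry_eq_iff)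
      show "diagram_size (E(c := E c - k)) + k * cell_size c = diagram_size E"
        using diagram_size_raise_entry[OF *, of c k] unfolding eq by (rule sym)
    qed
    have "E c \<le> diagram_size E" using sz[of "E c"] by (simp add: cell_size_def)
    then have "E c \<le> K" using less.prems by simp
    have "real (E c) * pmf (levels K) E =
        (\<Sum>k=1..K. if k \<le> E c then x ^ (k * cell_size c) * pmf (levels K) (E(c := E c - k)) else 0)"
      by (rule pmf_levels_entry)
    also have "\<dots> = (\<Sum>k=1..E c. x ^ (k * cell_size c) * pmf (levels K) (E(c := E c - k)))"
      using \<open>E c \<le> K\<close> by (intro sum.mono_neutral_cong_right) auto
    also have "\<dots> = (\<Sum>k=1..E c. x ^ diagram_size E * pmf (levels K) zero_diagram)"
    proof (intro sum.cong refl)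
      fix k assume k: "k \<in> {1..E c}"
      let ?F = "E(c := E c - k)"
      have "diagram_size ?F < diagram_size E" using sz[of k] k by (simp add: cell_size_def)
      then have "pmf (levels K) ?F = x ^ diagram_size ?F * pmf (levels K) zero_diagram"
        using fin[of k] k less.prems(2) by (intro less.hyps) auto
      then show "x ^ (k * cell_size c) * pmf (levels K) ?F = x ^ diagram_size E * pmf (levels K) zero_diagram"
        using sz[of k] k by (simp add: power_add[symmetric] add.commute)
    qed
    finally show ?thesis using c by simp
  qed
qed

lemma add_pairs_ge: "D' \<in> set_pmf (add_pairs k p D) \<Longrightarrow> D c \<le> D' c"
proof (induction p arbitrary: D)
  case (Suc p)
  then obtain y where "D' \<in> set_pmf (add_pairs k p (raise_entry y k D))" by auto
  from Suc.IH[OF this] show ?case by (auto simp: raise_entry_def split: if_splits)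
qed simp

lemma pmf_level_zero:
  assumes "1 \<le> k"
  shows "pmf (level k D) zero_diagram = indicator {zero_diagram} D * exp (- rate k)"
proof -
  have "pmf (add_pairs k p D) zero_diagram = indicator {0} p * indicator {zero_diagram} D" for p
  proof (cases p)
    case (Suc p')
    have "zero_diagram \<notin> set_pmf (add_pairs k p D)"
    proof
      assume "zero_diagram \<in> set_pmf (add_pairs k p D)"
      then obtain y where "zero_diagram \<in> set_pmf (add_pairs k p' (raise_entry y k D))" using Suc by auto
      from add_pairs_ge[OF this, of y] show False using assms by (simp add: raise_entry_def zero_diagram_def)
    qed
    then show ?thesis using Suc by (simp add: pmf_eq_0_set_pmf del: add_pairs.simps)
  qed (auto simp: indicator_def)
  then have "ennreal (pmf (level k D) zero_diagram) =
      (\<integral>\<^sup>+ p. ennreal (indicator {zero_diagram} D) * indicator {0} p \<partial>poisson_pmf (rate k))"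
    unfolding level_def ennreal_pmf_bind by (intro nn_integral_cong) (auto simp: indicator_def)
  also have "\<dots> = ennreal (indicator {zero_diagram} D * exp (- rate k))"
    using rate_pos[OF assms] by (simp add: nn_integral_cmult_indicator emeasure_pmf_single ennreal_mult')
  finally show ?thesis by simp
qed

lemma pmf_levels_zero: "pmf (levels K) zero_diagram = exp (- (\<Sum>k=1..K. rate k))"
proof (induction K)
  case 0
  show ?case by (simp add: levels_def)
next
  case (Suc K)
  have "ennreal (pmf (levels (Suc K)) zero_diagram) =
      (\<integral>\<^sup>+ D. ennreal (exp (- rate (Suc K))) * indicator {zero_diagram} D \<partial>levels K)"
    unfolding levels_Suc ennreal_pmf_bind
    by (intro nn_integral_cong) (auto simp: pmf_level_zero indicator_def)
  also have "\<dots> = ennreal (exp (- rate (Suc K)) * pmf (levels K) zero_diagram)"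
    by (simp add: nn_integral_cmult_indicator emeasure_pmf_single ennreal_mult')
  finally show ?case using Suc.IH by (simp add: exp_add[symmetric])
qed

end

lemma bind_spmf_of_pmf_of_pmf:
  "bind_spmf (spmf_of_pmf p) (\<lambda>y. spmf_of_pmf (f y)) = spmf_of_pmf (bind_pmf p f)"
  by (simp add: spmf_of_pmf_bind)

lemma upt_Suc_snoc: "[1..<Suc K + 1] = [1..<K + 1] @ [Suc K]"
  by simp

lemma sum_list_upt_ennreal:
  assumes "\<And>k. 0 \<le> f k"
  shows "(\<Sum>k\<leftarrow>[m..<n]. ennreal (f k)) = ennreal (\<Sum>k\<in>{m..<n}. f k)"
  using assms by (simp add: interv_sum_list_conv_sum_set_nat sum_ennreal)

section \<open>Laws and costs of the elementary draws\<close>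

lemma output_law_draw [simp]: "output_law (draw M p) = spmf_of_pmf p"
  by (simp add: output_law_def draw_def pmf.map_comp o_def)

lemma output_law_draw_geom [simp]: "output_law (draw_geom M p) = spmf_of_pmf (Geom p)"
  by (simp add: output_law_def draw_geom_def pmf.map_comp o_def)

text \<open>One bound for all the unit costs, so that each running time becomes a numerical multiple
  of a single constant.\<close>

definition total_cost :: "cost_model \<Rightarrow> real" where
  "total_cost M = real (oracle_cost M + draw_cost M + geom_cost M + arith_cost M + access_cost M + create_cost M)"

lemma total_cost_nonneg [simp]: "0 \<le> total_cost M"
  by (simp add: total_cost_def)

lemma expected_time_draw_le:
  assumes "(\<integral>\<^sup>+ k. of_nat k \<partial>measure_pmf p) \<le> ennreal \<mu>" "0 \<le> \<mu>"
  shows "expected_time (draw M p) \<le> ennreal (total_cost M * (1 + \<mu>))"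
proof -
  have "expected_time (draw M p) =
      (\<integral>\<^sup>+ k. of_nat (oracle_cost M + draw_cost M) + of_nat (draw_cost M) * of_nat k \<partial>measure_pmf p)"
    unfolding expected_time_def draw_def map_spmf_of_pmf spmf_of_pmf_def nn_integral_map_pmf
    by (simp add: algebra_simps)
  also have "\<dots> = of_nat (oracle_cost M + draw_cost M) + of_nat (draw_cost M) * (\<integral>\<^sup>+ k. of_nat k \<partial>measure_pmf p)"
    by (simp add: nn_integral_add nn_integral_cmult measure_pmf.emeasure_space_1)
  also have "\<dots> \<le> of_nat (oracle_cost M + draw_cost M) + of_nat (draw_cost M) * ennreal \<mu>"
    using assms(1) by (intro add_left_mono mult_left_mono) auto
  also have "\<dots> = ennreal (real (oracle_cost M + draw_cost M) + real (draw_cost M) * \<mu>)"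
    using assms(2) by (simp add: ennreal_of_nat_eq_real_of_nat ennreal_mult)
  also have "\<dots> \<le> ennreal (total_cost M * (1 + \<mu>))"
  proof (intro ennreal_leI)
    have "real (draw_cost M) * \<mu> \<le> total_cost M * \<mu>"
      using assms(2) by (intro mult_right_mono) (auto simp: total_cost_def)
    then show "real (oracle_cost M + draw_cost M) + real (draw_cost M) * \<mu> \<le> total_cost M * (1 + \<mu>)"
      by (simp add: total_cost_def algebra_simps)
  qed
  finally show ?thesis .
qed

lemma expected_time_draw_geom: "expected_time (draw_geom M p) = of_nat (oracle_cost M + geom_cost M)"
  unfolding expected_time_def draw_geom_def map_spmf_of_pmf spmf_of_pmf_def nn_integral_map_pmf
  by (simp add: measure_pmf.emeasure_space_1)

lemma expected_time_for_each_real_le: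
  assumes "\<And>i s. i \<in> {m..<n} \<Longrightarrow> expected_time (body i s) \<le> ennreal (b i)" "\<And>i. 0 \<le> b i"
  shows "expected_time (for_each M [m..<n] body s) \<le>
    ennreal (total_cost M * (1 + 2 * real (n - m)) + (\<Sum>i\<in>{m..<n}. b i))"
proof -
  let ?a = "real (arith_cost M)"
  have "expected_time (for_each M [m..<n] body s) \<le>
      of_nat (arith_cost M) + (\<Sum>i\<leftarrow>[m..<n]. of_nat (2 * arith_cost M) + ennreal (b i))"
    using assms(1) by (intro expected_time_for_each_le) auto
  also have "\<dots> = of_nat (arith_cost M) + (\<Sum>i\<leftarrow>[m..<n]. ennreal (2 * ?a + b i))"
    using assms(2) by (simp add: ennreal_of_nat_eq_real_of_nat ennreal_mult)
  also have "\<dots> = ennreal (?a + (\<Sum>i\<in>{m..<n}. 2 * ?a + b i))"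
    using assms(2) by (subst sum_list_upt_ennreal) (auto simp: ennreal_of_nat_eq_real_of_nat sum_nonneg)
  also have "\<dots> \<le> ennreal (total_cost M * (1 + 2 * real (n - m)) + (\<Sum>i\<in>{m..<n}. b i))"
  proof (intro ennreal_leI)
    have "?a * (1 + 2 * real (n - m)) \<le> total_cost M * (1 + 2 * real (n - m))"
      by (intro mult_right_mono) (auto simp: total_cost_def)
    then show "?a + (\<Sum>i\<in>{m..<n}. 2 * ?a + b i) \<le> total_cost M * (1 + 2 * real (n - m)) + (\<Sum>i\<in>{m..<n}. b i)"
      by (simp add: sum.distrib algebra_simps)
  qed
  finally show ?thesis .
qed

section \<open>The sampler with its random top level\<close>

context
  fixes x :: real
  assumes x: "0 < x" "x < 1"
begin

lemma pair_gf_power_nonneg: "0 \<le> pair_gf (x ^ k)"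
  using x by (simp add: pair_gf_def)

lemma summable_pair_gf: "summable (\<lambda>k. pair_gf (x ^ k))"
proof (rule summable_comparison_test')
  show "summable (\<lambda>k. x ^ k / (1 - x)\<^sup>2)"
    using x by (intro summable_divide summable_geometric) auto
  fix k :: nat assume "0 \<le> k"
  show "norm (pair_gf (x ^ k)) \<le> x ^ k / (1 - x)\<^sup>2"
  proof (cases "k = 0")
    case False
    then have "x ^ k \<le> x ^ 1" using x by (intro power_decreasing) auto
    then show ?thesis unfolding pair_gf_def using x
      by (auto intro!: divide_left_mono power_mono mult_pos_pos)
  qed (simp add: pair_gf_def)
qed

lemma rate_le_pair_gf: "rate x k \<le> pair_gf (x ^ k)"
proof (cases "k = 0")
  case False
  then show ?thesis unfolding rate_def[OF x] using frac_le[of "pair_gf (x ^ k)" "pair_gf (x ^ k)" 1 "real k"]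
    pair_gf_power_nonneg[of k] by simp
qed (simp add: rate_def[OF x] pair_gf_def)

lemma summable_rate: "summable (rate x)"
  by (rule summable_comparison_test'[OF summable_pair_gf])
    (use rate_le_pair_gf rate_nonneg[OF x] in auto)

lemma k0_cdf_eq: "k0_cdf x k = exp (- (suminf (rate x) - (\<Sum>i\<le>k. rate x i)))"
proof -
  have s: "summable (\<lambda>i. rate x (i + (k + 1)))" using summable_rate by (subst summable_iff_shift)
  have "k0_cdf x k = (\<Prod>i. exp (- rate x (i + (k + 1))))"
    by (simp add: k0_cdf_def rate_def[OF x] add.commute add.left_commute)
  also have "\<dots> = exp (\<Sum>i. - rate x (i + (k + 1)))"
    by (rule prodinf_exp[OF summable_minus[OF s]])
  also have "(\<Sum>i. - rate x (i + (k + 1))) = - (\<Sum>i. rate x (i + (k + 1)))"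
    by (rule suminf_minus[OF s])
  also have "(\<Sum>i. rate x (i + (k + 1))) = suminf (rate x) - (\<Sum>i<k + 1. rate x i)"
    by (rule suminf_minus_initial_segment[OF summable_rate])
  finally show ?thesis by (simp add: lessThan_Suc_atMost)
qed

lemma k0_cdf_Suc: "k0_cdf x k = k0_cdf x (Suc k) * exp (- rate x (Suc k))"
  by (simp add: k0_cdf_eq exp_add[symmetric])

lemma pmf_k0: "pmf (k0_pmf x) 0 = k0_cdf x 0"
  "pmf (k0_pmf x) (Suc k) = k0_cdf x (Suc k) * (1 - exp (- rate x (Suc k)))"
proof -
  have "(\<Sum>i\<le>k. pmf (k0_pmf x) i) = k0_cdf x k" for k
    using prob_k0_atMost[OF x, of k] by (simp add: measure_measure_pmf_finite)
  from this[of 0] this[of k] this[of "Suc k"]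
  show "pmf (k0_pmf x) 0 = k0_cdf x 0"
    "pmf (k0_pmf x) (Suc k) = k0_cdf x (Suc k) * (1 - exp (- rate x (Suc k)))"
    by (auto simp: k0_cdf_Suc[of k] algebra_simps)
qed

definition draw_rates :: "nat \<Rightarrow> (nat \<Rightarrow> nat) pmf" where
  "draw_rates K = fold_pmf [1..<K + 1] (\<lambda>k p. map_pmf (\<lambda>m. p(k := m)) (poisson_pmf (rate x k))) (\<lambda>_. 0)"

definition fill :: "nat \<Rightarrow> (nat \<Rightarrow> nat) \<Rightarrow> diagram pmf" where
  "fill K p = fold_pmf [1..<K + 1] (\<lambda>k. add_pairs x k (p k)) zero_diagram"

lemma fill_Suc: "fill (Suc K) (p(Suc K := m)) = bind_pmf (fill K p) (add_pairs x (Suc K) m)"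
proof -
  have "fold_pmf [1..<K + 1] (\<lambda>k. add_pairs x k ((p(Suc K := m)) k)) zero_diagram = fill K p"
    unfolding fill_def by (rule fold_pmf_cong) auto
  then show ?thesis unfolding fill_def upt_Suc_snoc fold_pmf_append fold_pmf_single by simp
qed

lemma draw_rates_Suc:
  "draw_rates (Suc K) = bind_pmf (draw_rates K) (\<lambda>p. map_pmf (\<lambda>m. p(Suc K := m)) (poisson_pmf (rate x (Suc K))))"
  unfolding draw_rates_def upt_Suc_snoc fold_pmf_append fold_pmf_single ..

text \<open>The program draws all the numbers of pairs before the first pair, whereas
  \<open>levels\<close> alternates between the two; independence, in the form of
  \<open>bind_commute_pmf\<close>, allows the interchange. The law \<open>q\<close> of the last
  number is kept free, to be Poisson or positive Poisson.\<close>

lemma bind_draw_rates_fill: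
  "bind_pmf (draw_rates K) (\<lambda>p. bind_pmf q (\<lambda>m. fill (Suc K) (p(Suc K := m)))) =
   bind_pmf (bind_pmf (draw_rates K) (fill K)) (\<lambda>D. bind_pmf q (\<lambda>m. add_pairs x (Suc K) m D))"
proof -
  have "bind_pmf q (\<lambda>m. fill (Suc K) (p(Suc K := m))) =
      bind_pmf (fill K p) (\<lambda>D. bind_pmf q (\<lambda>m. add_pairs x (Suc K) m D))" for p
    unfolding fill_Suc by (rule bind_commute_pmf)
  then show ?thesis by (simp add: bind_assoc_pmf)
qed

lemma draw_rates_fill: "bind_pmf (draw_rates K) (fill K) = levels x K"
proof (induction K)
  case 0
  show ?case by (simp add: draw_rates_def fill_def levels_def[OF x] bind_return_pmf)
next
  case (Suc K)
  have "bind_pmf (draw_rates (Suc K)) (fill (Suc K)) =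
      bind_pmf (draw_rates K) (\<lambda>p. bind_pmf (poisson_pmf (rate x (Suc K))) (\<lambda>m. fill (Suc K) (p(Suc K := m))))"
    by (simp add: draw_rates_Suc bind_assoc_pmf bind_map_pmf)
  then show ?case
    unfolding bind_draw_rates_fill Suc.IH levels_Suc[OF x] level_def[OF x, abs_def] .
qed

text \<open>The law of the result given \<open>k\<^sub>0 = K\<close>.\<close>

definition sampler :: "nat \<Rightarrow> diagram pmf" where
  "sampler K = (case K of 0 \<Rightarrow> return_pmf zero_diagram | Suc K' \<Rightarrow>
     bind_pmf (draw_rates K') (\<lambda>p. bind_pmf (pos_poisson_pmf (rate x K)) (\<lambda>m. fill K (p(K := m)))))"

definition Gamma_pmf :: "diagram pmf" where
  "Gamma_pmf = bind_pmf (k0_pmf x) sampler"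

text \<open>Splits the Poisson number at level \<open>Suc K\<close> by whether it is zero; if it is
  positive, the run is one of the sampler with top level \<open>Suc K\<close>.\<close>

lemma pmf_levels_split:
  "pmf (levels x (Suc K)) E = exp (- rate x (Suc K)) * pmf (levels x K) E +
     (1 - exp (- rate x (Suc K))) * pmf (sampler (Suc K)) E"
proof -
  let ?r = "rate x (Suc K)"
  have r: "0 < ?r" using rate_pos[OF x] by simp
  define f where "f m = (\<integral>\<^sup>+ D. ennreal (pmf (add_pairs x (Suc K) m D) E) \<partial>levels x K)" for m
  have f: "f m = ennreal (pmf (bind_pmf (levels x K) (add_pairs x (Suc K) m)) E)" for m
    by (simp add: f_def ennreal_pmf_bind)
  have "ennreal (pmf (levels x (Suc K)) E) = (\<integral>\<^sup>+ m. f m \<partial>poisson_pmf ?r)"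
  proof -
    have "levels x (Suc K) = bind_pmf (poisson_pmf ?r) (\<lambda>m. bind_pmf (levels x K) (add_pairs x (Suc K) m))"
      unfolding levels_Suc[OF x] level_def[OF x, abs_def] by (rule bind_commute_pmf)
    then show ?thesis by (simp add: ennreal_pmf_bind f)
  qed
  also have "\<dots> = ennreal (exp (- ?r)) * f 0 + ennreal (1 - exp (- ?r)) * (\<integral>\<^sup>+ m. f m \<partial>pos_poisson_pmf ?r)"
    by (rule nn_integral_poisson_split[OF r])
  also have "f 0 = ennreal (pmf (levels x K) E)"
  proof -
    have "add_pairs x (Suc K) 0 = return_pmf" by (rule ext) (simp add: add_pairs.simps[OF x])
    then show ?thesis by (simp add: f bind_return_pmf')
  qed
  also have "(\<integral>\<^sup>+ m. f m \<partial>pos_poisson_pmf ?r) = ennreal (pmf (sampler (Suc K)) E)"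
  proof -
    have "sampler (Suc K) = bind_pmf (pos_poisson_pmf ?r) (\<lambda>m. bind_pmf (levels x K) (add_pairs x (Suc K) m))"
      unfolding sampler_def nat.case bind_draw_rates_fill draw_rates_fill by (rule bind_commute_pmf)
    then show ?thesis by (simp add: ennreal_pmf_bind f)
  qed
  finally have "ennreal (pmf (levels x (Suc K)) E) = ennreal (exp (- ?r) * pmf (levels x K) E +
     (1 - exp (- ?r)) * pmf (sampler (Suc K)) E)"
    using r by (simp add: ennreal_mult)
  then show ?thesis using r by (subst (asm) ennreal_inj) auto
qed

text \<open>\<open>k\<^sub>0\<close> is distributed like the highest nonempty level of the process
  with infinitely many levels, and \<open>k0_cdf x N\<close> is the probability that all levels
  above \<open>N\<close> are empty. Given that, the first \<open>N\<close> levels are an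
  unconditioned \<open>levels x N\<close>. The induction telescopes by
  \<open>k0_cdf_Suc\<close>.\<close>

lemma partial_sums_Gamma:
  "(\<Sum>K\<le>N. pmf (k0_pmf x) K * pmf (sampler K) E) = k0_cdf x N * pmf (levels x N) E"
proof (induction N)
  case 0
  have "sampler 0 = levels x 0" by (simp add: sampler_def levels_def[OF x])
  then show ?case by (simp add: pmf_k0)
next
  case (Suc N)
  then show ?case by (simp add: pmf_k0 pmf_levels_split k0_cdf_Suc[of N] algebra_simps)
qed

text \<open>From level \<open>diagram_size E\<close> on the partial sums no longer change, because
  \<open>k0_cdf x N\<close> and the probability of the zero diagram multiply to
  \<open>exp (- suminf (rate x))\<close> for every \<open>N\<close>.\<close>

lemma pmf_Gamma:
  assumes "finite {c. E c \<noteq> 0}"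
  shows "pmf Gamma_pmf E = x ^ diagram_size E * exp (- suminf (rate x))"
proof -
  let ?f = "\<lambda>K. pmf (k0_pmf x) K * pmf (sampler K) E"
  have const: "(\<Sum>K<n. ?f K) = x ^ diagram_size E * exp (- suminf (rate x))" if "diagram_size E < n" for n
  proof -
    from that obtain N where n: "n = Suc N" "diagram_size E \<le> N" by (cases n) auto
    have "(\<Sum>K<n. ?f K) = k0_cdf x N * pmf (levels x N) E"
      unfolding n(1) lessThan_Suc_atMost by (rule partial_sums_Gamma)
    also have "\<dots> = x ^ diagram_size E * (k0_cdf x N * exp (- (\<Sum>k=1..N. rate x k)))"
      by (simp add: pmf_levels[OF x assms n(2)] pmf_levels_zero[OF x])
    also have "(\<Sum>k=1..N. rate x k) = (\<Sum>k\<le>N. rate x k)"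
      by (intro sum.mono_neutral_left) (auto simp: rate_def[OF x] Suc_le_eq)
    finally show ?thesis by (simp add: k0_cdf_eq exp_add[symmetric])
  qed
  have sums: "?f sums (x ^ diagram_size E * exp (- suminf (rate x)))"
    unfolding sums_def
    by (rule tendsto_eventually, rule eventually_sequentiallyI[of "Suc (diagram_size E)"]) (use const in auto)
  have "ennreal (pmf Gamma_pmf E) = (\<integral>\<^sup>+ K. ennreal (?f K) \<partial>count_space UNIV)"
    by (simp add: Gamma_pmf_def ennreal_pmf_bind nn_integral_measure_pmf ennreal_mult')
  also have "\<dots> = (\<Sum>K. ennreal (?f K))" by (simp add: nn_integral_count_space_nat)
  also have "\<dots> = ennreal (x ^ diagram_size E * exp (- suminf (rate x)))"
    by (rule suminf_ennreal_eq[OF _ sums]) simp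
  finally show ?thesis using x by (subst (asm) ennreal_inj) auto
qed

lemma finite_support_Gamma: "set_pmf Gamma_pmf \<subseteq> {D. finite {c. D c \<noteq> 0}}"
proof -
  let ?F = "{D :: diagram. finite {c. D c \<noteq> 0}}"
  have add: "set_pmf (add_pairs x k p D) \<subseteq> ?F" if "D \<in> ?F" for k p D
    using that
  proof (induction p arbitrary: D)
    case (Suc p)
    then show ?case using finite_support_raise_entry by (fastforce simp: set_bind_pmf add_pairs.simps[OF x])
  qed (simp add: add_pairs.simps[OF x])
  have zero: "zero_diagram \<in> ?F" by (simp add: zero_diagram_def)
  have fill: "set_pmf (fill K p) \<subseteq> ?F" for K p
    unfolding fill_def by (intro set_fold_pmf add zero)
  have "set_pmf (sampler K) \<subseteq> ?F" for K
    using fill zero by (cases K) (fastforce simp: sampler_def set_bind_pmf)+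
  then show ?thesis by (fastforce simp: Gamma_pmf_def set_bind_pmf)
qed

lemma output_law_add_random_pair:
  "output_law (add_random_pair M x k D) = spmf_of_pmf (map_pmf (\<lambda>y. raise_entry y k D) (random_pair x k))"
  by (simp add: add_random_pair_def random_pair_def[OF x] pair_pmf_def map_bind_pmf spmf_of_pmf_bind
      raise_entry_def)

lemma output_law_add_random_pairs:
  "output_law (for_each M is (\<lambda>_. add_random_pair M x k) D) = spmf_of_pmf (add_pairs x k (length is) D)"
  by (induction "is" arbitrary: D)
    (simp_all del: for_each.simps add: add_pairs.simps[OF x] output_law_add_random_pair bind_map_pmf spmf_of_pmf_bind)

lemma output_law_draw_multiplicities:
  "output_law (draw_multiplicities M x (Suc K)) =
     spmf_of_pmf (bind_pmf (draw_rates K) (\<lambda>p. map_pmf (\<lambda>m. p(Suc K := m)) (pos_poisson_pmf (rate x (Suc K)))))"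
proof -
  have "output_law (for_each M [1..<Suc K] (\<lambda>k p. bind_prog (draw M (poisson_pmf (pair_gf (x ^ k) / real k)))
      (\<lambda>m. charge (access_cost M) (return_prog (p(k := m))))) (\<lambda>_. 0)) = spmf_of_pmf (draw_rates K)"
    unfolding draw_rates_def Suc_eq_plus1
    by (intro output_law_for_each_eq) (simp add: rate_def[OF x] bind_pmf_return_spmf)
  then show ?thesis
    by (simp add: draw_multiplicities_def spmf_of_pmf_bind rate_def[OF x] bind_pmf_return_spmf del: of_nat_Suc power_Suc)
qed

lemma output_law_fill:
  "output_law (for_each M [1..<K + 1] (\<lambda>k D. charge (access_cost M)
      (for_each M [0..<p k] (\<lambda>_. add_random_pair M x k) D)) zero_diagram) = spmf_of_pmf (fill K p)"
  unfolding fill_def by (intro output_law_for_each_eq) (simp add: output_law_add_random_pairs)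

lemma output_law_Gamma_M: "output_law (Gamma_M M x) = spmf_of_pmf Gamma_pmf"
proof -
  have "output_law (if K = 0 then return_prog zero_diagram
        else bind_prog (draw_multiplicities M x K) (\<lambda>p.
          for_each M [1..<K + 1] (\<lambda>k D. charge (access_cost M)
            (for_each M [0..<p k] (\<lambda>_. add_random_pair M x k) D)) zero_diagram)) = spmf_of_pmf (sampler K)" for K
  proof (cases K)
    case (Suc K')
    have "sampler K = bind_pmf (bind_pmf (draw_rates K')
        (\<lambda>p. map_pmf (\<lambda>m. p(Suc K' := m)) (pos_poisson_pmf (rate x (Suc K'))))) (fill (Suc K'))"
      by (simp add: Suc sampler_def bind_assoc_pmf bind_map_pmf)
    then show ?thesis
      unfolding Suc if_not_P[OF nat.distinct(2)] output_law_bind output_law_fill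
        output_law_draw_multiplicities bind_spmf_of_pmf_of_pmf by (rule sym[OF arg_cong])
  next
    case 0
    show ?thesis unfolding 0 if_P[OF refl] by (simp add: sampler_def)
  qed
  note branch = this
  show ?thesis
    unfolding Gamma_M_def Gamma_pmf_def output_law_bind output_law_charge output_law_draw branch
      bind_spmf_of_pmf_of_pmf ..
qed


subsection \<open>Expected cost of one run\<close>

lemma expected_time_add_random_pair_le:
  "expected_time (add_random_pair M x k D) \<le> ennreal (11 * total_cost M)"
proof -
  have "expected_time (add_random_pair M x k D) \<le> of_nat (oracle_cost M + geom_cost M) +
      (of_nat (oracle_cost M + geom_cost M) + of_nat (2 * access_cost M + 9 * arith_cost M))"
    unfolding add_random_pair_def
    by (intro order_trans[OF expected_time_bind_le[OF expected_time_bind_le]])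
      (auto simp: expected_time_draw_geom)
  also have "\<dots> = ennreal (real (2 * oracle_cost M + 2 * geom_cost M + 2 * access_cost M + 9 * arith_cost M))"
    by (simp add: ennreal_of_nat_eq_real_of_nat ennreal_plus[symmetric] del: ennreal_plus)
  also have "\<dots> \<le> ennreal (11 * total_cost M)"
    by (intro ennreal_leI) (simp add: total_cost_def)
  finally show ?thesis .
qed

lemma expected_time_fill_le:
  "expected_time (for_each M [1..<K + 1] (\<lambda>k D. charge (access_cost M)
      (for_each M [0..<p k] (\<lambda>_. add_random_pair M x k) D)) D) \<le>
    ennreal (total_cost M * (1 + 4 * real K)) + ennreal (13 * total_cost M) * (\<Sum>k=1..K. of_nat (p k))"
proof -
  let ?w = "total_cost M"
  have body: "expected_time (charge (access_cost M) (for_each M [0..<p k] (\<lambda>_. add_random_pair M x k) D)) \<le>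
      ennreal (2 * ?w + 13 * ?w * real (p k))" for k D
  proof -
    have "expected_time (for_each M [0..<p k] (\<lambda>_. add_random_pair M x k) D) \<le>
        ennreal (?w * (1 + 2 * real (p k - 0)) + (\<Sum>i\<in>{0..<p k}. 11 * ?w))"
      by (rule expected_time_for_each_real_le[OF expected_time_add_random_pair_le]) simp
    then have "expected_time (charge (access_cost M) (for_each M [0..<p k] (\<lambda>_. add_random_pair M x k) D)) \<le>
        ennreal ?w + ennreal (?w * (1 + 2 * real (p k)) + (\<Sum>i\<in>{0..<p k}. 11 * ?w))"
      unfolding expected_time_charge diff_zero
      by (intro add_mono) (auto simp: ennreal_of_nat_eq_real_of_nat total_cost_def intro!: ennreal_leI)
    also have "\<dots> = ennreal (2 * ?w + 13 * ?w * real (p k))"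
      by (subst ennreal_plus[symmetric]) (auto simp: algebra_simps)
    finally show ?thesis .
  qed
  have "expected_time (for_each M [1..<K + 1] (\<lambda>k D. charge (access_cost M)
      (for_each M [0..<p k] (\<lambda>_. add_random_pair M x k) D)) D) \<le>
      ennreal (?w * (1 + 2 * real (K + 1 - 1)) + (\<Sum>k\<in>{1..<K + 1}. 2 * ?w + 13 * ?w * real (p k)))"
    by (rule expected_time_for_each_real_le) (use body in auto)
  also have "?w * (1 + 2 * real (K + 1 - 1)) + (\<Sum>k\<in>{1..<K + 1}. 2 * ?w + 13 * ?w * real (p k)) =
      ?w * (1 + 4 * real K) + 13 * ?w * (\<Sum>k=1..K. real (p k))"
    by (simp add: sum.distrib sum_distrib_left atLeastLessThanSuc_atLeastAtMost algebra_simps)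
  also have "ennreal \<dots> = ennreal (?w * (1 + 4 * real K)) + ennreal (13 * ?w) * (\<Sum>k=1..K. of_nat (p k))"
    by (simp add: ennreal_mult ennreal_of_nat_eq_real_of_nat sum_nonneg sum_ennreal)
  finally show ?thesis .
qed

lemma nn_integral_draw_rates:
  "(\<integral>\<^sup>+ p. (\<Sum>k=1..K. of_nat (p k)) \<partial>draw_rates K) = ennreal (\<Sum>k=1..K. rate x k)"
proof (induction K)
  case 0
  show ?case by simp
next
  case (Suc K)
  have "(\<integral>\<^sup>+ p. (\<Sum>k=1..Suc K. of_nat (p k)) \<partial>draw_rates (Suc K)) =
      (\<integral>\<^sup>+ p. \<integral>\<^sup>+ m. (\<Sum>k=1..K. of_nat (p k)) + of_nat m \<partial>poisson_pmf (rate x (Suc K)) \<partial>draw_rates K)"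
    by (simp add: draw_rates_Suc add.commute cong: sum.cong_simp)
  also have "\<dots> = (\<integral>\<^sup>+ p. (\<Sum>k=1..K. of_nat (p k)) \<partial>draw_rates K) + ennreal (rate x (Suc K))"
    using rate_pos[OF x, of "Suc K"]
    by (simp add: nn_integral_add nn_integral_poisson_mean measure_pmf.emeasure_space_1)
  also have "\<dots> = ennreal (\<Sum>k=1..K. rate x k) + ennreal (rate x (Suc K))"
    by (simp only: Suc.IH)
  also have "\<dots> = ennreal (\<Sum>k=1..Suc K. rate x k)"
    using rate_nonneg[OF x] by (simp add: sum_nonneg)
  finally show ?case .
qed

lemma sum_rate_le: "finite A \<Longrightarrow> (\<Sum>k\<in>A. rate x k) \<le> suminf (rate x)"
  by (rule sum_le_suminf[OF summable_rate]) (auto simp: rate_nonneg[OF x])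

lemma expected_time_draw_multiplicities_le:
  "expected_time (draw_multiplicities M x (Suc K)) \<le>
    ennreal (total_cost M * (4 + 4 * real K + suminf (rate x)))"
proof -
  let ?w = "total_cost M"
  have step: "expected_time (bind_prog (draw M q) (\<lambda>m. charge (access_cost M) (return_prog (p(k := m))))) \<le>
      ennreal (?w * (2 + \<mu>))" if "(\<integral>\<^sup>+ k. of_nat k \<partial>measure_pmf q) \<le> ennreal \<mu>" "0 \<le> \<mu>" for q \<mu> p k
  proof -
    have "expected_time (bind_prog (draw M q) (\<lambda>m. charge (access_cost M) (return_prog (p(k := m))))) \<le>
        ennreal (?w * (1 + \<mu>)) + ennreal ?w"
      by (rule order_trans[OF expected_time_bind_le add_mono[OF expected_time_draw_le[OF that] order_refl]])
        (auto simp: ennreal_of_nat_eq_real_of_nat total_cost_def intro!: ennreal_leI)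
    also have "\<dots> = ennreal (?w * (2 + \<mu>))"
      using that(2) by (subst ennreal_plus[symmetric]) (auto simp: algebra_simps)
    finally show ?thesis .
  qed
  have loop: "expected_time (for_each M [1..<Suc K] (\<lambda>k p. bind_prog (draw M (poisson_pmf (pair_gf (x ^ k) / real k)))
      (\<lambda>m. charge (access_cost M) (return_prog (p(k := m))))) (\<lambda>_. 0)) \<le>
      ennreal (?w * (1 + 2 * real (Suc K - 1)) + (\<Sum>k\<in>{1..<Suc K}. ?w * (2 + rate x k)))"
    using rate_pos[OF x] rate_nonneg[OF x]
    by (intro expected_time_for_each_real_le) (auto simp: rate_def[OF x, symmetric] nn_integral_poisson_mean intro!: step)
  have last: "expected_time (bind_prog (draw M (pos_poisson_pmf (pair_gf (x ^ Suc K) / real (Suc K))))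
      (\<lambda>m. charge (access_cost M) (return_prog (p(Suc K := m))))) \<le> ennreal (?w * (3 + rate x (Suc K)))" for p
    using step[OF nn_integral_pos_poisson_mean_le, of "rate x (Suc K)" p "Suc K"] rate_pos[OF x, of "Suc K"]
    by (simp add: rate_def[OF x] del: power_Suc of_nat_Suc)
  have "expected_time (draw_multiplicities M x (Suc K)) \<le>
      ennreal (?w * (1 + 2 * real (Suc K - 1)) + (\<Sum>k\<in>{1..<Suc K}. ?w * (2 + rate x k))) +
      ennreal (?w * (3 + rate x (Suc K)))"
    unfolding draw_multiplicities_def
    by (rule order_trans[OF expected_time_bind_le[OF last] add_right_mono[OF loop]])
  also have "\<dots> = ennreal (?w * (4 + 4 * real K + (\<Sum>k\<in>{1..<Suc (Suc K)}. rate x k)))"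
    using rate_nonneg[OF x] by (subst ennreal_plus[symmetric])
      (auto simp: sum.distrib sum_distrib_left[symmetric] algebra_simps intro!: sum_nonneg add_nonneg_nonneg mult_nonneg_nonneg)
  also have "\<dots> \<le> ennreal (?w * (4 + 4 * real K + suminf (rate x)))"
    using sum_rate_le[of "{1..<Suc (Suc K)}"] by (intro ennreal_leI mult_left_mono) auto
  finally show ?thesis .
qed

text \<open>A top level \<open>k\<close> requires level \<open>k\<close> to be nonempty, so its
  probability is at most \<open>1 - exp (- rate x k) \<le> rate x k\<close>; and
  \<open>k * rate x k = pair_gf (x ^ k)\<close> for \<open>k \<ge> 1\<close>.\<close>

lemma nn_integral_k0_le: "(\<integral>\<^sup>+ k. of_nat k \<partial>k0_pmf x) \<le> ennreal (\<Sum>k. pair_gf (x ^ k))"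
proof -
  have "ennreal (pmf (k0_pmf x) k) * of_nat k \<le> ennreal (pair_gf (x ^ k))" for k
  proof (cases k)
    case (Suc k')
    have "pmf (k0_pmf x) k \<le> 1 * (1 - exp (- rate x k))"
      unfolding Suc pmf_k0 using rate_nonneg[OF x, of "Suc k'"] sum_rate_le[of "{..Suc k'}"]
      by (intro mult_right_mono) (auto simp: k0_cdf_eq)
    also have "\<dots> \<le> rate x k" using exp_ge_add_one_self[of "- rate x k"] by simp
    finally have "pmf (k0_pmf x) k * real k \<le> rate x k * real k" by (intro mult_right_mono) auto
    also have "\<dots> = pair_gf (x ^ k)" using Suc by (simp add: rate_def[OF x])
    finally show ?thesis by (simp add: ennreal_of_nat_eq_real_of_nat ennreal_mult''[symmetric] ennreal_leI)
  qed simp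
  then have "(\<integral>\<^sup>+ k. of_nat k \<partial>k0_pmf x) \<le> (\<integral>\<^sup>+ k. ennreal (pair_gf (x ^ k)) \<partial>count_space UNIV)"
    unfolding nn_integral_measure_pmf by (intro nn_integral_mono) auto
  also have "\<dots> = ennreal (\<Sum>k. pair_gf (x ^ k))"
    unfolding nn_integral_count_space_nat
    by (rule suminf_ennreal2[OF pair_gf_power_nonneg summable_pair_gf])
  finally show ?thesis .
qed

text \<open>All loops are linear in \<open>k\<^sub>0\<close> and in the number of pairs. Given
  \<open>k\<^sub>0\<close>, the mean number of pairs is at most \<open>1 + suminf (rate x)\<close>,
  where the 1 accounts for the forced draw at the top level. Both \<open>suminf (rate x)\<close> and
  the mean of \<open>k\<^sub>0\<close> are bounded by the sum of
  \<open>pair_gf (x ^ k)\<close>.\<close>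

theorem expected_time_Gamma_M_le:
  "expected_time (Gamma_M M x) \<le> ennreal (32 * total_cost M * (1 + (\<Sum>k. pair_gf (x ^ k))))"
proof -
  let ?w = "total_cost M" and ?L = "suminf (rate x)" and ?S = "\<Sum>k. pair_gf (x ^ k)"
  have L: "0 \<le> ?L" using sum_rate_le[of "{}"] by simp
  have LS: "?L \<le> ?S" using rate_le_pair_gf summable_rate summable_pair_gf by (rule suminf_le)
  define T where "T K = (if K = 0 then return_prog zero_diagram
        else bind_prog (draw_multiplicities M x K) (\<lambda>p.
          for_each M [1..<K + 1] (\<lambda>k D. charge (access_cost M)
            (for_each M [0..<p k] (\<lambda>_. add_random_pair M x k) D)) zero_diagram))" for K
  have T: "expected_time (T K) \<le> ennreal (?w * (18 + 14 * ?L)) + ennreal (8 * ?w) * of_nat K" for K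
  proof (cases K)
    case (Suc K')
    define R where "R = bind_pmf (draw_rates K') (\<lambda>p. map_pmf (\<lambda>m. p(K := m)) (pos_poisson_pmf (rate x K)))"
    have mean: "(\<integral>\<^sup>+ p. (\<Sum>k=1..K. of_nat (p k)) \<partial>R) \<le> ennreal (1 + ?L)"
    proof -
      have "(\<integral>\<^sup>+ p. (\<Sum>k=1..K. of_nat (p k)) \<partial>R) =
          (\<integral>\<^sup>+ p. \<integral>\<^sup>+ m. (\<Sum>k=1..K'. of_nat (p k)) + of_nat m \<partial>pos_poisson_pmf (rate x K) \<partial>draw_rates K')"
        by (simp add: R_def Suc add.commute cong: sum.cong_simp)
      also have "\<dots> = ennreal (\<Sum>k=1..K'. rate x k) + (\<integral>\<^sup>+ m. of_nat m \<partial>pos_poisson_pmf (rate x K))"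
        by (simp add: nn_integral_add nn_integral_draw_rates[simplified] measure_pmf.emeasure_space_1)
      also have "\<dots> \<le> ennreal (\<Sum>k=1..K'. rate x k) + ennreal (1 + rate x K)"
        using Suc rate_pos[OF x, of K] by (intro add_left_mono nn_integral_pos_poisson_mean_le) simp
      also have "\<dots> = ennreal (1 + (\<Sum>k=1..K. rate x k))"
        using rate_nonneg[OF x] by (subst ennreal_plus[symmetric]) (auto simp: Suc sum_nonneg)
      also have "\<dots> \<le> ennreal (1 + ?L)" using sum_rate_le[of "{1..K}"] by (intro ennreal_leI) auto
      finally show ?thesis .
    qed
    have "expected_time (T K) = expected_time (draw_multiplicities M x K) +
        (\<integral>\<^sup>+ p. expected_time (for_each M [1..<K + 1] (\<lambda>k D. charge (access_cost M)
            (for_each M [0..<p k] (\<lambda>_. add_random_pair M x k) D)) zero_diagram) \<partial>R)"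
      unfolding T_def using Suc by (simp only: if_False nat.simps expected_time_bind output_law_draw_multiplicities R_def
          measure_spmf_spmf_of_pmf)
    also have "\<dots> \<le> ennreal (?w * (4 + 4 * real K' + ?L)) +
        (\<integral>\<^sup>+ p. ennreal (?w * (1 + 4 * real K)) + ennreal (13 * ?w) * (\<Sum>k=1..K. of_nat (p k)) \<partial>R)"
      unfolding Suc by (intro add_mono nn_integral_mono expected_time_draw_multiplicities_le expected_time_fill_le)
    also have "\<dots> = ennreal (?w * (4 + 4 * real K' + ?L)) + (ennreal (?w * (1 + 4 * real K)) +
        ennreal (13 * ?w) * (\<integral>\<^sup>+ p. (\<Sum>k=1..K. of_nat (p k)) \<partial>R))"
      by (simp add: nn_integral_add nn_integral_cmult measure_pmf.emeasure_space_1)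
    also have "\<dots> \<le> ennreal (?w * (4 + 4 * real K' + ?L)) + (ennreal (?w * (1 + 4 * real K)) +
        ennreal (13 * ?w) * ennreal (1 + ?L))"
      using mean by (intro add_left_mono mult_left_mono) auto
    also have "\<dots> = ennreal (?w * (4 + 4 * real K' + ?L) + (?w * (1 + 4 * real K) + 13 * ?w * (1 + ?L)))"
      using L by (simp add: ennreal_mult)
    also have "\<dots> \<le> ennreal (?w * (18 + 14 * ?L) + 8 * ?w * real K)"
      by (intro ennreal_leI) (simp add: Suc algebra_simps)
    also have "\<dots> = ennreal (?w * (18 + 14 * ?L)) + ennreal (8 * ?w) * of_nat K"
      using L by (simp add: ennreal_mult ennreal_of_nat_eq_real_of_nat)
    finally show ?thesis .
  qed (simp add: T_def)
  have "expected_time (Gamma_M M x) = expected_time (draw M (k0_pmf x)) +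
      (\<integral>\<^sup>+ K. of_nat (2 * create_cost M + arith_cost M) + expected_time (T K) \<partial>k0_pmf x)"
    unfolding Gamma_M_def T_def by (simp only: expected_time_bind expected_time_charge output_law_draw measure_spmf_spmf_of_pmf)
  also have "\<dots> \<le> ennreal (?w * (1 + ?S)) + (\<integral>\<^sup>+ K. ennreal (3 * ?w) +
      (ennreal (?w * (18 + 14 * ?L)) + ennreal (8 * ?w) * of_nat K) \<partial>k0_pmf x)"
    using L LS by (intro add_mono nn_integral_mono T expected_time_draw_le nn_integral_k0_le)
      (auto simp: ennreal_of_nat_eq_real_of_nat total_cost_def simp del: ennreal_plus intro!: ennreal_leI)
  also have "\<dots> = ennreal (?w * (1 + ?S)) + (ennreal (3 * ?w) + (ennreal (?w * (18 + 14 * ?L)) +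
      ennreal (8 * ?w) * (\<integral>\<^sup>+ K. of_nat K \<partial>k0_pmf x)))"
    by (simp add: nn_integral_add nn_integral_cmult measure_pmf.emeasure_space_1)
  also have "\<dots> \<le> ennreal (?w * (1 + ?S)) + (ennreal (3 * ?w) + (ennreal (?w * (18 + 14 * ?L)) +
      ennreal (8 * ?w) * ennreal ?S))"
    using nn_integral_k0_le by (intro add_left_mono mult_left_mono) auto
  also have "\<dots> = ennreal (?w * (1 + ?S) + (3 * ?w + (?w * (18 + 14 * ?L) + 8 * ?w * ?S)))"
    using L LS by (simp add: ennreal_mult)
  also have "\<dots> \<le> ennreal (32 * ?w * (1 + ?S))"
  proof (intro ennreal_leI)
    have "0 \<le> ?w * (10 + 23 * ?S - 14 * ?L)"
      using L LS by (intro mult_nonneg_nonneg) auto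
    then show "?w * (1 + ?S) + (3 * ?w + (?w * (18 + 14 * ?L) + 8 * ?w * ?S)) \<le> 32 * ?w * (1 + ?S)"
      by (simp add: algebra_simps)
  qed
  finally show ?thesis .
qed

end

section \<open>The generating function\<close>

definition diagrams :: "nat \<Rightarrow> diagram set" where
  "diagrams n = {D. finite {c. D c \<noteq> 0} \<and> diagram_size D = n}"

lemma entry_le_diagram_size:
  assumes "finite {c. D c \<noteq> 0}"
  shows "D c * cell_size c \<le> diagram_size D"
proof (cases "D c = 0")
  case False
  have "D c * cell_size c \<le> (\<Sum>c | D c \<noteq> 0. D c * cell_size c)"
    using assms False by (intro member_le_sum) auto
  then show ?thesis using assms by (simp add: diagram_size_eq[of "{c. D c \<noteq> 0}"])
qed simp

lemma finite_diagrams: "finite (diagrams n)"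
proof -
  have "diagrams n \<subseteq> {D. \<forall>c. (c \<in> {..n} \<times> {..n} \<longrightarrow> D c \<in> {..n}) \<and> (c \<notin> {..n} \<times> {..n} \<longrightarrow> D c = 0)}"
  proof (intro subsetI CollectI allI)
    fix D :: diagram and c assume "D \<in> diagrams n"
    then have le: "D c * cell_size c \<le> n"
      using entry_le_diagram_size[of D c] by (simp add: diagrams_def)
    have "D c \<le> D c * cell_size c" by (simp add: cell_size_def)
    then have 1: "D c \<le> n" using le by (rule order_trans)
    have 2: "c \<in> {..n} \<times> {..n}" if "D c \<noteq> 0"
    proof -
      have "1 \<le> D c" using that by simp
      then have "1 * cell_size c \<le> D c * cell_size c" by (rule mult_le_mono1)
      then have "cell_size c \<le> n" using le by linarith
      then have "fst c \<le> n" "snd c \<le> n" unfolding cell_size_def by linarith+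
      then show ?thesis by (simp add: mem_Times_iff)
    qed
    show "(c \<in> {..n} \<times> {..n} \<longrightarrow> D c \<in> {..n}) \<and> (c \<notin> {..n} \<times> {..n} \<longrightarrow> D c = 0)"
      using 1 2 by blast
  qed
  then show ?thesis by (rule finite_subset) (intro finite_set_of_finite_funs; simp)
qed

definition num_diagrams :: "nat \<Rightarrow> nat" where
  "num_diagrams n = card (diagrams n)"

lemma num_diagrams_pos: "0 < num_diagrams n"
proof -
  \<comment> \<open>The cell \<open>(0, 0)\<close> has size 1, so the single entry \<open>n\<close>
    there gives size \<open>n\<close>.\<close>
  have "raise_entry (0, 0) n zero_diagram \<in> diagrams n"
    using diagram_size_raise_entry[of zero_diagram "(0, 0)" n] finite_support_raise_entry[of zero_diagram "(0, 0)" n]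
    by (simp add: diagrams_def zero_diagram_def cell_size_def) (simp add: diagram_size_def)
  then show ?thesis using finite_diagrams by (auto simp: num_diagrams_def card_gt_0_iff)
qed

lemma pmf_size_Gamma:
  assumes x: "0 < x" "x < 1"
  shows "pmf (map_pmf diagram_size (Gamma_pmf x)) n = real (num_diagrams n) * x ^ n * exp (- suminf (rate x))"
proof -
  have "pmf (map_pmf diagram_size (Gamma_pmf x)) n = measure (Gamma_pmf x) (diagram_size -` {n})"
    by (rule pmf_map)
  also have "\<dots> = measure (Gamma_pmf x) (diagrams n)"
    using finite_support_Gamma[OF x]
    by (intro measure_prob_cong_0) (auto simp: diagrams_def set_pmf_iff)
  also have "\<dots> = (\<Sum>D\<in>diagrams n. x ^ n * exp (- suminf (rate x)))"
    unfolding measure_measure_pmf_finite[OF finite_diagrams]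
    by (intro sum.cong) (auto simp: diagrams_def pmf_Gamma[OF x])
  finally show ?thesis by (simp add: num_diagrams_def)
qed

text \<open>Double series are rearranged in \<open>ennreal\<close>, where the order of summation is
  free; this brings the result back to convergent real series.\<close>

lemma sums_of_ennreal_suminf:
  fixes f :: "nat \<Rightarrow> real"
  assumes "\<And>n. 0 \<le> f n" "(\<Sum>n. ennreal (f n)) = ennreal s" "0 \<le> s"
  shows "f sums s"
proof -
  have summ: "summable f"
    by (rule summable_suminf_not_top) (simp_all only: assms ennreal_neq_top not_False_eq_True)
  have "ennreal (suminf f) = ennreal s"
    using suminf_ennreal2[OF assms(1) summ] assms(2) by (rule trans[OF sym])
  then have "suminf f = s"
    using suminf_nonneg[OF summ assms(1)] assms(3) by (subst (asm) ennreal_inj)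
  then show ?thesis using summ by (simp add: sums_iff)
qed

lemma pmf_nat_sums_1: "pmf (p :: nat pmf) sums 1"
proof (rule sums_of_ennreal_suminf)
  have "(\<Sum>n. ennreal (pmf p n)) = emeasure (measure_pmf p) UNIV"
    unfolding nn_integral_count_space_nat[symmetric] by (rule nn_integral_pmf)
  also have "\<dots> = ennreal 1"
    using measure_pmf.emeasure_space_1[of p] by simp
  finally show "(\<Sum>n. ennreal (pmf p n)) = ennreal 1" .
qed (rule pmf_nonneg, rule zero_le_one)

text \<open>The size probabilities of the sampler add up to 1, and multiplying by the normalizing
  factor gives the generating function. The exponent is the logarithm of MacMahon's product.\<close>

lemma num_diagrams_sums:
  assumes x: "0 < x" "x < 1"
  shows "(\<lambda>n. real (num_diagrams n) * x ^ n) sums exp (suminf (rate x))"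
proof -
  have "(\<lambda>n. exp (suminf (rate x)) * pmf (map_pmf diagram_size (Gamma_pmf x)) n) sums (exp (suminf (rate x)) * 1)"
    by (intro sums_mult pmf_nat_sums_1)
  then show ?thesis by (simp add: pmf_size_Gamma[OF x] exp_minus field_simps)
qed

text \<open>The coefficient of \<open>x ^ m\<close> in \<open>suminf (rate x)\<close>: expanding
  \<open>pair_gf (x ^ k) / k\<close> as the sum of \<open>j / k * x ^ (k * j)\<close>, a divisor
  \<open>k\<close> of \<open>m\<close> contributes \<open>m / k\<^sup>2\<close>. In the code the
  divisor is \<open>Suc k\<close>. For \<open>m > 0\<close> the value is the sum of the squared
  divisors of \<open>m\<close>, divided by \<open>m\<close>.\<close>

definition log_coeff :: "nat \<Rightarrow> real" where
  "log_coeff m = (\<Sum>k<m. if Suc k dvd m then real m / (real (Suc k))\<^sup>2 else 0)"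

lemma log_coeff_nonneg: "0 \<le> log_coeff m"
  unfolding log_coeff_def by (intro sum_nonneg) simp

text \<open>The divisor 1 alone gives \<open>m\<close>. This bound reduces the decay of the
  characteristic function to the elementary series of \<open>m * x ^ m\<close>.\<close>

lemma log_coeff_ge: "real m \<le> log_coeff m"
proof (cases m)
  case (Suc m')
  have "(\<Sum>k\<in>{0}. if Suc k dvd m then real m / (real (Suc k))\<^sup>2 else 0) \<le> log_coeff m"
    unfolding log_coeff_def by (rule sum_mono2) (auto simp: Suc)
  then show ?thesis by simp
qed (simp add: log_coeff_def)

lemma sum_inverse_squares_le: "(\<Sum>k<m. 1 / (real (Suc k))\<^sup>2) \<le> 2"
proof -
  \<comment> \<open>The subtracted term makes the induction telescope, by
    \<open>1 / (m + 1)\<^sup>2 \<le> 1 / m - 1 / (m + 1)\<close>.\<close>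
  have "(\<Sum>k<Suc m. 1 / (real (Suc k))\<^sup>2) \<le> 2 - 1 / real (Suc m)" for m
  proof (induction m)
    case (Suc m)
    have "1 / (real (Suc (Suc m)))\<^sup>2 \<le> 1 / (real (Suc m) * real (Suc (Suc m)))"
      unfolding power2_eq_square by (intro frac_le mult_right_mono) auto
    also have "\<dots> = 1 / real (Suc m) - 1 / real (Suc (Suc m))"
    proof -
      have "1 / (a * (1 + a)) = 1 / a - 1 / (1 + a)" if "0 < a" for a :: real
        using that by (simp add: field_simps)
      from this[of "real (Suc m)"] show ?thesis by simp
    qed
    finally have "1 / (real (Suc (Suc m)))\<^sup>2 \<le> 1 / real (Suc m) - 1 / real (Suc (Suc m))" .
    from add_mono[OF Suc.IH this] show ?case unfolding sum.lessThan_Suc[of _ "Suc m"] by simp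
  qed simp
  then have "(\<Sum>k<Suc m. 1 / (real (Suc k))\<^sup>2) \<le> 2" for m
    by (rule order_trans) simp
  then show ?thesis by (cases m) auto
qed

lemma log_coeff_le: "log_coeff m \<le> 2 * real m"
proof -
  have "log_coeff m \<le> (\<Sum>k<m. real m * (1 / (real (Suc k))\<^sup>2))"
    unfolding log_coeff_def by (intro sum_mono) auto
  also have "\<dots> = real m * (\<Sum>k<m. 1 / (real (Suc k))\<^sup>2)" by (simp add: sum_distrib_left)
  also have "\<dots> \<le> real m * 2" by (intro mult_left_mono sum_inverse_squares_le) auto
  finally show ?thesis by simp
qed

text \<open>Summation over pairs \<open>(k, j)\<close> regrouped by the product
  \<open>m = k * j\<close>. The free \<open>g\<close> covers both the series itself and its first
  moment.\<close>

lemma suminf_log_coeff_ennreal: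
  fixes g :: "nat \<Rightarrow> real"
  assumes g: "\<And>m. 0 \<le> g m"
  shows "(\<Sum>m. ennreal (log_coeff m * g m)) = (\<Sum>k. \<Sum>j. ennreal (real j / real (Suc k) * g (Suc k * j)))"
proof -
  define F where "F = (\<lambda>(m, k). ennreal (if Suc k dvd m then real m / (real (Suc k))\<^sup>2 * g m else 0))"
  have inner: "(\<integral>\<^sup>+ k. F (m, k) \<partial>count_space UNIV) = ennreal (log_coeff m * g m)" for m
  proof -
    have "(\<integral>\<^sup>+ k. F (m, k) \<partial>count_space UNIV) = (\<Sum>k<m. F (m, k))"
    proof (rule nn_integral_count_space')
      fix k assume k: "k \<notin> {..<m}"
      show "F (m, k) = 0"
      proof (cases "m = 0")
        case False
        have "\<not> Suc k dvd m"
        proof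
          assume "Suc k dvd m"
          then have "Suc k \<le> m" by (rule dvd_imp_le) (rule \<open>m \<noteq> 0\<close>[THEN bot_nat_0.not_eq_extremum[THEN iffD1]])
          then have "k \<in> {..<m}" by (simp only: lessThan_iff Suc_le_eq)
          with k show False by contradiction
        qed
        then show ?thesis by (simp add: F_def)
      qed (simp add: F_def)
    qed (rule finite_lessThan, rule subset_UNIV)
    also have "\<dots> = ennreal (\<Sum>k<m. if Suc k dvd m then real m / (real (Suc k))\<^sup>2 * g m else 0)"
      unfolding F_def prod.case using g by (intro sum_ennreal) auto
    also have "(\<Sum>k<m. if Suc k dvd m then real m / (real (Suc k))\<^sup>2 * g m else 0) = log_coeff m * g m"
      unfolding log_coeff_def sum_distrib_right by (intro sum.cong) auto
    finally show ?thesis .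
  qed
  have outer: "(\<integral>\<^sup>+ m. F (m, k) \<partial>count_space UNIV) = (\<Sum>j. ennreal (real j / real (Suc k) * g (Suc k * j)))" for k
  proof -
    have "(\<integral>\<^sup>+ m. F (m, k) \<partial>count_space UNIV) = (\<integral>\<^sup>+ m. F (m, k) * indicator (range (\<lambda>j. Suc k * j)) m \<partial>count_space UNIV)"
    proof (intro nn_integral_cong)
      fix m
      have "m \<in> range (\<lambda>j. Suc k * j) \<longleftrightarrow> Suc k dvd m" unfolding dvd_def by blast
      then show "F (m, k) = F (m, k) * indicator (range (\<lambda>j. Suc k * j)) m"
        by (simp add: F_def indicator_def)
    qed
    also have "\<dots> = (\<integral>\<^sup>+ m. F (m, k) \<partial>count_space (range (\<lambda>j. Suc k * j)))"
      by (simp add: nn_integral_count_space_indicator)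
    also have "\<dots> = (\<integral>\<^sup>+ j. F (Suc k * j, k) \<partial>count_space UNIV)"
      by (rule nn_integral_bij_count_space[symmetric]) (simp add: bij_betw_def inj_on_def del: mult_Suc)
    also have "\<dots> = (\<Sum>j. F (Suc k * j, k))" by (simp add: nn_integral_count_space_nat)
    also have "(\<lambda>j. F (Suc k * j, k)) = (\<lambda>j. ennreal (real j / real (Suc k) * g (Suc k * j)))"
      unfolding F_def by (rule ext) (simp add: power2_eq_square del: of_nat_Suc mult_Suc)
    finally show ?thesis .
  qed
  have "(\<Sum>m. ennreal (log_coeff m * g m)) = (\<integral>\<^sup>+ m. \<integral>\<^sup>+ k. F (m, k) \<partial>count_space UNIV \<partial>count_space UNIV)"
    by (simp add: inner nn_integral_count_space_nat)
  also have "\<dots> = (\<integral>\<^sup>+ k. \<integral>\<^sup>+ m. F (m, k) \<partial>count_space UNIV \<partial>count_space UNIV)"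
    unfolding nn_integral_fst_count_space nn_integral_snd_count_space ..
  also have "\<dots> = (\<Sum>k. \<Sum>j. ennreal (real j / real (Suc k) * g (Suc k * j)))"
    by (simp add: outer nn_integral_count_space_nat)
  finally show ?thesis .
qed

text \<open>The negative binomial series, by repeated Cauchy products with the geometric series. It
  sums rising factorials exactly, and powers of \<open>m\<close> are then compared with rising
  factorials.\<close>

lemma choose_power_sums:
  fixes z :: real
  assumes "0 \<le> z" "z < 1"
  shows "(\<lambda>n. real ((r + n) choose r) * z ^ n) sums (1 / (1 - z) ^ Suc r)"
proof (induction r)
  case 0
  show ?case using geometric_sums[of z] assms by simp
next
  case (Suc r)
  have "(\<lambda>n. \<Sum>i\<le>n. (real ((r + i) choose r) * z ^ i) * z ^ (n - i)) sums
      ((\<Sum>n. real ((r + n) choose r) * z ^ n) * (\<Sum>n. z ^ n))"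
    by (rule Cauchy_product_sums) (use assms sums_summable[OF Suc.IH] in \<open>auto simp: abs_mult\<close>)
  moreover have "(\<Sum>i\<le>n. (real ((r + i) choose r) * z ^ i) * z ^ (n - i)) = real ((Suc r + n) choose Suc r) * z ^ n" for n
  proof -
    have "(\<Sum>i\<le>n. (real ((r + i) choose r) * z ^ i) * z ^ (n - i)) = (\<Sum>i\<le>n. real ((r + i) choose r) * z ^ n)"
      by (intro sum.cong) (auto simp: power_add[symmetric] mult.assoc)
    also have "\<dots> = real (\<Sum>i\<le>n. (r + i) choose r) * z ^ n" by (simp add: sum_distrib_right)
    finally show ?thesis by (simp add: choose_rising_sum(1))
  qed
  moreover have "(\<Sum>n. real ((r + n) choose r) * z ^ n) = 1 / (1 - z) ^ Suc r" "(\<Sum>n. z ^ n) = 1 / (1 - z)"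
    using sums_unique[OF Suc.IH] suminf_geometric[of z] assms by auto
  moreover have "1 / (1 - z) ^ Suc r * (1 / (1 - z)) = 1 / (1 - z) ^ Suc (Suc r)" by simp
  ultimately show ?case by (simp only:)
qed

lemma sum_j_sums:
  fixes z :: real
  assumes "0 \<le> z" "z < 1"
  shows "(\<lambda>j. real j * z ^ j) sums (z / (1 - z)\<^sup>2)"
proof -
  have "(\<lambda>j. z * (real ((1 + j) choose 1) * z ^ j)) sums (z * (1 / (1 - z) ^ Suc 1))"
    by (intro sums_mult choose_power_sums assms)
  then have "(\<lambda>j. real (Suc j) * z ^ Suc j) sums (z / (1 - z)\<^sup>2)"
    by (simp add: power2_eq_square algebra_simps)
  then show ?thesis by (subst (asm) sums_Suc_iff) simp
qed

lemma sum_j2_sums: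
  fixes z :: real
  assumes "0 \<le> z" "z < 1"
  shows "(\<lambda>j. (real j)\<^sup>2 * z ^ j) sums (z * (1 + z) / (1 - z) ^ 3)"
proof -
  \<comment> \<open>From \<open>(j + 1)\<^sup>2 = 2 * ((j + 2) choose 2) - (j + 1)\<close>.\<close>
  have "(\<lambda>j. 2 * z * (real ((2 + j) choose 2) * z ^ j) - real (Suc j) * z ^ Suc j) sums
     (2 * z * (1 / (1 - z) ^ Suc 2) - (z / (1 - z)\<^sup>2))"
    using sum_j_sums[OF assms] by (intro sums_diff sums_mult choose_power_sums assms) (subst sums_Suc_iff, simp)
  moreover have "2 * z * (real ((2 + j) choose 2) * z ^ j) - real (Suc j) * z ^ Suc j = (real (Suc j))\<^sup>2 * z ^ Suc j" for j
  proof -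
    have "real ((2 + j) choose 2) * 2 = (real j + 2) * (real j + 1)"
    proof -
      have "(2 + j) * (2 + j - 1) div 2 * 2 = (2 + j) * (2 + j - 1)" by (rule dvd_div_mult_self) simp
      then have "((2 + j) choose 2) * 2 = (j + 2) * (j + 1)" unfolding choose_two by (simp add: add.commute)
      then have "real (((2 + j) choose 2) * 2) = real ((j + 2) * (j + 1))" by (simp only:)
      then show ?thesis by (simp only: of_nat_mult of_nat_add of_nat_1 of_nat_numeral)
    qed
    moreover have "2 * z * (real ((2 + j) choose 2) * z ^ j) = z * z ^ j * (real ((2 + j) choose 2) * 2)"
      by (simp only: mult_ac)
    ultimately have "2 * z * (real ((2 + j) choose 2) * z ^ j) = z * z ^ j * ((real j + 2) * (real j + 1))"
      by (simp only:)
    moreover have "z * z ^ j * ((real j + 2) * (real j + 1)) - real (Suc j) * z ^ Suc j = (real (Suc j))\<^sup>2 * z ^ Suc j"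
      by (simp add: power2_eq_square algebra_simps)
    ultimately show ?thesis by (simp only:)
  qed
  moreover have "2 * z * (1 / (1 - z) ^ Suc 2) - (z / (1 - z)\<^sup>2) = z * (1 + z) / (1 - z) ^ 3"
  proof -
    have "z / u\<^sup>2 = z * u / u ^ 3" if "u \<noteq> 0" for u
      using that by (simp add: power2_eq_square power3_eq_cube)
    then have "z / (1 - z)\<^sup>2 = z * (1 - z) / (1 - z) ^ 3" using assms by simp
    moreover have "2 * z * (1 / (1 - z) ^ Suc 2) = 2 * z / (1 - z) ^ 3" by (simp add: eval_nat_numeral)
    moreover have "2 * z - z * (1 - z) = z * (1 + z)" by (simp add: algebra_simps)
    ultimately show ?thesis by (simp only: diff_divide_distrib[symmetric])
  qed
  ultimately have "(\<lambda>j. (real (Suc j))\<^sup>2 * z ^ Suc j) sums (z * (1 + z) / (1 - z) ^ 3)" by simp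
  then show ?thesis by (subst (asm) sums_Suc_iff) simp
qed

lemma log_coeff_sums:
  assumes x: "0 < x" "x < 1"
  shows "(\<lambda>m. log_coeff m * x ^ m) sums suminf (rate x)"
proof (rule sums_of_ennreal_suminf)
  have pow: "0 \<le> x ^ Suc k" "x ^ Suc k < 1" for k using x power_lt_1[OF x, of "Suc k"] by auto
  have inner: "(\<Sum>j. ennreal (real j / real (Suc k) * x ^ (Suc k * j))) = ennreal (rate x (Suc k))" for k
  proof (rule suminf_ennreal_eq)
    have "(\<lambda>j. 1 / real (Suc k) * (real j * (x ^ Suc k) ^ j)) sums (1 / real (Suc k) * (x ^ Suc k / (1 - x ^ Suc k)\<^sup>2))"
      by (intro sums_mult sum_j_sums pow)
    moreover have "rate x (Suc k) = 1 / real (Suc k) * (x ^ Suc k / (1 - x ^ Suc k)\<^sup>2)"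
      by (simp add: rate_def[OF x] pair_gf_def del: power_Suc of_nat_Suc)
    moreover have "real j / real (Suc k) * x ^ (Suc k * j) = 1 / real (Suc k) * (real j * (x ^ Suc k) ^ j)" for j
      by (simp add: power_mult[symmetric] del: power_Suc of_nat_Suc mult_Suc)
    ultimately show "(\<lambda>j. real j / real (Suc k) * x ^ (Suc k * j)) sums rate x (Suc k)" by (simp only:)
  qed (use x in auto)
  have "(\<Sum>m. ennreal (log_coeff m * x ^ m)) = (\<Sum>k. ennreal (rate x (Suc k)))"
    using suminf_log_coeff_ennreal[of "\<lambda>m. x ^ m"] x by (simp only: inner) simp
  also have "\<dots> = ennreal (suminf (rate x))"
  proof (rule suminf_ennreal_eq)
    show "(\<lambda>k. rate x (Suc k)) sums suminf (rate x)"
      using summable_sums[OF summable_rate[OF x]] by (subst sums_Suc_iff) (simp add: rate_def[OF x])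
  qed (rule rate_nonneg[OF x])
  finally show "(\<Sum>m. ennreal (log_coeff m * x ^ m)) = ennreal (suminf (rate x))" .
  show "0 \<le> suminf (rate x)" using rate_nonneg[OF x] summable_rate[OF x] by (intro suminf_nonneg)
qed (intro mult_nonneg_nonneg log_coeff_nonneg zero_le_power of_nat_0_le_iff less_imp_le[OF x(1)])

text \<open>The closed form of the sum of \<open>j\<^sup>2 * y ^ j\<close>; at
  \<open>y = x ^ k\<close> it is the contribution of level \<open>k\<close> to the mean
  size.\<close>

definition mean_term :: "real \<Rightarrow> real" where
  "mean_term y = y * (1 + y) / (1 - y) ^ 3"

lemma log_coeff_mean_sums:
  assumes x: "0 < x" "x < 1" and summ: "summable (\<lambda>k. mean_term (x ^ Suc k))"
  shows "(\<lambda>m. real m * (log_coeff m * x ^ m)) sums (\<Sum>k. mean_term (x ^ Suc k))"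
proof (rule sums_of_ennreal_suminf)
  have pow: "0 \<le> x ^ Suc k" "x ^ Suc k < 1" for k using x power_lt_1[OF x, of "Suc k"] by auto
  have nonneg: "0 \<le> mean_term (x ^ Suc k)" for k
    unfolding mean_term_def using pow[of k] by (intro divide_nonneg_nonneg mult_nonneg_nonneg) auto
  have inner: "(\<Sum>j. ennreal (real j / real (Suc k) * (real (Suc k * j) * x ^ (Suc k * j)))) = ennreal (mean_term (x ^ Suc k))" for k
  proof (rule suminf_ennreal_eq)
    have "(\<lambda>j. (real j)\<^sup>2 * (x ^ Suc k) ^ j) sums mean_term (x ^ Suc k)"
      unfolding mean_term_def by (intro sum_j2_sums pow)
    moreover have "(real j)\<^sup>2 * (x ^ Suc k) ^ j = real j / real (Suc k) * (real (Suc k * j) * x ^ (Suc k * j))" for j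
      by (simp add: power_mult[symmetric] power2_eq_square del: power_Suc of_nat_Suc mult_Suc)
    ultimately show "(\<lambda>j. real j / real (Suc k) * (real (Suc k * j) * x ^ (Suc k * j))) sums mean_term (x ^ Suc k)"
      by (simp only:)
  qed (use x in auto)
  have "(\<Sum>m. ennreal (real m * (log_coeff m * x ^ m))) = (\<Sum>m. ennreal (log_coeff m * (real m * x ^ m)))"
    by (simp add: mult_ac)
  also have "\<dots> = (\<Sum>k. ennreal (mean_term (x ^ Suc k)))"
    using suminf_log_coeff_ennreal[of "\<lambda>m. real m * x ^ m"] x by (simp only: inner) simp
  also have "\<dots> = ennreal (\<Sum>k. mean_term (x ^ Suc k))"
    by (rule suminf_ennreal2[OF nonneg summ])
  finally show "(\<Sum>m. ennreal (real m * (log_coeff m * x ^ m))) = ennreal (\<Sum>k. mean_term (x ^ Suc k))" .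
  show "0 \<le> (\<Sum>k. mean_term (x ^ Suc k))" using nonneg summ by (intro suminf_nonneg)
qed (intro mult_nonneg_nonneg log_coeff_nonneg zero_le_power of_nat_0_le_iff less_imp_le[OF x(1)])

lemma summable_norm_powser:
  fixes f :: "nat \<Rightarrow> real" and z :: complex
  assumes "\<And>x. 0 < x \<Longrightarrow> x < 1 \<Longrightarrow> summable (\<lambda>n. f n * x ^ n)" "norm z < 1"
  shows "summable (\<lambda>n. norm (of_real (f n) * z ^ n))"
proof -
  define x where "x = (norm z + 1) / 2"
  have x: "norm z < x" "0 < x" "x < 1" using assms(2) norm_ge_zero[of z] by (auto simp: x_def simp del: norm_ge_zero)
  have "summable (\<lambda>n. norm (f n * norm z ^ n))"
    using assms(1)[OF x(2,3)] by (rule powser_insidea) (use x in simp)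
  then show ?thesis by (simp add: norm_mult norm_power abs_mult)
qed

text \<open>On (0,1) the identity combines \<open>num_diagrams_sums\<close> with
  \<open>log_coeff_sums\<close>. Both sides are holomorphic in the unit disc, so it extends to the
  disc; the points \<open>x * iexp \<theta>\<close> then give the characteristic function of the
  size.\<close>

theorem num_diagrams_gf:
  fixes z :: complex
  assumes z: "norm z < 1"
  shows "(\<lambda>n. of_nat (num_diagrams n) * z ^ n) sums exp (\<Sum>m. of_real (log_coeff m) * z ^ m)"
proof -
  define F where "F w = (\<Sum>n. of_real (real (num_diagrams n)) * w ^ n)" for w :: complex
  define L where "L w = (\<Sum>m. of_real (log_coeff m) * w ^ m)" for w :: complex
  have F: "(\<lambda>n. of_real (real (num_diagrams n)) * w ^ n) sums F w" if "norm w < 1" for w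
    unfolding F_def using num_diagrams_sums that
    by (intro summable_sums summable_norm_cancel[OF summable_norm_powser]) (auto simp: sums_iff)
  have L: "(\<lambda>m. of_real (log_coeff m) * w ^ m) sums L w" if "norm w < 1" for w
    unfolding L_def using log_coeff_sums that
    by (intro summable_sums summable_norm_cancel[OF summable_norm_powser]) (auto simp: sums_iff)
  have holF: "F holomorphic_on ball 0 1"
    by (rule power_series_holomorphic[where a = "\<lambda>n. of_real (real (num_diagrams n))"]) (use F in simp)
  have "L holomorphic_on ball 0 1"
    by (rule power_series_holomorphic[where a = "\<lambda>n. of_real (log_coeff n)"]) (use L in simp)
  then have hol: "(\<lambda>w. F w - exp (L w)) holomorphic_on ball 0 1"
    using holF by (intro holomorphic_intros)
  have eq: "F (of_real x) - exp (L (of_real x)) = 0" if x: "0 < x" "x < 1" for x :: real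
  proof -
    have "(\<lambda>m. complex_of_real (log_coeff m) * of_real x ^ m) sums of_real (suminf (rate x))"
      using sums_of_real[OF log_coeff_sums[OF x], where 'a = complex] by simp
    moreover have "(\<lambda>n. complex_of_real (real (num_diagrams n)) * of_real x ^ n) sums of_real (exp (suminf (rate x)))"
      using sums_of_real[OF num_diagrams_sums[OF x], where 'a = complex] by simp
    moreover have "norm (complex_of_real x) < 1" using x by simp
    ultimately have "L (of_real x) = of_real (suminf (rate x))" "F (of_real x) = of_real (exp (suminf (rate x)))"
      using F[of "of_real x"] L[of "of_real x"] sums_unique2 by blast+
    then show ?thesis by (simp add: exp_of_real)
  qed
  have "(1 / 2 :: real) islimpt {0<..<1}"
    by (rule interior_limit_point) (simp add: interior_open)
  then have lim: "complex_of_real (1 / 2) islimpt (of_real ` {0<..<1})"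
  proof (rule islimpt_isCont_image)
    show "\<forall>\<^sub>F y in at (1 / 2). complex_of_real y \<noteq> complex_of_real (1 / 2)"
      unfolding of_real_eq_iff eventually_at_filter by simp
  qed auto
  have "F z - exp (L z) = 0"
    by (rule analytic_continuation[OF hol _ _ _ _ lim]) (use z eq in auto)
  then show ?thesis using F[OF z] by (simp add: L_def)
qed

section \<open>Moments\<close>

lemma choose3_real: "6 * real ((3 + n) choose 3) = (real n + 1) * (real n + 2) * (real n + 3)"
proof -
  have "((3 + n) choose 3) * 3 = (3 + n) * ((2 + n) choose 2)" "((2 + n) choose 2) * 2 = (2 + n) * (1 + n)"
    using Suc_times_binomial_eq[of "2 + n" 2] Suc_times_binomial_eq[of "1 + n" 1] by (simp_all add: eval_nat_numeral)
  from arg_cong[OF this(1), of real] arg_cong[OF this(2), of real]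
  have "real ((3 + n) choose 3) * 3 = (3 + real n) * real ((2 + n) choose 2)"
    "real ((2 + n) choose 2) * 2 = (2 + real n) * (1 + real n)"
    by (simp_all only: of_nat_mult of_nat_add of_nat_numeral of_nat_1)
  then show ?thesis by algebra
qed

lemma choose4_real: "24 * real ((4 + n) choose 4) = (real n + 1) * (real n + 2) * (real n + 3) * (real n + 4)"
proof -
  have "((4 + n) choose 4) * 4 = (4 + n) * ((3 + n) choose 3)"
    using Suc_times_binomial_eq[of "3 + n" 3] by (simp_all add: eval_nat_numeral)
  from arg_cong[OF this, of real] have "real ((4 + n) choose 4) * 4 = (4 + real n) * real ((3 + n) choose 3)"
    by (simp only: of_nat_mult of_nat_add of_nat_numeral)
  then show ?thesis using choose3_real[of n] by algebra
qed

context
  fixes x :: real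
  assumes x: "0 < x" "x < 1"
begin

text \<open>Comparison with rising factorials:
  \<open>m ^ 3 \<le> (m + 1) * (m + 2) * (m + 3)\<close> for the upper bound, and
  \<open>(m + 1) * (m + 2) * (m + 3) \<le> (m + 3) ^ 3\<close> for the lower one, where the shift by
  3 is the source of the factor \<open>x ^ 3\<close>.\<close>

lemma cubes_sums_bounds:
  shows "summable (\<lambda>m. real m ^ 3 * x ^ m)" (is ?A)
    and "(\<Sum>m. real m ^ 3 * x ^ m) \<le> 6 / (1 - x) ^ 4" (is ?B)
    and "6 * x ^ 3 / (1 - x) ^ 4 \<le> (\<Sum>m. real m ^ 3 * x ^ m)" (is ?C)
proof -
  have S: "(\<lambda>n. 6 * (real ((3 + n) choose 3) * x ^ n)) sums (6 * (1 / (1 - x) ^ Suc 3))"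
    by (intro sums_mult choose_power_sums) (use x in auto)
  then have S': "(\<lambda>n. 6 * real ((3 + n) choose 3) * x ^ n) sums (6 / (1 - x) ^ 4)"
    by (simp add: eval_nat_numeral mult_ac)
  have le: "real n ^ 3 * x ^ n \<le> 6 * real ((3 + n) choose 3) * x ^ n" for n
    unfolding choose3_real power3_eq_cube by (intro mult_right_mono mult_mono) (use x in auto)
  show A: ?A
    by (rule summable_comparison_test'[OF sums_summable[OF S']]) (use le x in auto)
  show ?B using suminf_le[OF le A sums_summable[OF S']] sums_unique[OF S'] by simp
  have "6 * x ^ 3 / (1 - x) ^ 4 = (\<Sum>n. x ^ 3 * (6 * real ((3 + n) choose 3) * x ^ n))"
    using sums_unique[OF sums_mult[OF S', of "x ^ 3"]] by (simp add: mult.commute)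
  also have "\<dots> \<le> (\<Sum>n. real (n + 3) ^ 3 * x ^ (n + 3))"
  proof (rule suminf_le)
    show "x ^ 3 * (6 * real ((3 + n) choose 3) * x ^ n) \<le> real (n + 3) ^ 3 * x ^ (n + 3)" for n
    proof -
      have "6 * real ((3 + n) choose 3) \<le> real (n + 3) ^ 3"
        unfolding choose3_real power3_eq_cube by (intro mult_mono) auto
      from mult_right_mono[OF this, of "x ^ (n + 3)"] show ?thesis using x by (simp add: power_add mult_ac)
    qed
    show "summable (\<lambda>n. x ^ 3 * (6 * real ((3 + n) choose 3) * x ^ n))"
      by (intro summable_mult sums_summable[OF S'])
    show "summable (\<lambda>n. real (n + 3) ^ 3 * x ^ (n + 3))"
      by (rule summable_ignore_initial_segment[OF A])
  qed
  also have "\<dots> = (\<Sum>m. real m ^ 3 * x ^ m) - (\<Sum>m<3. real m ^ 3 * x ^ m)"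
    by (rule suminf_minus_initial_segment[OF A])
  also have "\<dots> \<le> (\<Sum>m. real m ^ 3 * x ^ m)"
    using x by (simp add: sum_nonneg)
  finally show ?C .
qed

lemma fourth_powers_sums_bounds:
  shows "summable (\<lambda>m. real m ^ 4 * x ^ m)" (is ?A)
    and "(\<Sum>m. real m ^ 4 * x ^ m) \<le> 24 / (1 - x) ^ 5" (is ?B)
proof -
  have S: "(\<lambda>n. 24 * (real ((4 + n) choose 4) * x ^ n)) sums (24 * (1 / (1 - x) ^ Suc 4))"
    by (intro sums_mult choose_power_sums) (use x in auto)
  then have S': "(\<lambda>n. 24 * real ((4 + n) choose 4) * x ^ n) sums (24 / (1 - x) ^ 5)"
    by (simp add: eval_nat_numeral mult_ac)
  have le: "real n ^ 4 * x ^ n \<le> 24 * real ((4 + n) choose 4) * x ^ n" for n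
  proof -
    have "real n * real n * real n * real n \<le> (real n + 1) * (real n + 2) * (real n + 3) * (real n + 4)"
      by (intro mult_mono) auto
    then have "real n ^ 4 \<le> 24 * real ((4 + n) choose 4)"
      unfolding choose4_real by (simp add: eval_nat_numeral mult_ac)
    then show ?thesis using x by (intro mult_right_mono) auto
  qed
  show A: ?A
    by (rule summable_comparison_test'[OF sums_summable[OF S']]) (use le x in auto)
  show ?B using suminf_le[OF le A sums_summable[OF S']] sums_unique[OF S'] by simp
qed

text \<open>The generating function is the exponential of the series of \<open>log_coeff\<close>, so
  the size is a compound Poisson variable with intensity \<open>weight m\<close> for jumps of size
  \<open>m\<close>. Power sums of the intensities are its cumulants: \<open>size_var\<close> is the
  variance and \<open>third_moment\<close> the third cumulant.\<close>

definition weight :: "nat \<Rightarrow> real" where "weight m = log_coeff m * x ^ m"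

definition size_var :: real where "size_var = (\<Sum>m. (real m)\<^sup>2 * weight m)"

definition third_moment :: real where "third_moment = (\<Sum>m. real m ^ 3 * weight m)"

lemma weight_nonneg: "0 \<le> weight m"
  unfolding weight_def by (intro mult_nonneg_nonneg log_coeff_nonneg) (use x in simp)

lemma weight_le: "weight m \<le> 2 * real m * x ^ m"
  unfolding weight_def by (intro mult_right_mono log_coeff_le) (use x in simp)

lemma weight_ge: "real m * x ^ m \<le> weight m"
  unfolding weight_def by (intro mult_right_mono log_coeff_ge) (use x in simp)

lemma summable_weight: "summable weight" and suminf_weight: "suminf weight = suminf (rate x)"
  using log_coeff_sums[OF x] unfolding weight_def[abs_def] by (simp_all add: sums_iff)

lemma size_var_bounds:
  shows "summable (\<lambda>m. (real m)\<^sup>2 * weight m)" (is ?A)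
    and "size_var \<le> 12 / (1 - x) ^ 4" (is ?B)
    and "6 * x ^ 3 / (1 - x) ^ 4 \<le> size_var" (is ?C)
proof -
  have le: "(real m)\<^sup>2 * weight m \<le> 2 * (real m ^ 3 * x ^ m)" for m
    using mult_left_mono[OF weight_le, of "(real m)\<^sup>2" m] by (simp add: power2_eq_square power3_eq_cube mult_ac)
  have ge: "real m ^ 3 * x ^ m \<le> (real m)\<^sup>2 * weight m" for m
    using mult_left_mono[OF weight_ge, of "(real m)\<^sup>2" m] by (simp add: power2_eq_square power3_eq_cube mult_ac)
  have nonneg: "0 \<le> (real m)\<^sup>2 * weight m" for m by (intro mult_nonneg_nonneg weight_nonneg) simp
  have S: "summable (\<lambda>m. 2 * (real m ^ 3 * x ^ m))" by (rule summable_mult[OF cubes_sums_bounds(1)])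
  show A: ?A
    by (rule summable_comparison_test'[OF S, of 0]) (simp only: real_norm_def abs_of_nonneg[OF nonneg] le)
  have "size_var \<le> 2 * (\<Sum>m. real m ^ 3 * x ^ m)"
    unfolding size_var_def suminf_mult[OF cubes_sums_bounds(1), symmetric] by (rule suminf_le[OF le A S])
  then show ?B using cubes_sums_bounds(2) by simp
  have "(\<Sum>m. real m ^ 3 * x ^ m) \<le> size_var"
    unfolding size_var_def by (rule suminf_le[OF ge cubes_sums_bounds(1) A])
  then show ?C using cubes_sums_bounds(3) by simp
qed

lemma third_moment_bounds:
  shows "summable (\<lambda>m. real m ^ 3 * weight m)" (is ?A)
    and "third_moment \<le> 48 / (1 - x) ^ 5" (is ?B)
proof -
  have le: "real m ^ 3 * weight m \<le> 2 * (real m ^ 4 * x ^ m)" for m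
    using mult_left_mono[OF weight_le, of "real m ^ 3" m] by (simp add: eval_nat_numeral mult_ac)
  have nonneg: "0 \<le> real m ^ 3 * weight m" for m by (intro mult_nonneg_nonneg weight_nonneg) simp
  have S: "summable (\<lambda>m. 2 * (real m ^ 4 * x ^ m))" by (rule summable_mult[OF fourth_powers_sums_bounds(1)])
  show A: ?A
    by (rule summable_comparison_test'[OF S, of 0]) (simp only: real_norm_def abs_of_nonneg[OF nonneg] le)
  have "third_moment \<le> 2 * (\<Sum>m. real m ^ 4 * x ^ m)"
    unfolding third_moment_def suminf_mult[OF fourth_powers_sums_bounds(1), symmetric] by (rule suminf_le[OF le A S])
  then show ?B using fourth_powers_sums_bounds(2) by simp
qed

end

subsection \<open>The mean\<close>

lemma inverse_cube_le: "1 / real (Suc k) ^ 3 \<le> 1 / (real (Suc k))\<^sup>2"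
  by (intro divide_left_mono power_increasing) auto

lemma summable_inverse_powers:
  "summable (\<lambda>k. 1 / (real (Suc k))\<^sup>2)" "summable (\<lambda>k. 1 / real (Suc k) ^ 3)"
proof -
  show s2: "summable (\<lambda>k. 1 / (real (Suc k))\<^sup>2)"
  proof -
    have "summable (\<lambda>n. inverse ((real n)\<^sup>2))" by (rule inverse_power_summable) simp
    then show ?thesis by (subst (asm) summable_Suc_iff[symmetric]) (simp only: inverse_eq_divide)
  qed
  show "summable (\<lambda>k. 1 / real (Suc k) ^ 3)"
    by (rule summable_comparison_test'[OF s2, of 0]) (use inverse_cube_le in simp)
qed

lemma suminf_inverse_squares_le: "(\<Sum>k. 1 / (real (Suc k))\<^sup>2) \<le> 2"
  by (rule suminf_le_const[OF summable_inverse_powers(1) sum_inverse_squares_le])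

lemma riemann_zeta_3: "riemann_zeta 3 = (\<Sum>k. 1 / real (Suc k) ^ 3)"
  unfolding riemann_zeta_def by (intro suminf_cong) simp

lemma one_minus_power_le:
  assumes "0 < t" "t < (1::real)"
  shows "1 - (1 - t) ^ k \<le> real k * t"
  using Bernoulli_inequality[of "- t" k] assms by simp

text \<open>With \<open>x ^ k = exp (- v)\<close> one has \<open>v \<ge> k * t\<close>, and \<open>pair_gf (exp (- v)) = 1 / (2 * sinh (v / 2))\<^sup>2\<close>.\<close>

lemma power_estimates:
  fixes t :: real
  assumes t: "0 < t" "t < 1"
  defines "y \<equiv> \<lambda>k. (1 - t) ^ Suc k"
  shows "0 < y k" "y k < 1" "pair_gf (y k) \<le> 1 / (real (Suc k) * t)\<^sup>2"
    and "y k / (1 - y k) \<le> 1 / (real (Suc k) * t)"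
proof -
  define K where "K = real (Suc k) * t"
  define v where "v = - ln (y k)"
  have K: "0 < K" using t by (simp add: K_def)
  show y: "0 < y k" "y k < 1" using t power_less_one_iff[of "1 - t" "Suc k"] by (auto simp: y_def simp del: power_Suc)
  have "ln (1 - t) \<le> - t" using ln_le_minus_one[of "1 - t"] t by simp
  moreover have "v = real (Suc k) * (- ln (1 - t))"
    unfolding v_def y_def using t by (subst ln_realpow) auto
  ultimately have v: "K \<le> v" unfolding K_def by (metis le_minus_iff mult_left_mono of_nat_0_le_iff)
  have yv: "y k = exp (- v)" using y by (simp add: v_def)
  have "v / 2 \<le> (exp (v / 2) - inverse (exp (v / 2))) / 2"
    using K v by (intro real_le_x_sinh) simp
  then have "K \<le> exp (v / 2) - exp (- (v / 2))" using v by (simp add: exp_minus)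
  then have "K * exp (- (v / 2)) \<le> (exp (v / 2) - exp (- (v / 2))) * exp (- (v / 2))"
    by (rule mult_right_mono) simp
  also have "\<dots> = 1 - y k" by (simp add: yv left_diff_distrib exp_add[symmetric])
  finally have "(K * exp (- (v / 2)))\<^sup>2 \<le> (1 - y k)\<^sup>2"
    using K by (intro power_mono) auto
  moreover have "(exp (- (v / 2)))\<^sup>2 = y k"
    unfolding yv power2_eq_square exp_add[symmetric] by simp
  ultimately have "K\<^sup>2 * y k \<le> (1 - y k)\<^sup>2" by (simp add: power_mult_distrib)
  then show "pair_gf (y k) \<le> 1 / (real (Suc k) * t)\<^sup>2"
    unfolding pair_gf_def K_def[symmetric] using y K by (simp add: divide_simps mult.commute)
  have "(1 + K) * y k \<le> exp v * y k"
  proof (rule mult_right_mono)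
    show "1 + K \<le> exp v" using exp_ge_add_one_self[of v] v by linarith
  qed (use y in simp)
  also have "\<dots> = 1" by (simp add: yv exp_add[symmetric])
  finally have "K * y k \<le> 1 - y k" by (simp add: algebra_simps)
  then show "y k / (1 - y k) \<le> 1 / (real (Suc k) * t)"
    unfolding K_def[symmetric] using y K by (simp add: divide_simps mult.commute)
qed

text \<open>Let \<open>K = (k + 1) * t\<close> and \<open>y = (1 - t) ^ (k + 1)\<close>. The upper
  bound comes from \<open>mean_term y = pair_gf y * (1 + 2 * (y / (1 - y)))\<close>. For the lower
  one, \<open>1 - y \<le> K\<close> gives
  \<open>y * (1 + y) \<ge> (1 - K) * (2 - K) \<ge> 2 - 3 * K\<close>, and for
  \<open>2 \<le> 3 * K\<close> the left-hand side is not positive.\<close>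

lemma mean_term_bounds:
  fixes t :: real
  assumes t: "0 < t" "t < 1"
  shows "mean_term ((1 - t) ^ Suc k) \<le> 2 / (real (Suc k) * t) ^ 3 + 1 / (real (Suc k) * t)\<^sup>2" (is ?A)
    and "2 / (real (Suc k) * t) ^ 3 - 3 / (real (Suc k) * t)\<^sup>2 \<le> mean_term ((1 - t) ^ Suc k)" (is ?B)
    and "0 \<le> mean_term ((1 - t) ^ Suc k)" (is ?C)
proof -
  define K where "K = real (Suc k) * t"
  define y where "y = (1 - t) ^ Suc k"
  have K: "0 < K" using t by (simp add: K_def)
  have y: "0 < y" "y < 1" "pair_gf y \<le> 1 / K\<^sup>2" "y / (1 - y) \<le> 1 / K"
    using power_estimates[OF t, of k] unfolding y_def K_def by blast+
  have "mean_term y = pair_gf y * (1 + 2 * (y / (1 - y)))"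
    using y unfolding mean_term_def pair_gf_def by (simp add: divide_simps power2_eq_square power3_eq_cube)
  also have "\<dots> \<le> 1 / K\<^sup>2 * (1 + 2 * (1 / K))"
    using y K by (intro mult_mono) (auto simp: pair_gf_def)
  also have "\<dots> = 2 / K ^ 3 + 1 / K\<^sup>2" using K by (simp add: field_simps power2_eq_square power3_eq_cube)
  finally show ?A unfolding K_def y_def .
  show nonneg: ?C unfolding y_def[symmetric] mean_term_def using y by simp
  have "2 / K ^ 3 - 3 / K\<^sup>2 \<le> mean_term y"
  proof (cases "2 \<le> 3 * K")
    case True
    have "2 / K ^ 3 - 3 / K\<^sup>2 = (2 - 3 * K) / K ^ 3" using K by (simp add: field_simps power2_eq_square power3_eq_cube)
    also have "\<dots> \<le> 0" using True K by (intro divide_nonpos_nonneg) auto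
    finally show ?thesis using nonneg unfolding y_def by simp
  next
    case False
    have le: "1 - y \<le> K" unfolding y_def K_def by (rule one_minus_power_le[OF t])
    have "2 - 3 * K \<le> (1 - K) * (1 + (1 - K))" by (simp add: algebra_simps)
    also have "\<dots> \<le> y * (1 + y)" using le False y by (intro mult_mono) auto
    finally have "(2 - 3 * K) / K ^ 3 \<le> y * (1 + y) / (1 - y) ^ 3"
      using le False y K by (intro frac_le power_mono) auto
    moreover have "2 / K ^ 3 - 3 / K\<^sup>2 = (2 - 3 * K) / K ^ 3" using K by (simp add: field_simps power2_eq_square power3_eq_cube)
    ultimately show ?thesis by (simp add: mean_term_def)
  qed
  then show ?B unfolding K_def y_def .
qed

definition size_mean :: "real \<Rightarrow> real" where
  "size_mean x = (\<Sum>k. mean_term (x ^ Suc k))"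

text \<open>The leading terms \<open>2 / (k * t) ^ 3\<close> add up to
  \<open>2 * riemann_zeta 3 / t ^ 3\<close>, which is \<open>n\<close> for
  \<open>t = tilt n\<close>. The lower bound loses three times the sum of
  \<open>1 / (k * t)\<^sup>2\<close>, hence at most \<open>3 * 2 / t\<^sup>2\<close>.\<close>

lemma size_mean_estimate:
  fixes t :: real
  assumes t: "0 < t" "t < 1"
  shows "summable (\<lambda>k. mean_term ((1 - t) ^ Suc k))" (is ?A)
    and "\<bar>size_mean (1 - t) - 2 * riemann_zeta 3 / t ^ 3\<bar> \<le> 6 / t\<^sup>2" (is ?B)
proof -
  let ?m = "\<lambda>k. mean_term ((1 - t) ^ Suc k)"
  let ?c = "\<lambda>k. 2 / t ^ 3 * (1 / real (Suc k) ^ 3)" and ?q = "\<lambda>k. 1 / t\<^sup>2 * (1 / (real (Suc k))\<^sup>2)"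
  have sc: "?c sums (2 / t ^ 3 * riemann_zeta 3)"
    unfolding riemann_zeta_3 by (intro sums_mult summable_sums summable_inverse_powers)
  have sq: "?q sums (1 / t\<^sup>2 * (\<Sum>k. 1 / (real (Suc k))\<^sup>2))"
    by (intro sums_mult summable_sums summable_inverse_powers)
  have up: "?m k \<le> ?c k + ?q k" for k
    using mean_term_bounds(1)[OF t, of k] by (simp only: power_mult_distrib) (simp add: mult.commute)
  have low: "?c k - 3 * ?q k \<le> ?m k" for k
    using mean_term_bounds(2)[OF t, of k] by (simp only: power_mult_distrib) (simp add: mult.commute)
  have up_sums: "(\<lambda>k. ?c k + ?q k) sums (2 / t ^ 3 * riemann_zeta 3 + 1 / t\<^sup>2 * (\<Sum>k. 1 / (real (Suc k))\<^sup>2))"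
    by (rule sums_add[OF sc sq])
  have low_sums: "(\<lambda>k. ?c k - 3 * ?q k) sums (2 / t ^ 3 * riemann_zeta 3 - 3 * (1 / t\<^sup>2 * (\<Sum>k. 1 / (real (Suc k))\<^sup>2)))"
    by (intro sums_diff sc sums_mult sq)
  show A: ?A
    by (rule summable_comparison_test'[OF sums_summable[OF up_sums], of 0])
      (simp only: real_norm_def abs_of_nonneg[OF mean_term_bounds(3)[OF t]] up)
  have Q: "0 \<le> 1 / t\<^sup>2 * (\<Sum>k. 1 / (real (Suc k))\<^sup>2)" "1 / t\<^sup>2 * (\<Sum>k. 1 / (real (Suc k))\<^sup>2) \<le> 2 / t\<^sup>2"
    using suminf_inverse_squares_le suminf_nonneg[OF summable_inverse_powers(1)] t by (auto simp: divide_simps)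
  have "size_mean (1 - t) \<le> 2 / t ^ 3 * riemann_zeta 3 + 1 / t\<^sup>2 * (\<Sum>k. 1 / (real (Suc k))\<^sup>2)"
    unfolding size_mean_def by (rule sums_le[OF up summable_sums[OF A] up_sums])
  moreover have "2 / t ^ 3 * riemann_zeta 3 - 3 * (1 / t\<^sup>2 * (\<Sum>k. 1 / (real (Suc k))\<^sup>2)) \<le> size_mean (1 - t)"
    unfolding size_mean_def by (rule sums_le[OF low low_sums summable_sums[OF A]])
  moreover have "2 / t ^ 3 * riemann_zeta 3 = 2 * riemann_zeta 3 / t ^ 3" by simp
  moreover have "3 * (2 / t\<^sup>2) = 6 / t\<^sup>2" by simp
  ultimately show ?B using Q by linarith
qed

lemma suminf_pair_gf_le:
  fixes t :: real
  assumes t: "0 < t" "t < 1"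
  shows "(\<Sum>k. pair_gf ((1 - t) ^ k)) \<le> 2 / t\<^sup>2"
proof -
  have x: "0 < 1 - t" "1 - t < 1" using t by auto
  have s1: "(\<lambda>k. pair_gf ((1 - t) ^ Suc k)) sums (\<Sum>k. pair_gf ((1 - t) ^ k))"
    using summable_sums[OF summable_pair_gf[OF x]] by (subst sums_Suc_iff) (simp add: pair_gf_def)
  have s2: "(\<lambda>k. 1 / t\<^sup>2 * (1 / (real (Suc k))\<^sup>2)) sums (1 / t\<^sup>2 * (\<Sum>k. 1 / (real (Suc k))\<^sup>2))"
    by (intro sums_mult summable_sums summable_inverse_powers)
  have le: "pair_gf ((1 - t) ^ Suc k) \<le> 1 / t\<^sup>2 * (1 / (real (Suc k))\<^sup>2)" for k
    using power_estimates(3)[OF t, of k] by (simp only: power_mult_distrib) (simp add: mult.commute)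
  have "(\<Sum>k. pair_gf ((1 - t) ^ k)) \<le> 1 / t\<^sup>2 * (\<Sum>k. 1 / (real (Suc k))\<^sup>2)"
    by (rule sums_le[OF le s1 s2])
  also have "\<dots> \<le> 1 / t\<^sup>2 * 2" by (intro mult_left_mono suminf_inverse_squares_le) simp
  finally show ?thesis by simp
qed

section \<open>The local limit theorem\<close>

text \<open>Taylor's formula with error \<open>w ^ 3 / 6\<close> is applied to half the angle, where
  \<open>w \<le> 2\<close> turns it into \<open>1 - cos w \<ge> w\<^sup>2 / 6\<close>. Then
  \<open>1 - cos \<theta> = 2 * (1 - cos w) * (1 + cos w)\<close> with \<open>cos w \<ge> 0\<close>
  yields \<open>w\<^sup>2 / 3 = \<theta>\<^sup>2 / 12\<close>.\<close>

lemma one_minus_cos_ge: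
  assumes "\<bar>\<theta>\<bar> \<le> pi"
  shows "\<theta>\<^sup>2 / 12 \<le> 1 - cos \<theta>"
proof -
  define w where "w = \<bar>\<theta>\<bar> / 2"
  have w: "0 \<le> w" "w \<le> 2" "w \<le> pi / 2" using assms pi_less_4 by (auto simp: w_def)
  have "cmod (iexp w - (\<Sum>k\<le>2. (\<i> * w) ^ k / fact k)) \<le> \<bar>w\<bar> ^ Suc 2 / fact (Suc 2)"
    by (rule iexp_approx1)
  then have "\<bar>Re (iexp w - (\<Sum>k\<le>2. (\<i> * w) ^ k / fact k))\<bar> \<le> w ^ 3 / 6"
    using w by (intro order_trans[OF abs_Re_le_cmod]) (simp add: eval_nat_numeral)
  moreover have "Re (iexp w - (\<Sum>k\<le>2. (\<i> * w) ^ k / fact k)) = cos w - 1 + w\<^sup>2 / 2"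
    by (simp add: eval_nat_numeral Re_exp)
  ultimately have "cos w \<le> 1 - w\<^sup>2 / 2 + w ^ 3 / 6" by linarith
  moreover have "w ^ 3 \<le> 2 * w\<^sup>2"
    using mult_right_mono[OF w(2), of "w\<^sup>2"] by (simp add: power2_eq_square power3_eq_cube)
  ultimately have c: "w\<^sup>2 / 6 \<le> 1 - cos w" by linarith
  have c0: "0 \<le> cos w" using w by (intro cos_ge_zero) auto
  have "cos \<theta> = 2 * (cos w)\<^sup>2 - 1"
    using cos_double_cos[of w] by (simp add: w_def)
  then have "1 - cos \<theta> = 1 - (2 * (cos w)\<^sup>2 - 1)" by simp
  also have "1 - (2 * (cos w)\<^sup>2 - 1) = 2 * (1 - cos w) * (1 + cos w)"
    by (simp add: algebra_simps power2_eq_square)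
  finally have eq: "1 - cos \<theta> = 2 * (1 - cos w) * (1 + cos w)" .
  have "2 * (w\<^sup>2 / 6) * 1 \<le> 2 * (1 - cos w) * (1 + cos w)"
    using c0 c by (intro mult_mono) auto
  then have "2 * (w\<^sup>2 / 6) \<le> 1 - cos \<theta>" unfolding eq by simp
  then show ?thesis by (simp add: w_def power_divide)
qed

lemma integral_cis_period:
  fixes j :: int
  shows "(LINT \<theta>|lborel. indicator {-pi..pi} \<theta> *\<^sub>R iexp (real_of_int j * \<theta>)) = (if j = 0 then 2 * pi else 0)"
proof (cases "j = 0")
  case True
  have "(LINT \<theta>|lborel. indicator {-pi..pi} \<theta> *\<^sub>R iexp (real_of_int j * \<theta>)) =
      (LINT \<theta>|lborel. indicator {-pi..pi} \<theta> *\<^sub>R (1 :: complex))"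
    using True by simp
  also have "\<dots> = of_real (LINT \<theta>|lborel. indicator {-pi..pi} \<theta>)"
    by (subst integral_scaleR_left) (auto simp: scaleR_conv_of_real)
  also have "(LINT \<theta>|lborel. indicator {-pi..pi} \<theta>) = 2 * pi"
    by simp
  finally show ?thesis using True by simp
next
  case False
  define F where "F \<theta> = iexp (real_of_int j * \<theta>) / (\<i> * of_int j)" for \<theta> :: real
  have "(LINT \<theta>|lborel. indicator {-pi..pi} \<theta> *\<^sub>R iexp (real_of_int j * \<theta>)) = F pi - F (- pi)"
  proof (rule integral_FTC_Icc)
    fix \<theta> :: real
    have "((\<lambda>\<theta>. iexp (real_of_int j * \<theta>)) has_vector_derivative real_of_int j *\<^sub>R (\<i> * iexp (real_of_int j * \<theta>))) (at \<theta> within {-pi..pi})"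
    proof -
      have "((\<lambda>z. exp (\<i> * (of_int j * z))) has_field_derivative (of_int j * (\<i> * exp (\<i> * (of_int j * of_real \<theta>))))) (at (of_real \<theta>))"
        by (auto intro!: derivative_eq_intros)
      from has_vector_derivative_real_field[OF this] show ?thesis by (simp add: scaleR_conv_of_real)
    qed
    then have "(F has_vector_derivative (real_of_int j *\<^sub>R (\<i> * iexp (real_of_int j * \<theta>))) / (\<i> * of_int j)) (at \<theta> within {-pi..pi})"
      unfolding F_def by (rule has_vector_derivative_divide)
    then show "(F has_vector_derivative iexp (real_of_int j * \<theta>)) (at \<theta> within {-pi..pi})"
      using False by (simp add: scaleR_conv_of_real)
  qed (auto intro!: continuous_intros)
  also have "F pi = F (- pi)"
  proof -
    have "iexp (real_of_int j * pi) = iexp (real_of_int j * - pi) * exp (2 * of_int j * of_real pi * \<i>)"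
      unfolding exp_add[symmetric] by (simp add: algebra_simps)
    also have "exp (2 * of_int j * of_real pi * \<i>) = 1" by (auto simp: exp_eq_1)
    finally show ?thesis by (simp add: F_def)
  qed
  finally show ?thesis using False by simp
qed

lemma integrable_indicator_iexp:
  "integrable lborel (\<lambda>\<theta>. indicator {-pi..pi} \<theta> *\<^sub>R iexp (c * \<theta>))"
  by (rule borel_integrable_compact) (auto intro!: continuous_intros)

text \<open>Sum and integral may be interchanged because the coefficients are summable and the
  exponentials have modulus 1.\<close>

lemma fourier_coefficient:
  fixes p :: "nat \<Rightarrow> real"
  assumes p: "\<And>n. 0 \<le> p n" "summable p"
  shows "2 * pi * p n = (LINT \<theta>|lborel. indicator {-pi..pi} \<theta> *\<^sub>R
    ((\<Sum>k. p k *\<^sub>R iexp (real k * \<theta>)) * iexp (- real n * \<theta>)))"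
proof -
  define f where "f k \<theta> = p k *\<^sub>R (indicator {-pi..pi} \<theta> *\<^sub>R iexp (real_of_int (int k - int n) * \<theta>))" for k \<theta>
  have f_eq: "f k \<theta> = indicator {-pi..pi} \<theta> *\<^sub>R (p k *\<^sub>R iexp (real k * \<theta>) * iexp (- real n * \<theta>))" for k \<theta>
    unfolding f_def by (simp add: exp_add[symmetric] algebra_simps exp_diff[symmetric] flip: exp_minus)
  have int: "integrable lborel (f k)" for k
    unfolding f_def by (intro integrable_scaleR_right integrable_indicator_iexp)
  have norm_f: "norm (f k \<theta>) = p k * indicator {-pi..pi} \<theta>" for k \<theta>
    using p(1)[of k] by (simp add: f_def indicator_def)
  have s_norm: "summable (\<lambda>k. norm (f k \<theta>))" for \<theta>
    unfolding norm_f by (intro summable_mult2 p(2))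
  have "(LINT \<theta>|lborel. norm (f k \<theta>)) = p k * (2 * pi)" for k
    unfolding norm_f by simp
  then have s_int: "summable (\<lambda>k. LINT \<theta>|lborel. norm (f k \<theta>))"
    by (simp only:) (intro summable_mult2 p(2))
  have "(LINT \<theta>|lborel. (\<Sum>k. f k \<theta>)) = (\<Sum>k. LINT \<theta>|lborel. f k \<theta>)"
    by (rule integral_suminf[OF int AE_I2[OF s_norm] s_int])
  also have "(\<lambda>k. LINT \<theta>|lborel. f k \<theta>) = (\<lambda>k. if k = n then of_real (2 * pi * p n) else 0)"
    unfolding f_def integral_scaleR_right integral_cis_period by (rule ext) (simp add: scaleR_conv_of_real)
  also have "(\<Sum>k. if k = n then complex_of_real (2 * pi * p n) else 0) = of_real (2 * pi * p n)"
    using sums_single[of n "\<lambda>_. complex_of_real (2 * pi * p n)"] by (simp add: sums_iff)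
  also have "(\<lambda>\<theta>. \<Sum>k. f k \<theta>) = (\<lambda>\<theta>. indicator {-pi..pi} \<theta> *\<^sub>R
    ((\<Sum>k. p k *\<^sub>R iexp (real k * \<theta>)) * iexp (- real n * \<theta>)))"
  proof
    fix \<theta>
    have s: "summable (\<lambda>k. p k *\<^sub>R iexp (real k * \<theta>))"
      by (rule summable_norm_cancel) (use p in \<open>simp add: norm_mult\<close>)
    have "(\<Sum>k. f k \<theta>) = (\<Sum>k. indicator {-pi..pi} \<theta> *\<^sub>R (p k *\<^sub>R iexp (real k * \<theta>) * iexp (- real n * \<theta>)))"
      by (simp only: f_eq)
    also have "\<dots> = indicator {-pi..pi} \<theta> *\<^sub>R (\<Sum>k. p k *\<^sub>R iexp (real k * \<theta>) * iexp (- real n * \<theta>))"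
      by (rule suminf_scaleR_right[symmetric]) (intro summable_mult2 s)
    also have "(\<Sum>k. p k *\<^sub>R iexp (real k * \<theta>) * iexp (- real n * \<theta>)) = (\<Sum>k. p k *\<^sub>R iexp (real k * \<theta>)) * iexp (- real n * \<theta>)"
      by (rule suminf_mult2[symmetric, OF s])
    finally show "(\<Sum>k. f k \<theta>) = indicator {-pi..pi} \<theta> *\<^sub>R
      ((\<Sum>k. p k *\<^sub>R iexp (real k * \<theta>)) * iexp (- real n * \<theta>))" .
  qed
  finally show ?thesis by simp
qed

lemma gaussian_fourier:
  "integrable lborel (\<lambda>y. of_real (exp (- y\<^sup>2 / 2)) * iexp (- d * y))"
  "(LINT y|lborel. of_real (exp (- y\<^sup>2 / 2)) * iexp (- d * y)) = of_real (sqrt (2 * pi) * exp (- d\<^sup>2 / 2))"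
  "integrable lborel (\<lambda>y. exp (- y\<^sup>2 / 2) :: real)"
proof -
  have int: "integrable lborel std_normal_density"
    by (rule integrable_normal_density) simp
  have dens: "exp (- y\<^sup>2 / 2) = sqrt (2 * pi) * std_normal_density y" for y
    by (simp add: std_normal_density_def)
  show i3: "integrable lborel (\<lambda>y. exp (- y\<^sup>2 / 2) :: real)"
    unfolding dens by (intro integrable_mult_right int)
  show i1: "integrable lborel (\<lambda>y. of_real (exp (- y\<^sup>2 / 2)) * iexp (- d * y))"
    by (rule Bochner_Integration.integrable_bound[OF i3]) (auto simp: norm_mult)
  have "of_real (exp (- (- d)\<^sup>2 / 2)) = char std_normal_distribution (- d)"
    unfolding char_std_normal_distribution by simp
  also have "\<dots> = (LINT y|lborel. std_normal_density y *\<^sub>R iexp (- d * y))"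
    unfolding char_def by (subst integral_density) (auto simp: normal_density_nonneg)
  finally have "of_real (sqrt (2 * pi)) * of_real (exp (- d\<^sup>2 / 2)) =
      of_real (sqrt (2 * pi)) * (LINT y|lborel. std_normal_density y *\<^sub>R iexp (- d * y))" by simp
  also have "\<dots> = (LINT y|lborel. of_real (sqrt (2 * pi)) * (std_normal_density y *\<^sub>R iexp (- d * y)))"
    by (rule integral_mult_right_zero[symmetric])
  also have "\<dots> = (LINT y|lborel. of_real (exp (- y\<^sup>2 / 2)) * iexp (- d * y))"
    unfolding dens by (simp add: scaleR_conv_of_real mult.assoc)
  finally show "(LINT y|lborel. of_real (exp (- y\<^sup>2 / 2)) * iexp (- d * y)) = of_real (sqrt (2 * pi) * exp (- d\<^sup>2 / 2))"
    by simp
qed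

lemma integrable_cauchy: "integrable lborel (\<lambda>y::real. c / (1 + y\<^sup>2))"
proof -
  have "integrable lborel (\<lambda>y::real. inverse (1 + y\<^sup>2))"
    using integrable_inverse_1_plus_square by (simp add: set_integrable_def einterval_def)
  then have "integrable lborel (\<lambda>y::real. c * inverse (1 + y\<^sup>2))" by (rule integrable_mult_right)
  then show ?thesis by (simp add: divide_inverse)
qed

text \<open>The bound for the rescaled characteristic function decays like
  \<open>exp (- \<bar>y\<bar> / 28)\<close> for large \<open>y\<close>; a multiple of the Cauchy
  density is a convenient integrable majorant. The constants 288 and 28 arise in
  \<open>local_limit\<close>.\<close>

lemma exp_dominated:
  fixes y :: real
  shows "exp (- (y\<^sup>2 / (288 + 28 * \<bar>y\<bar>))) \<le> 4704 / (1 + y\<^sup>2)"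
proof -
  define s where "s = \<bar>y\<bar> / 28"
  have s: "0 \<le> s" by (simp add: s_def)
  have "(s - 288 / 784) * (288 + 28 * \<bar>y\<bar>) \<le> y\<^sup>2"
    by (simp add: s_def algebra_simps power2_eq_square abs_mult_self_eq)
  then have "s - 288 / 784 \<le> y\<^sup>2 / (288 + 28 * \<bar>y\<bar>)" by (subst pos_le_divide_eq) auto
  then have "exp (- (y\<^sup>2 / (288 + 28 * \<bar>y\<bar>))) \<le> exp (1 - s)" by simp
  also have "\<dots> = exp 1 / exp s" by (rule exp_diff)
  \<comment> \<open>By \<open>exp 1 \<le> 3\<close> and
    \<open>exp s \<ge> 1 + s + s\<^sup>2 / 2\<close>. With the rescaling by
    \<open>28\<^sup>2 = 784\<close> this is the origin of \<open>4704 = 3 * 2 * 784\<close>.\<close>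
  also have "\<dots> \<le> 3 / ((1 + s\<^sup>2) / 2)"
    using exp_le exp_lower_Taylor_quadratic[OF s] s by (intro frac_le) (auto simp: add_pos_nonneg)
  also have "\<dots> \<le> 4704 / (1 + y\<^sup>2)"
  proof -
    have "1 + y\<^sup>2 \<le> 784 * (1 + s\<^sup>2)" by (simp add: s_def power_divide)
    moreover have "0 < 1 + s\<^sup>2" "0 < 1 + y\<^sup>2" by (auto simp: add_pos_nonneg)
    ultimately show ?thesis by (simp add: divide_simps)
  qed
  finally show ?thesis .
qed


section \<open>The characteristic function of the size\<close>

context
  fixes x :: real
  assumes x: "0 < x" "x < 1"
begin

definition size_prob :: "nat \<Rightarrow> real" where
  "size_prob n = real (num_diagrams n) * x ^ n * exp (- suminf (rate x))"

definition char_fun :: "real \<Rightarrow> complex" where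
  "char_fun \<theta> = (\<Sum>n. size_prob n *\<^sub>R iexp (real n * \<theta>))"

lemma size_prob_nonneg: "0 \<le> size_prob n"
  unfolding size_prob_def using x by simp

lemma size_prob_sums: "size_prob sums 1"
  using sums_mult[OF num_diagrams_sums[OF x], of "exp (- suminf (rate x))"]
  by (simp add: size_prob_def[abs_def] exp_minus mult_ac)

lemma iexp_power: "iexp \<theta> ^ n = iexp (real n * \<theta>)"
  unfolding exp_of_nat_mult[symmetric] by (simp add: mult_ac)

lemma summable_weight_bounded:
  fixes f :: "nat \<Rightarrow> complex"
  assumes "\<And>m. norm (f m) \<le> c"
  shows "summable (\<lambda>m. weight x m *\<^sub>R f m)"
proof (rule summable_comparison_test'[of "\<lambda>m. weight x m * c" 0])
  show "summable (\<lambda>m. weight x m * c)" by (rule summable_mult2[OF summable_weight[OF x]])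
  show "norm (weight x m *\<^sub>R f m) \<le> weight x m * c" for m
    using mult_left_mono[OF assms weight_nonneg[OF x]] weight_nonneg[OF x, of m] by (simp only: norm_scaleR abs_of_nonneg)
qed

text \<open>The compound Poisson form: \<open>num_diagrams_gf\<close> at
  \<open>x * iexp \<theta>\<close>, with the normalization \<open>exp (- suminf (rate x))\<close>
  written as the exponential of minus the total weight.\<close>

lemma char_fun_eq: "char_fun \<theta> = exp (\<Sum>m. weight x m *\<^sub>R (iexp (real m * \<theta>) - 1))"
proof -
  define z where "z = of_real x * iexp \<theta>"
  have z: "norm z < 1" using x by (simp add: z_def norm_mult)
  have zp: "z ^ n = of_real (x ^ n) * iexp (real n * \<theta>)" for n
    unfolding z_def power_mult_distrib iexp_power by simp
  have s1: "summable (\<lambda>m. weight x m *\<^sub>R iexp (real m * \<theta>))" by (rule summable_weight_bounded[of _ 1]) simp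
  have s2: "summable (\<lambda>m. weight x m *\<^sub>R (1 :: complex))" by (rule summable_weight_bounded[of _ 1]) simp
  have sw: "(\<Sum>m. weight x m *\<^sub>R (1 :: complex)) = of_real (suminf (rate x))"
    unfolding suminf_weight[OF x, symmetric] scaleR_conv_of_real mult_1_right
    by (rule suminf_of_real[OF summable_weight[OF x], symmetric])
  have "(\<lambda>n. of_real (exp (- suminf (rate x))) * (of_nat (num_diagrams n) * z ^ n)) sums
      (of_real (exp (- suminf (rate x))) * exp (\<Sum>m. of_real (log_coeff m) * z ^ m))"
    by (intro sums_mult num_diagrams_gf z)
  moreover have "of_real (exp (- suminf (rate x))) * (of_nat (num_diagrams n) * z ^ n) = size_prob n *\<^sub>R iexp (real n * \<theta>)" for n
    unfolding zp by (simp add: size_prob_def scaleR_conv_of_real mult_ac)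
  ultimately have "char_fun \<theta> = of_real (exp (- suminf (rate x))) * exp (\<Sum>m. of_real (log_coeff m) * z ^ m)"
    unfolding char_fun_def by (simp only: sums_iff)
  also have "(\<lambda>m. of_real (log_coeff m) * z ^ m) = (\<lambda>m. weight x m *\<^sub>R iexp (real m * \<theta>))"
    unfolding zp by (rule ext) (simp add: weight_def[OF x] scaleR_conv_of_real)
  also have "complex_of_real (exp (- suminf (rate x))) = exp (- (\<Sum>m. weight x m *\<^sub>R 1))"
    unfolding sw by (simp add: exp_of_real[symmetric])
  also have "exp (- (\<Sum>m. weight x m *\<^sub>R 1)) * exp (\<Sum>m. weight x m *\<^sub>R iexp (real m * \<theta>)) =
      exp ((\<Sum>m. weight x m *\<^sub>R iexp (real m * \<theta>)) - (\<Sum>m. weight x m *\<^sub>R 1))"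
    unfolding exp_add[symmetric] by (simp add: add.commute)
  also have "\<dots> = exp (\<Sum>m. weight x m *\<^sub>R iexp (real m * \<theta>) - weight x m *\<^sub>R 1)"
    unfolding suminf_diff[OF s1 s2] ..
  finally show ?thesis unfolding scaleR_diff_right .
qed

lemma summable_cos:
  "summable (\<lambda>m. weight x m * (1 - cos (real m * \<theta>)))"
  "summable (\<lambda>m. real m * x ^ m * (1 - cos (real m * \<theta>)))"
proof -
  have c: "0 \<le> 1 - cos (real m * \<theta>)" "1 - cos (real m * \<theta>) \<le> 2" for m
    using cos_le_one[of "real m * \<theta>"] cos_ge_minus_one[of "real m * \<theta>"] by linarith+
  show A: "summable (\<lambda>m. weight x m * (1 - cos (real m * \<theta>)))"
    by (rule summable_comparison_test'[OF summable_mult2[OF summable_weight[OF x], of 2], of 0])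
      (simp only: real_norm_def abs_of_nonneg[OF mult_nonneg_nonneg[OF weight_nonneg[OF x] c(1)]]
        mult_left_mono[OF c(2) weight_nonneg[OF x]])
  have nn: "0 \<le> real m * x ^ m * (1 - cos (real m * \<theta>))" for m using c(1)[of m] x by simp
  show "summable (\<lambda>m. real m * x ^ m * (1 - cos (real m * \<theta>)))"
    by (rule summable_comparison_test'[OF A, of 0])
      (simp only: real_norm_def abs_of_nonneg[OF nn] mult_right_mono[OF weight_ge[OF x] c(1)])
qed

text \<open>Only the real part of the exponent matters. As \<open>1 - cos (m * \<theta>)\<close> is
  nonnegative, \<open>weight\<close> may be lowered to \<open>m * x ^ m\<close>, for which the sum
  has a closed form.\<close>

lemma norm_char_fun_le:
  "cmod (char_fun \<theta>) \<le> exp (- (\<Sum>m. real m * x ^ m * (1 - cos (real m * \<theta>))))"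
proof -
  have c: "0 \<le> 1 - cos (real m * \<theta>)" for m using cos_le_one[of "real m * \<theta>"] by linarith
  have s: "summable (\<lambda>m. weight x m *\<^sub>R (iexp (real m * \<theta>) - 1))"
  proof (rule summable_weight_bounded)
    show "norm (iexp (real m * \<theta>) - 1) \<le> 1 + 1" for m
      by (rule order_trans[OF norm_triangle_ineq4]) simp
  qed
  have "Re (\<Sum>m. weight x m *\<^sub>R (iexp (real m * \<theta>) - 1)) = (\<Sum>m. Re (weight x m *\<^sub>R (iexp (real m * \<theta>) - 1)))"
    by (rule bounded_linear.suminf[OF bounded_linear_Re s])
  also have "\<dots> = (\<Sum>m. - (weight x m * (1 - cos (real m * \<theta>))))"
    by (simp add: Re_exp algebra_simps)
  also have "\<dots> = - (\<Sum>m. weight x m * (1 - cos (real m * \<theta>)))"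
    by (rule suminf_minus[OF summable_cos(1)])
  also have "\<dots> \<le> - (\<Sum>m. real m * x ^ m * (1 - cos (real m * \<theta>)))"
    unfolding neg_le_iff_le
    by (rule suminf_le[OF mult_right_mono[OF weight_ge[OF x] c] summable_cos(2) summable_cos(1)])
  finally show ?thesis unfolding char_fun_eq norm_exp_eq_Re by simp
qed

text \<open>With \<open>z = x * iexp \<theta>\<close> the sum of \<open>m * z ^ m\<close> is
  \<open>z / (1 - z)\<^sup>2\<close>. Its real part is at most
  \<open>x / (cmod (1 - z))\<^sup>2\<close>, and \<open>(cmod (1 - z))\<^sup>2 = (1 - x)\<^sup>2 + 2
  * x * (1 - cos \<theta>)\<close>.\<close>

lemma sum_cos_ge:
  "x / (1 - x)\<^sup>2 - x / ((1 - x)\<^sup>2 + 2 * x * (1 - cos \<theta>)) \<le> (\<Sum>m. real m * x ^ m * (1 - cos (real m * \<theta>)))"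
proof -
  define z where "z = of_real x * iexp \<theta>"
  have z: "norm z < 1" "norm z = x" using x by (simp_all add: z_def norm_mult)
  have zp: "z ^ n = of_real (x ^ n) * iexp (real n * \<theta>)" for n
    unfolding z_def power_mult_distrib iexp_power by simp
  have "(\<lambda>n. z * (of_nat (Suc n) * z ^ n)) sums (z * (1 / (1 - z)\<^sup>2))"
    by (intro sums_mult geometric_deriv_sums z)
  then have "(\<lambda>n. of_nat (Suc n) * z ^ Suc n) sums (z / (1 - z)\<^sup>2)" by (simp add: mult_ac)
  then have "(\<lambda>n. of_nat n * z ^ n) sums (z / (1 - z)\<^sup>2)" by (subst (asm) sums_Suc_iff) simp
  then have "(\<lambda>n. Re (of_nat n * z ^ n)) sums Re (z / (1 - z)\<^sup>2)" by (rule bounded_linear.sums[OF bounded_linear_Re])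
  then have sc: "(\<lambda>n. real n * x ^ n * cos (real n * \<theta>)) sums Re (z / (1 - z)\<^sup>2)"
    unfolding zp by (simp add: Re_exp mult_ac)
  have s1: "(\<lambda>n. real n * x ^ n) sums (x / (1 - x)\<^sup>2)" by (rule sum_j_sums) (use x in auto)
  have "(\<lambda>n. real n * x ^ n - real n * x ^ n * cos (real n * \<theta>)) sums (x / (1 - x)\<^sup>2 - Re (z / (1 - z)\<^sup>2))"
    by (rule sums_diff[OF s1 sc])
  then have eq: "(\<Sum>m. real m * x ^ m * (1 - cos (real m * \<theta>))) = x / (1 - x)\<^sup>2 - Re (z / (1 - z)\<^sup>2)"
    by (simp add: sums_iff right_diff_distrib)
  have "Re (z / (1 - z)\<^sup>2) \<le> cmod (z / (1 - z)\<^sup>2)" by (rule complex_Re_le_cmod)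
  also have "\<dots> = x / (cmod (1 - z))\<^sup>2" by (simp add: norm_divide norm_power z(2))
  also have "(cmod (1 - z))\<^sup>2 = (1 - x * cos \<theta>)\<^sup>2 + (x * sin \<theta>)\<^sup>2"
    unfolding cmod_power2 by (simp add: z_def Re_exp Im_exp)
  also have "\<dots> = (1 - x)\<^sup>2 + 2 * x * (1 - cos \<theta>)"
  proof -
    have "(1 - x * cos \<theta>)\<^sup>2 + (x * sin \<theta>)\<^sup>2 =
        1 - 2 * x * cos \<theta> + (x\<^sup>2 * (sin \<theta>)\<^sup>2 + x\<^sup>2 * (cos \<theta>)\<^sup>2)"
      by (simp add: power2_eq_square algebra_simps)
    also have "x\<^sup>2 * (sin \<theta>)\<^sup>2 + x\<^sup>2 * (cos \<theta>)\<^sup>2 = x\<^sup>2"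
      unfolding distrib_left[symmetric] by simp
    also have "1 - 2 * x * cos \<theta> + x\<^sup>2 = (1 - x)\<^sup>2 + 2 * x * (1 - cos \<theta>)" by (simp add: power2_eq_square algebra_simps)
    finally show ?thesis .
  qed
  finally show ?thesis unfolding eq by simp
qed

text \<open>The difference in \<open>sum_cos_ge\<close> equals \<open>x / T * (g / (T + g))\<close>,
  which increases with \<open>g\<close>, so \<open>g\<close> may be lowered to \<open>q\<close>. The
  estimate covers the entire period, hence both the centre and the tails of the Fourier
  integral.\<close>

lemma norm_char_fun_bound:
  assumes half: "1 / 2 \<le> x" and \<theta>: "\<bar>\<theta>\<bar> \<le> pi"
  shows "cmod (char_fun \<theta>) \<le> exp (- (\<theta>\<^sup>2 / (2 * (1 - x)\<^sup>2 * (12 * (1 - x)\<^sup>2 + \<theta>\<^sup>2))))"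
proof -
  define T q g where "T = (1 - x)\<^sup>2" and "q = \<theta>\<^sup>2 / 12" and "g = 2 * x * (1 - cos \<theta>)"
  have T: "0 < T" using x by (simp add: T_def)
  have q: "0 \<le> q" by (simp add: q_def)
  have "1 * q \<le> (2 * x) * (1 - cos \<theta>)"
    using one_minus_cos_ge[OF \<theta>] half q by (intro mult_mono) (auto simp: q_def)
  then have g: "q \<le> g" by (simp add: g_def)
  have Tq: "0 < T + q" "0 < T + g" using T q g by auto
  have "(1 / 2) / T * (q / (T + q)) \<le> x / T * (g / (T + g))"
  proof (rule mult_mono)
    show "(1 / 2) / T \<le> x / T" using half T by (intro divide_right_mono) auto
    show "q / (T + q) \<le> g / (T + g)" using Tq T q g by (simp add: divide_simps algebra_simps)
  qed (use T q Tq half x in \<open>auto simp: divide_right_mono\<close>)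
  also have "\<dots> = x / T - x / (T + g)" using T Tq by (simp add: divide_simps) (simp add: algebra_simps)
  also have "\<dots> \<le> (\<Sum>m. real m * x ^ m * (1 - cos (real m * \<theta>)))"
    unfolding T_def g_def by (rule sum_cos_ge)
  also have "(1 / 2) / T * (q / (T + q)) = \<theta>\<^sup>2 / (2 * T * (12 * T + \<theta>\<^sup>2))"
  proof -
    have "q / (T + q) = \<theta>\<^sup>2 / (12 * T + \<theta>\<^sup>2)"
      using Tq unfolding q_def by (simp add: field_simps)
    then show ?thesis by simp
  qed
  finally have "exp (- (\<Sum>m. real m * x ^ m * (1 - cos (real m * \<theta>)))) \<le> exp (- (\<theta>\<^sup>2 / (2 * T * (12 * T + \<theta>\<^sup>2))))"
    by simp
  then show ?thesis unfolding T_def by (rule order_trans[OF norm_char_fun_le])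
qed

text \<open>Second-order Taylor expansion of each \<open>iexp (m * \<theta>)\<close>: the linear
  terms cancel the centring by the mean, the quadratic ones give the variance, and the errors
  \<open>\<bar>m * \<theta>\<bar> ^ 3 / 6\<close> add up to the third cumulant.\<close>

lemma char_fun_expansion:
  assumes summ: "summable (\<lambda>k. mean_term (x ^ Suc k))"
  shows "\<exists>R. char_fun \<theta> * iexp (- size_mean x * \<theta>) = exp (of_real (- size_var x * \<theta>\<^sup>2 / 2) + R) \<and>
    cmod R \<le> third_moment x * \<bar>\<theta>\<bar> ^ 3 / 6"
proof -
  let ?w = "weight x"
  define r where "r m = iexp (real m * \<theta>) - 1 - \<i> * of_real (real m * \<theta>) + of_real ((real m * \<theta>)\<^sup>2 / 2)" for m
  have r: "cmod (r m) \<le> \<bar>real m * \<theta>\<bar> ^ 3 / 6" for m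
  proof -
    have "r m = iexp (real m * \<theta>) - (\<Sum>k\<le>2. (\<i> * of_real (real m * \<theta>)) ^ k / fact k)"
    proof -
      define a where "a = complex_of_real (real m * \<theta>)"
      have "(\<Sum>k\<le>2. (\<i> * a) ^ k / fact k) = 1 + \<i> * a + (\<i> * a)\<^sup>2 / 2" by (simp add: eval_nat_numeral)
      also have "(\<i> * a)\<^sup>2 = - (a\<^sup>2)" by (simp add: power_mult_distrib)
      finally have "iexp (real m * \<theta>) - (\<Sum>k\<le>2. (\<i> * a) ^ k / fact k) = iexp (real m * \<theta>) - 1 - \<i> * a + a\<^sup>2 / 2"
        by simp
      moreover have "complex_of_real ((real m * \<theta>)\<^sup>2 / 2) = a\<^sup>2 / 2" by (simp add: a_def)
      ultimately show ?thesis unfolding r_def a_def[symmetric] by simp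
    qed
    then show ?thesis using iexp_approx1[of "real m * \<theta>" 2] by (simp add: eval_nat_numeral)
  qed
  have s1: "(\<lambda>m. ?w m *\<^sub>R (iexp (real m * \<theta>) - 1)) sums (\<Sum>m. ?w m *\<^sub>R (iexp (real m * \<theta>) - 1))"
  proof (intro summable_sums summable_weight_bounded)
    show "norm (iexp (real m * \<theta>) - 1) \<le> 1 + 1" for m
      by (rule order_trans[OF norm_triangle_ineq4]) simp
  qed
  have "(\<lambda>m. real m * ?w m) sums size_mean x"
    using log_coeff_mean_sums[OF x summ] unfolding size_mean_def weight_def[OF x] .
  from sums_mult[OF sums_of_real[OF this, where 'a = complex], of "\<i> * of_real \<theta>"]
  have s2: "(\<lambda>m. ?w m *\<^sub>R (\<i> * of_real (real m * \<theta>))) sums (\<i> * of_real (size_mean x * \<theta>))"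
    by (simp add: scaleR_conv_of_real mult_ac)
  have "(\<lambda>m. (real m)\<^sup>2 * ?w m) sums size_var x"
    using summable_sums[OF size_var_bounds(1)[OF x]] unfolding size_var_def[OF x] .
  from sums_mult[OF sums_of_real[OF this, where 'a = complex], of "of_real (\<theta>\<^sup>2 / 2)"]
  have s3: "(\<lambda>m. ?w m *\<^sub>R of_real ((real m * \<theta>)\<^sup>2 / 2)) sums complex_of_real (size_var x * \<theta>\<^sup>2 / 2)"
    by (simp add: scaleR_conv_of_real power_mult_distrib mult_ac)
  define R where "R = (\<Sum>m. ?w m *\<^sub>R (iexp (real m * \<theta>) - 1)) - \<i> * of_real (size_mean x * \<theta>) + of_real (size_var x * \<theta>\<^sup>2 / 2)"
  have sR: "(\<lambda>m. ?w m *\<^sub>R r m) sums R"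
    using sums_add[OF sums_diff[OF s1 s2] s3] unfolding R_def r_def by (simp add: scaleR_diff_right scaleR_add_right)
  have "char_fun \<theta> * iexp (- size_mean x * \<theta>) = exp (of_real (- size_var x * \<theta>\<^sup>2 / 2) + R)"
    unfolding char_fun_eq exp_add[symmetric] R_def by simp
  moreover have "cmod R \<le> third_moment x * \<bar>\<theta>\<bar> ^ 3 / 6"
  proof -
    have s3m: "(\<lambda>m. \<bar>\<theta>\<bar> ^ 3 / 6 * (real m ^ 3 * ?w m)) sums (\<bar>\<theta>\<bar> ^ 3 / 6 * third_moment x)"
      unfolding third_moment_def[OF x] by (intro sums_mult summable_sums third_moment_bounds(1)[OF x])
    have le: "norm (?w m *\<^sub>R r m) \<le> \<bar>\<theta>\<bar> ^ 3 / 6 * (real m ^ 3 * ?w m)" for m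
      using mult_left_mono[OF r weight_nonneg[OF x], of m m] weight_nonneg[OF x, of m]
      by (simp add: abs_mult power_mult_distrib mult_ac)
    have "cmod (\<Sum>m. ?w m *\<^sub>R r m) \<le> (\<Sum>m. \<bar>\<theta>\<bar> ^ 3 / 6 * (real m ^ 3 * ?w m))"
      by (rule norm_suminf_le[OF le sums_summable[OF s3m]])
    then show ?thesis using sums_unique[OF sR] sums_unique[OF s3m] by (simp add: mult.commute)
  qed
  ultimately show ?thesis by blast
qed

lemma char_fun_measurable [measurable]: "char_fun \<in> borel_measurable borel"
  unfolding char_fun_def[abs_def] by measurable

end

text \<open>Stated along a sequence so that dominated convergence applies. The error integral
  \<open>I j\<close> does not involve the target \<open>n\<close>, which enters the integrand only
  through a factor of modulus 1; this makes the estimate uniform in \<open>n\<close>.\<close>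

theorem local_limit:
  fixes T :: "nat \<Rightarrow> real"
  assumes T: "\<And>j. 0 < T j" "\<And>j. T j \<le> 1 / 2" "T \<longlonglongrightarrow> 0" and C: "0 \<le> C"
  shows "\<exists>c>0. \<forall>\<^sub>F j in sequentially. \<forall>n. \<bar>real n - size_mean (1 - T j)\<bar> \<le> C / (T j)\<^sup>2 \<longrightarrow>
    c * (T j)\<^sup>2 \<le> size_prob (1 - T j) n"
proof -
  define x where "x j = 1 - T j" for j
  define v where "v j = size_var (x j)" for j
  define \<sigma> where "\<sigma> j = sqrt (v j)" for j
  define \<mu> where "\<mu> j = size_mean (x j)" for j
  have x: "0 < x j" "x j < 1" "1 / 2 \<le> x j" "1 - x j = T j" for j
    using T(1,2)[of j] by (auto simp: x_def)
  have v: "1 / (4 * T j ^ 4) \<le> v j" "v j \<le> 12 / T j ^ 4" for j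
  proof -
    show "v j \<le> 12 / T j ^ 4" using size_var_bounds(2)[OF x(1,2), of j] unfolding x(4) v_def .
    have "(1 / 2) ^ 3 \<le> x j ^ 3" using x(3) by (intro power_mono) auto
    then have "(1 / 4) / T j ^ 4 \<le> 6 * x j ^ 3 / T j ^ 4"
      using T(1)[of j] by (intro divide_right_mono) (auto simp: power3_eq_cube)
    also have "\<dots> \<le> v j" using size_var_bounds(3)[OF x(1,2), of j] unfolding x(4) v_def .
    finally show "1 / (4 * T j ^ 4) \<le> v j" by simp
  qed
  have v_pos: "0 < v j" for j
    by (rule less_le_trans[OF _ v(1)]) (use T(1)[of j] in simp)
  then have \<sigma>_pos: "0 < \<sigma> j" and \<sigma>_sq: "(\<sigma> j)\<^sup>2 = v j" for j
    using less_imp_le[OF v_pos[of j]] by (simp_all add: \<sigma>_def)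
  have \<sigma>: "1 / (2 * (T j)\<^sup>2) \<le> \<sigma> j" "\<sigma> j \<le> 7 / (2 * (T j)\<^sup>2)" for j
  proof -
    have "(1 / (2 * (T j)\<^sup>2))\<^sup>2 = 1 / (4 * T j ^ 4)"
      by (simp add: power_divide power_mult_distrib flip: power_mult)
    then show "1 / (2 * (T j)\<^sup>2) \<le> \<sigma> j"
      unfolding \<sigma>_def using v(1)[of j] by (intro real_le_rsqrt) simp
    have "12 / T j ^ 4 \<le> (49 / 4) / T j ^ 4" using T(1)[of j] by (intro divide_right_mono) auto
    also have "\<dots> = (7 / (2 * (T j)\<^sup>2))\<^sup>2"
      by (simp add: power_divide power_mult_distrib flip: power_mult)
    finally show "\<sigma> j \<le> 7 / (2 * (T j)\<^sup>2)"
      unfolding \<sigma>_def using v(2)[of j] by (intro real_le_lsqrt) (auto simp: less_imp_le[OF v_pos])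
  qed
  \<comment> \<open>The centred characteristic function in the scale of the standard deviation, cut
    off to one period, minus its Gaussian limit.\<close>
  define s where "s j y = indicator {- (pi * \<sigma> j)..pi * \<sigma> j} y *\<^sub>R
      (char_fun (x j) (y / \<sigma> j) * iexp (- \<mu> j * (y / \<sigma> j))) - of_real (exp (- y\<^sup>2 / 2))" for j y
  define w where "w y = 4704 / (1 + y\<^sup>2) + exp (- y\<^sup>2 / 2)" for y :: real
  have w: "integrable lborel w"
    unfolding w_def[abs_def] by (intro Bochner_Integration.integrable_add integrable_cauchy gaussian_fourier(3))
  have [measurable]: "char_fun (x j) \<in> borel_measurable borel" for j by (rule char_fun_measurable[OF x(1,2)])
  have s_meas [measurable]: "s j \<in> borel_measurable lborel" for j unfolding s_def by measurable
  have s_le: "norm (s j y) \<le> w y" for j y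
  proof -
    define t where "t = T j"
    have t: "0 < t" using T(1) by (simp add: t_def)
    have "norm (indicator {- (pi * \<sigma> j)..pi * \<sigma> j} y *\<^sub>R (char_fun (x j) (y / \<sigma> j) * iexp (- \<mu> j * (y / \<sigma> j)))) \<le>
        4704 / (1 + y\<^sup>2)"
    proof (cases "y \<in> {- (pi * \<sigma> j)..pi * \<sigma> j}")
      case True
      then have y: "\<bar>y\<bar> \<le> pi * \<sigma> j" by auto
      then have "\<bar>y / \<sigma> j\<bar> \<le> pi" using \<sigma>_pos[of j] by (simp add: abs_divide divide_le_eq)
      then have "cmod (char_fun (x j) (y / \<sigma> j)) \<le>
          exp (- ((y / \<sigma> j)\<^sup>2 / (2 * t\<^sup>2 * (12 * t\<^sup>2 + (y / \<sigma> j)\<^sup>2))))"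
        using norm_char_fun_bound[OF x(1,2,3), of "y / \<sigma> j" j] unfolding x(4) t_def by blast
      also have "\<dots> \<le> exp (- (y\<^sup>2 / (288 + 28 * \<bar>y\<bar>)))"
      proof -
        have "(y / \<sigma> j)\<^sup>2 / (2 * t\<^sup>2 * (12 * t\<^sup>2 + (y / \<sigma> j)\<^sup>2)) = y\<^sup>2 / (2 * t\<^sup>2 * (12 * t\<^sup>2 * v j + y\<^sup>2))"
        proof -
          have "12 * t\<^sup>2 + (y / \<sigma> j)\<^sup>2 = (12 * t\<^sup>2 * v j + y\<^sup>2) / v j"
            using v_pos[of j] by (simp add: power_divide \<sigma>_sq field_simps)
          then show ?thesis using v_pos[of j] by (simp add: power_divide \<sigma>_sq)
        qed
        \<comment> \<open>\<open>v j \<le> 12 / t ^ 4\<close> gives \<open>288 = 24 * 12\<close>,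
          and \<open>\<bar>y\<bar> \<le> pi * \<sigma> j \<le> 14 / t\<^sup>2\<close> turns
          \<open>2 * t\<^sup>2 * y\<^sup>2\<close> into \<open>28 * \<bar>y\<bar>\<close>.\<close>
        moreover have "2 * t\<^sup>2 * (12 * t\<^sup>2 * v j + y\<^sup>2) \<le> 288 + 28 * \<bar>y\<bar>"
        proof -
          have "24 * t ^ 4 * v j \<le> 24 * t ^ 4 * (12 / t ^ 4)"
            using v(2)[of j] t unfolding t_def by (intro mult_left_mono) auto
          then have 1: "24 * t ^ 4 * v j \<le> 288" using t by simp
          have "\<bar>y\<bar> \<le> 4 * (7 / (2 * t\<^sup>2))"
            using y mult_mono[OF less_imp_le[OF pi_less_4] \<sigma>(2)[of j]] \<sigma>_pos[of j] unfolding t_def by linarith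
          then have "t\<^sup>2 * \<bar>y\<bar> \<le> t\<^sup>2 * (4 * (7 / (2 * t\<^sup>2)))" by (rule mult_left_mono) simp
          also have "t\<^sup>2 * (4 * (7 / (2 * t\<^sup>2))) = 14" using t by simp
          finally have "t\<^sup>2 * \<bar>y\<bar> \<le> 14" .
          then have "t\<^sup>2 * \<bar>y\<bar> * (2 * \<bar>y\<bar>) \<le> 14 * (2 * \<bar>y\<bar>)" by (rule mult_right_mono) simp
          moreover have "t\<^sup>2 * \<bar>y\<bar> * (2 * \<bar>y\<bar>) = 2 * t\<^sup>2 * y\<^sup>2" by (simp add: power2_eq_square)
          moreover have "2 * t\<^sup>2 * (12 * t\<^sup>2 * v j + y\<^sup>2) = 24 * t ^ 4 * v j + 2 * t\<^sup>2 * y\<^sup>2"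
            by (simp add: algebra_simps eval_nat_numeral)
          ultimately show ?thesis using 1 by linarith
        qed
        moreover have "0 < 2 * t\<^sup>2 * (12 * t\<^sup>2 * v j + y\<^sup>2)"
          using t v_pos[of j] by (intro mult_pos_pos add_pos_nonneg) auto
        ultimately show ?thesis by (simp add: divide_left_mono)
      qed
      also have "\<dots> \<le> 4704 / (1 + y\<^sup>2)" by (rule exp_dominated)
      finally show ?thesis using True by (simp add: norm_mult)
    qed (simp add: add_nonneg_nonneg)
    then show ?thesis unfolding s_def w_def
      by (intro order_trans[OF norm_triangle_ineq4] add_mono) simp_all
  qed
  have s_lim: "(\<lambda>j. s j y) \<longlonglongrightarrow> 0" for y
  proof -
    \<comment> \<open>The third cumulant is at most \<open>48 / T j ^ 5\<close> and
      \<open>1 / \<sigma> j \<le> 2 * (T j)\<^sup>2\<close>, so the cubic error is of order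
      \<open>T j\<close>.\<close>
    have "\<exists>R. char_fun (x j) (y / \<sigma> j) * iexp (- \<mu> j * (y / \<sigma> j)) = exp (of_real (- y\<^sup>2 / 2) + R) \<and>
        cmod R \<le> 64 * \<bar>y\<bar> ^ 3 * T j" for j
    proof -
      have summ: "summable (\<lambda>k. mean_term (x j ^ Suc k))"
        unfolding x_def by (rule size_mean_estimate(1)) (use T(1,2)[of j] in auto)
      obtain R where R: "char_fun (x j) (y / \<sigma> j) * iexp (- \<mu> j * (y / \<sigma> j)) =
          exp (of_real (- v j * (y / \<sigma> j)\<^sup>2 / 2) + R)" "cmod R \<le> third_moment (x j) * \<bar>y / \<sigma> j\<bar> ^ 3 / 6"
        using char_fun_expansion[OF x(1,2) summ, of "y / \<sigma> j"] unfolding v_def \<mu>_def by blast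
      have "v j * (y / \<sigma> j)\<^sup>2 = y\<^sup>2" using v_pos[of j] by (simp add: power_divide \<sigma>_sq)
      then have eq: "- v j * (y / \<sigma> j)\<^sup>2 / 2 = - y\<^sup>2 / 2" by simp
      have "\<bar>y / \<sigma> j\<bar> \<le> \<bar>y\<bar> * (2 * (T j)\<^sup>2)"
      proof -
        have "\<bar>y / \<sigma> j\<bar> = \<bar>y\<bar> / \<sigma> j" using \<sigma>_pos[of j] by (simp add: abs_divide)
        also have "\<dots> \<le> \<bar>y\<bar> / (1 / (2 * (T j)\<^sup>2))"
          using \<sigma>(1)[of j] \<sigma>_pos[of j] T(1)[of j] by (intro divide_left_mono) auto
        finally show ?thesis by simp
      qed
      then have "third_moment (x j) * \<bar>y / \<sigma> j\<bar> ^ 3 / 6 \<le> 48 / T j ^ 5 * (\<bar>y\<bar> * (2 * (T j)\<^sup>2)) ^ 3 / 6"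
        using third_moment_bounds(2)[OF x(1,2), of j] T(1)[of j] unfolding x(4)
        by (intro divide_right_mono mult_mono power_mono) auto
      also have "\<dots> = 64 * \<bar>y\<bar> ^ 3 * T j"
        using T(1)[of j] by (simp add: power_mult_distrib eval_nat_numeral)
      finally show ?thesis using R unfolding eq by (meson order_trans)
    qed
    then obtain R where R: "\<And>j. char_fun (x j) (y / \<sigma> j) * iexp (- \<mu> j * (y / \<sigma> j)) = exp (of_real (- y\<^sup>2 / 2) + R j)"
      "\<And>j. cmod (R j) \<le> 64 * \<bar>y\<bar> ^ 3 * T j" by metis
    have "(\<lambda>j. 64 * \<bar>y\<bar> ^ 3 * T j) \<longlonglongrightarrow> 64 * \<bar>y\<bar> ^ 3 * 0" by (intro tendsto_intros T(3))
    then have "R \<longlonglongrightarrow> 0"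
      by (intro Lim_null_comparison[OF always_eventually[OF allI[OF R(2)]]]) simp
    then have "(\<lambda>j. exp (of_real (- y\<^sup>2 / 2) + R j) - of_real (exp (- y\<^sup>2 / 2))) \<longlonglongrightarrow>
        exp (of_real (- y\<^sup>2 / 2) + 0) - of_real (exp (- y\<^sup>2 / 2))"
      by (intro tendsto_intros)
    then have lim: "(\<lambda>j. exp (of_real (- y\<^sup>2 / 2) + R j) - of_real (exp (- y\<^sup>2 / 2))) \<longlonglongrightarrow> 0"
      by (simp add: exp_of_real[symmetric])
    \<comment> \<open>For such \<open>j\<close> the point \<open>y\<close> lies within the cut-off,
      since \<open>pi * \<sigma> j \<ge> 1 / T j \<ge> 1 + \<bar>y\<bar>\<close>.\<close>
    have "\<forall>\<^sub>F j in sequentially. T j < 1 / (1 + \<bar>y\<bar>)"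
      by (rule order_tendstoD(2)[OF T(3)]) (simp add: add_pos_nonneg)
    then have "\<forall>\<^sub>F j in sequentially. s j y = exp (of_real (- y\<^sup>2 / 2) + R j) - of_real (exp (- y\<^sup>2 / 2))"
    proof eventually_elim
      case (elim j)
      have "T j * (1 + \<bar>y\<bar>) \<le> 1" using elim by (simp add: less_divide_eq add_pos_nonneg)
      then have "1 + \<bar>y\<bar> \<le> 1 / T j" using T(1)[of j] by (simp add: le_divide_eq mult.commute)
      also have "\<dots> \<le> 1 / (2 * (T j)\<^sup>2)"
      proof (rule divide_left_mono)
        show "2 * (T j)\<^sup>2 \<le> T j"
          using mult_left_mono[OF T(2), of "T j" j] T(1)[of j] by (simp add: power2_eq_square)
      qed (use T(1)[of j] in auto)
      also have "\<dots> \<le> \<sigma> j" by (rule \<sigma>(1))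
      also have "\<dots> \<le> pi * \<sigma> j" using \<sigma>_pos[of j] pi_ge_two by simp
      finally have "y \<in> {- (pi * \<sigma> j)..pi * \<sigma> j}" by auto
      then show ?case unfolding s_def R(1) by simp
    qed
    then show ?thesis using lim by (simp add: tendsto_cong)
  qed
  define I where "I j = (LINT y|lborel. norm (s j y))" for j
  have "I \<longlonglongrightarrow> integral\<^sup>L (lborel :: real measure) (\<lambda>_. 0 :: real)" unfolding I_def[abs_def]
  proof (rule integral_dominated_convergence[where w = w])
    show "integrable lborel w" by (rule w)
    show "AE y in lborel. (\<lambda>j. norm (s j y)) \<longlonglongrightarrow> 0"
      using s_lim by (intro AE_I2 tendsto_norm_zero) 
    show "AE y in lborel. norm (norm (s j y)) \<le> w y" for j using s_le by (intro AE_I2) simp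
  qed auto
  then have I: "I \<longlonglongrightarrow> 0" by simp
  have s_int: "integrable lborel (s j)" for j
  proof (rule Bochner_Integration.integrable_bound[OF w s_meas])
    show "AE y in lborel. norm (s j y) \<le> norm (w y)"
      by (rule AE_I2, rule order_trans[OF s_le]) simp
  qed
  have main: "sqrt (2 * pi) * exp (- ((real n - \<mu> j) / \<sigma> j)\<^sup>2 / 2) - I j \<le> 2 * pi * \<sigma> j * size_prob (x j) n" for j n
  proof -
    define d where "d = (real n - \<mu> j) / \<sigma> j"
    let ?g = "\<lambda>\<theta>. indicator {-pi..pi} \<theta> *\<^sub>R (char_fun (x j) \<theta> * iexp (- real n * \<theta>))"
    have "2 * pi * size_prob (x j) n = (LINT \<theta>|lborel. ?g \<theta>)"
      unfolding char_fun_def[OF x(1,2)]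
      using fourier_coefficient[OF size_prob_nonneg[OF x(1,2)] sums_summable[OF size_prob_sums[OF x(1,2)]]] .
    also have "\<dots> = \<bar>1 / \<sigma> j\<bar> *\<^sub>R (LINT y|lborel. ?g (0 + 1 / \<sigma> j * y))"
      by (rule lborel_integral_real_affine) (use \<sigma>_pos[of j] in simp)
    also have "(\<lambda>y. ?g (0 + 1 / \<sigma> j * y)) = (\<lambda>y. s j y * iexp (- d * y) + of_real (exp (- y\<^sup>2 / 2)) * iexp (- d * y))"
    proof
      fix y
      have ind: "(indicator {-pi..pi} (0 + 1 / \<sigma> j * y) :: real) = indicator {- (pi * \<sigma> j)..pi * \<sigma> j} y"
        using \<sigma>_pos[of j] by (auto simp: indicator_def divide_le_eq le_divide_eq)
      have "iexp (- real n * (y / \<sigma> j)) = iexp (- \<mu> j * (y / \<sigma> j)) * iexp (- d * y)"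
        unfolding exp_add[symmetric] d_def using \<sigma>_pos[of j]
        by (intro arg_cong[of _ _ exp]) (simp add: field_simps)
      then show "?g (0 + 1 / \<sigma> j * y) = s j y * iexp (- d * y) + of_real (exp (- y\<^sup>2 / 2)) * iexp (- d * y)"
        unfolding ind s_def by (simp add: algebra_simps)
    qed
    also have "(LINT y|lborel. s j y * iexp (- d * y) + of_real (exp (- y\<^sup>2 / 2)) * iexp (- d * y)) =
        (LINT y|lborel. s j y * iexp (- d * y)) + (LINT y|lborel. of_real (exp (- y\<^sup>2 / 2)) * iexp (- d * y))"
    proof (rule Bochner_Integration.integral_add)
      show "integrable lborel (\<lambda>y. s j y * iexp (- d * y))"
        by (rule Bochner_Integration.integrable_bound[OF s_int[of j]]) (auto simp: norm_mult)
    qed (rule gaussian_fourier(1))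
    also have "(LINT y|lborel. of_real (exp (- y\<^sup>2 / 2)) * iexp (- d * y)) = of_real (sqrt (2 * pi) * exp (- d\<^sup>2 / 2))"
      by (rule gaussian_fourier(2))
    finally have eq: "complex_of_real (2 * pi * \<sigma> j * size_prob (x j) n) =
        (LINT y|lborel. s j y * iexp (- d * y)) + of_real (sqrt (2 * pi) * exp (- d\<^sup>2 / 2))"
      using \<sigma>_pos[of j] by (simp add: scaleR_conv_of_real field_simps)
    have "cmod (LINT y|lborel. s j y * iexp (- d * y)) \<le> (LINT y|lborel. norm (s j y * iexp (- d * y)))"
      by (rule integral_norm_bound)
    also have "\<dots> = I j" by (simp add: I_def norm_mult)
    finally have "- I j \<le> Re (LINT y|lborel. s j y * iexp (- d * y))"
      using abs_Re_le_cmod[of "LINT y|lborel. s j y * iexp (- d * y)"] by linarith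
    moreover have "2 * pi * \<sigma> j * size_prob (x j) n =
        Re (LINT y|lborel. s j y * iexp (- d * y)) + sqrt (2 * pi) * exp (- d\<^sup>2 / 2)"
      using arg_cong[OF eq, of Re] by (simp only: Re_complex_of_real plus_complex.sel)
    ultimately show ?thesis unfolding d_def by linarith
  qed
  \<comment> \<open>For \<open>\<bar>d\<bar> \<le> 2 * C\<close> the Gaussian main term is at least
    \<open>G\<close>; half of it absorbs \<open>I j\<close>.\<close>
  define G where "G = sqrt (2 * pi) * exp (- 2 * C\<^sup>2)"
  have G: "0 < G" by (simp add: G_def)
  have "\<forall>\<^sub>F j in sequentially. I j < G / 2" using G by (intro order_tendstoD(2)[OF I]) simp
  then have "\<forall>\<^sub>F j in sequentially. \<forall>n. \<bar>real n - size_mean (1 - T j)\<bar> \<le> C / (T j)\<^sup>2 \<longrightarrow>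
    G / (14 * pi) * (T j)\<^sup>2 \<le> size_prob (1 - T j) n"
  proof (eventually_elim, intro allI impI)
    fix j n
    assume Ij: "I j < G / 2" and n: "\<bar>real n - size_mean (1 - T j)\<bar> \<le> C / (T j)\<^sup>2"
    define d where "d = (real n - \<mu> j) / \<sigma> j"
    have "\<bar>d\<bar> = \<bar>real n - \<mu> j\<bar> / \<sigma> j" using \<sigma>_pos[of j] by (simp add: d_def abs_divide)
    also have "\<dots> \<le> (C / (T j)\<^sup>2) / (1 / (2 * (T j)\<^sup>2))"
      using n \<sigma>(1)[of j] T(1)[of j] C unfolding \<mu>_def x_def by (intro frac_le) auto
    also have "\<dots> = 2 * C" using T(1)[of j] by simp
    finally have "d\<^sup>2 \<le> (2 * C)\<^sup>2" by (rule abs_le_square_iff[THEN iffD1, OF order_trans[OF _ abs_ge_self]])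
    then have "exp (- 2 * C\<^sup>2) \<le> exp (- d\<^sup>2 / 2)" by (simp add: power_mult_distrib)
    then have "G \<le> sqrt (2 * pi) * exp (- d\<^sup>2 / 2)" unfolding G_def by (intro mult_left_mono) auto
    then have "G / 2 \<le> 2 * pi * \<sigma> j * size_prob (x j) n" using main[where j = j and n = n] Ij unfolding d_def by linarith
    also have "\<dots> \<le> 2 * pi * (7 / (2 * (T j)\<^sup>2)) * size_prob (x j) n"
      using \<sigma>(2)[of j] size_prob_nonneg[OF x(1,2), of j n] by (intro mult_right_mono mult_left_mono) auto
    finally have "G / 2 \<le> 7 * pi / (T j)\<^sup>2 * size_prob (x j) n" by simp
    then show "G / (14 * pi) * (T j)\<^sup>2 \<le> size_prob (1 - T j) n"
      using T(1)[of j] pi_gt_zero unfolding x_def by (simp add: field_simps)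
  qed
  then show ?thesis using G by (intro exI[of _ "G / (14 * pi)"]) simp
qed

section \<open>Pak's transform\<close>

text \<open>Reflects the entry in the interval from the larger of the entries below and to the right
  to the smaller of those above and to the left. Where the array is ordered this keeps the order and
  is an involution.\<close>

definition toggle :: "diagram \<Rightarrow> nat \<Rightarrow> nat \<Rightarrow> nat" where
  "toggle D p q = max (D (p + 1, q)) (D (p, q + 1)) + min (D (p - 1, q)) (D (p, q - 1)) - D (p, q)"

text \<open>The entries read by a toggle lie on the two neighbouring diagonals, so all the toggles of one
  step may be performed simultaneously; beyond the bounding rectangle they do nothing.\<close>

definition pak_step :: "nat \<Rightarrow> nat \<Rightarrow> diagram \<Rightarrow> diagram" where
  "pak_step i j D = (\<lambda>(p, q).
     if p = i \<and> q = j then D (i, j) + max (D (i + 1, j)) (D (i, j + 1))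
     else if i < p \<and> p + j = q + i then toggle D p q else D (p, q))"

definition pak_unstep :: "nat \<Rightarrow> nat \<Rightarrow> diagram \<Rightarrow> diagram" where
  "pak_unstep i j D = (\<lambda>(p, q).
     if p = i \<and> q = j then D (i, j) - max (D (i + 1, j)) (D (i, j + 1))
     else if i < p \<and> p + j = q + i then toggle D p q else D (p, q))"

definition pak_rect :: "nat \<Rightarrow> nat \<Rightarrow> diagram \<Rightarrow> diagram" where
  "pak_rect l w = fold (\<lambda>i. fold (pak_step i) (rev [0..<w])) (rev [0..<l])"

definition pak :: "diagram \<Rightarrow> diagram" where
  "pak D = pak_rect (num_rows D) (num_cols D) D"

section \<open>Independence of the chosen rectangle\<close>

definition supported :: "nat \<Rightarrow> nat \<Rightarrow> diagram \<Rightarrow> bool" where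
  "supported l w D \<longleftrightarrow> (\<forall>p q. D (p, q) \<noteq> 0 \<longrightarrow> p < l \<and> q < w)"

lemma supportedD: "supported l w D \<Longrightarrow> l \<le> p \<or> w \<le> q \<Longrightarrow> D (p, q) = 0"
  by (meson leD supported_def)

lemma supported_mono: "supported l w D \<Longrightarrow> l \<le> l' \<Longrightarrow> w \<le> w' \<Longrightarrow> supported l' w' D"
  unfolding supported_def by fastforce

lemma toggle_eq_0: "supported l w D \<Longrightarrow> l \<le> p \<or> w \<le> q \<Longrightarrow> toggle D p q = 0"
  using supportedD[of l w D p q] supportedD[of l w D "p + 1" q] supportedD[of l w D p "q + 1"]
    supportedD[of l w D p "q - 1"] supportedD[of l w D "p - 1" q]
  by (auto simp: toggle_def)

lemma pak_step_supported:
  assumes "supported l w D" "i < l" "j < w"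
  shows "supported l w (pak_step i j D)"
  unfolding supported_def
proof (intro allI impI)
  fix p q assume *: "pak_step i j D (p, q) \<noteq> 0"
  show "p < l \<and> q < w"
  proof (rule ccontr)
    assume "\<not> (p < l \<and> q < w)"
    then have "toggle D p q = 0" "D (p, q) = 0" "\<not> (p = i \<and> q = j)"
      using toggle_eq_0[OF assms(1), of p q] supportedD[OF assms(1), of p q] assms(2,3) by auto
    with * show False by (auto simp: pak_step_def split: if_splits)
  qed
qed

lemma pak_step_id:
  assumes "supported l w D" "l \<le> i \<or> w \<le> j"
  shows "pak_step i j D = D"
proof (intro ext, clarify)
  fix p q
  have "toggle D p q = 0" "D (p, q) = 0" if "i < p" "p + j = q + i"
  proof -
    have "l \<le> p \<or> w \<le> q" using assms(2) that by auto
    then show "toggle D p q = 0" "D (p, q) = 0"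
      using toggle_eq_0[OF assms(1)] supportedD[OF assms(1)] by blast+
  qed
  then show "pak_step i j D (p, q) = D (p, q)"
    using supportedD[OF assms(1), of "i + 1" j] supportedD[OF assms(1), of i "j + 1"] assms(2)
    by (auto simp: pak_step_def)
qed

text \<open>The loops run downwards, so the step at \<open>j\<close> leads from stage
  \<open>Suc j\<close> to stage \<open>j\<close>.\<close>

lemma fold_rev_upt_invariant:
  assumes "\<And>j D. j < n \<Longrightarrow> P (Suc j) D \<Longrightarrow> P j (f j D)" and "P n D"
  shows "P 0 (fold f (rev [0..<n]) D)"
  using assms by (induction n arbitrary: D) auto

lemma fold_rev_upt_bij_betw:
  assumes "\<And>j. j < n \<Longrightarrow> bij_betw (f j) (S (Suc j)) (S j)"
  shows "bij_betw (fold f (rev [0..<n])) (S n) (S 0)"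
  using assms
proof (induction n)
  case (Suc n)
  then have "bij_betw (fold f (rev [0..<n]) \<circ> f n) (S (Suc n)) (S 0)"
    by (intro bij_betw_trans[of "f n" _ "S n"]) auto
  then show ?case by (simp add: comp_def)
qed (simp add: bij_betw_def)

lemma fold_id_on: "(\<And>i. i \<in> set is \<Longrightarrow> f i D = D) \<Longrightarrow> fold f is D = D"
  by (induction "is") auto

lemma rev_upt_split: "m \<le> n \<Longrightarrow> rev [0..<n] = rev [m..<n] @ rev [0..<m]"
  by (metis le0 le_Suc_ex rev_append upt_add_eq_append)

lemma fold_pak_step_mono:
  assumes "supported l w D" "w \<le> w'"
  shows "fold (pak_step i) (rev [0..<w']) D = fold (pak_step i) (rev [0..<w]) D"
  using fold_id_on[of "rev [w..<w']" "pak_step i" D] pak_step_id[OF assms(1)] assms(2)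
  by (simp add: rev_upt_split[OF assms(2)])

lemma pak_row_supported:
  assumes "supported l w D" "i < l"
  shows "supported l w (fold (pak_step i) (rev [0..<w]) D)"
  using fold_rev_upt_invariant[of w "\<lambda>_. supported l w" "pak_step i" D] assms pak_step_supported
  by blast

lemma pak_rect_supported:
  assumes "supported l w D"
  shows "supported l w (pak_rect l w D)"
  unfolding pak_rect_def
  using fold_rev_upt_invariant[of l "\<lambda>_. supported l w" "\<lambda>i. fold (pak_step i) (rev [0..<w])" D]
    pak_row_supported assms by blast

lemma fold_cong_supported:
  assumes "supported l w D" "\<And>i D. i \<in> set is \<Longrightarrow> supported l w D \<Longrightarrow> f i D = g i D \<and> supported l w (g i D)"
  shows "fold f is D = fold g is D"
  using assms by (induction "is" arbitrary: D) auto

text \<open>Steps at cells outside the rectangle that contains the support change nothing. So the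
  bounding rectangle, which varies with the diagram, may be replaced by a common square for several
  diagrams.\<close>

lemma pak_rect_mono:
  assumes "supported l w D" "l \<le> l'" "w \<le> w'"
  shows "pak_rect l' w' D = pak_rect l w D"
proof -
  have "fold (\<lambda>i. fold (pak_step i) (rev [0..<w'])) (rev [l..<l']) D = D"
    by (intro fold_id_on) (use pak_step_id[OF assms(1)] in auto)
  moreover have "fold (\<lambda>i. fold (pak_step i) (rev [0..<w'])) (rev [0..<l]) D =
      fold (\<lambda>i. fold (pak_step i) (rev [0..<w])) (rev [0..<l]) D"
  proof (rule fold_cong_supported[OF assms(1)])
    fix i D assume "i \<in> set (rev [0..<l])" and D: "supported l w D"
    then have "i < l" by simp
    then show "fold (pak_step i) (rev [0..<w']) D = fold (pak_step i) (rev [0..<w]) D \<and>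
        supported l w (fold (pak_step i) (rev [0..<w]) D)"
      using pak_row_supported[OF D] fold_pak_step_mono[OF D assms(3)] by blast
  qed
  ultimately show ?thesis unfolding pak_rect_def by (simp add: rev_upt_split[OF assms(2)])
qed

section \<open>Order on the visited cells and invertibility of a step\<close>

definition processed :: "nat \<Rightarrow> nat \<Rightarrow> (nat \<times> nat) set" where
  "processed i j = {(p, q). i < p \<or> p = i \<and> j \<le> q}"

definition ordered_on :: "(nat \<times> nat) set \<Rightarrow> diagram \<Rightarrow> bool" where
  "ordered_on R D \<longleftrightarrow> (\<forall>(p, q)\<in>R. D (p + 1, q) \<le> D (p, q) \<and> D (p, q + 1) \<le> D (p, q))"

lemma ordered_onD:
  "ordered_on R D \<Longrightarrow> (p, q) \<in> R \<Longrightarrow> D (p + 1, q) \<le> D (p, q)"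
  "ordered_on R D \<Longrightarrow> (p, q) \<in> R \<Longrightarrow> D (p, q + 1) \<le> D (p, q)"
  unfolding ordered_on_def by auto

text \<open>The upper and the left neighbour of a cell further down the diagonal of
  \<open>(i, j)\<close> are already visited, so the entry lies in the interval in which it is
  reflected, and so does its reflection. In particular the subtraction in \<open>toggle\<close> does
  not truncate.\<close>

lemma toggle_bounds:
  assumes "ordered_on (processed i (j + 1)) D" "i < p" "p + j = q + i"
  shows "D (p, q) \<le> min (D (p - 1, q)) (D (p, q - 1))" and "max (D (p + 1, q)) (D (p, q + 1)) \<le> D (p, q)"
    and "max (D (p + 1, q)) (D (p, q + 1)) \<le> toggle D p q" and "toggle D p q \<le> min (D (p - 1, q)) (D (p, q - 1))"
proof -
  obtain c where c: "p = i + Suc c" "q = j + Suc c"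
    using assms(2,3) by (metis add.assoc add.commute add_left_cancel less_imp_Suc_add add_Suc_right)
  show "D (p, q) \<le> min (D (p - 1, q)) (D (p, q - 1))" "max (D (p + 1, q)) (D (p, q + 1)) \<le> D (p, q)"
    using ordered_onD(1)[OF assms(1), of "i + c" q] ordered_onD(2)[OF assms(1), of p "j + c"]
      ordered_onD[OF assms(1), of p q]
    by (auto simp: c processed_def)
  then show "max (D (p + 1, q)) (D (p, q + 1)) \<le> toggle D p q" "toggle D p q \<le> min (D (p - 1, q)) (D (p, q - 1))"
    unfolding toggle_def by linarith+
qed

text \<open>The entry of \<open>E\<close> at \<open>(i, j)\<close> is left open, so that one
  argument serves the step and its inverse. Neighbouring cells never lie on the same diagonal; hence
  each comparison involves at most one toggled entry, to which \<open>toggle_bounds\<close>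
  applies.\<close>

lemma ordered_on_toggle:
  assumes D: "ordered_on (processed i (j + 1)) D"
    and tog: "\<And>p q. i < p \<Longrightarrow> p + j = q + i \<Longrightarrow> E (p, q) = toggle D p q"
    and off: "\<And>p q. p + j \<noteq> q + i \<Longrightarrow> E (p, q) = D (p, q)"
  shows "ordered_on (processed i (j + 1)) E"
  unfolding ordered_on_def
proof (clarify)
  fix p q assume pq: "(p, q) \<in> processed i (j + 1)"
  consider "i < p" "p + j = q + i" | "p + j + 1 = q + i" | "p + j = q + i + 1" | "p + j \<noteq> q + i" "p + j + 1 \<noteq> q + i" "p + j \<noteq> q + i + 1"
    using pq by (fastforce simp: processed_def)
  then show "E (p + 1, q) \<le> E (p, q) \<and> E (p, q + 1) \<le> E (p, q)"
  proof cases
    case 1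
    have "E (p + 1, q) = D (p + 1, q)" "E (p, q + 1) = D (p, q + 1)"
      using 1 by (auto intro!: off)
    then show ?thesis using toggle_bounds(3)[OF D 1] tog[OF 1] by simp
  next
    case 2
    then have "i < p + 1" using pq by (auto simp: processed_def)
    then have "E (p + 1, q) \<le> D (p, q)"
      using tog[of "p + 1" q] toggle_bounds(4)[OF D, of "p + 1" q] 2 by simp
    moreover have "E (p, q + 1) = D (p, q + 1)" "E (p, q) = D (p, q)"
      using 2 by (auto intro!: off)
    ultimately show ?thesis using ordered_onD[OF D pq] by simp
  next
    case 3
    then have "i < p" using pq by (auto simp: processed_def)
    then have "E (p, q + 1) \<le> D (p, q)"
      using tog[of p "q + 1"] toggle_bounds(4)[OF D, of p "q + 1"] 3 by simp
    moreover have "E (p + 1, q) = D (p + 1, q)" "E (p, q) = D (p, q)"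
      using 3 by (auto intro!: off)
    ultimately show ?thesis using ordered_onD[OF D pq] by simp
  next
    case 4
    have "E (p + 1, q) = D (p + 1, q)" "E (p, q + 1) = D (p, q + 1)" "E (p, q) = D (p, q)"
      using 4 by (auto intro!: off)
    then show ?thesis using ordered_onD[OF D pq] by simp
  qed
qed

lemma processed_Suc: "processed i j = insert (i, j) (processed i (j + 1))"
  unfolding processed_def by auto

lemma ordered_on_pak_step:
  assumes "ordered_on (processed i (j + 1)) D"
  shows "ordered_on (processed i j) (pak_step i j D)"
proof -
  have "ordered_on (processed i (j + 1)) (pak_step i j D)"
    by (rule ordered_on_toggle[OF assms]) (auto simp: pak_step_def)
  then show ?thesis unfolding processed_Suc[of i j] ordered_on_def by (auto simp: pak_step_def)
qed

text \<open>The four neighbours read by a toggle are off the diagonal and hence unchanged, so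
  toggling twice reflects twice in the same interval.\<close>

lemma pak_unstep_step:
  assumes D: "ordered_on (processed i (j + 1)) D"
  shows "pak_unstep i j (pak_step i j D) = D"
proof (intro ext, clarify)
  fix p q
  have "toggle (pak_step i j D) p q = D (p, q)" if pq: "i < p" "p + j = q + i"
  proof -
    have "toggle (pak_step i j D) p q =
       max (D (p + 1, q)) (D (p, q + 1)) + min (D (p - 1, q)) (D (p, q - 1)) - toggle D p q"
      using pq unfolding toggle_def[of "pak_step i j D"] by (auto simp: pak_step_def)
    moreover have "D (p, q) \<le> max (D (p + 1, q)) (D (p, q + 1)) + min (D (p - 1, q)) (D (p, q - 1))"
      using toggle_bounds(1)[OF D pq] by (rule trans_le_add2)
    ultimately show ?thesis unfolding toggle_def[of D] by (metis diff_diff_cancel)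
  qed
  then show "pak_unstep i j (pak_step i j D) (p, q) = D (p, q)"
    by (auto simp: pak_unstep_def) (auto simp: pak_step_def)
qed

lemma ordered_on_pak_unstep:
  assumes "ordered_on (processed i j) D"
  shows "ordered_on (processed i (j + 1)) (pak_unstep i j D)"
  by (rule ordered_on_toggle[of i j D])
    (use assms in \<open>auto simp: pak_unstep_def processed_Suc[of i j] ordered_on_def\<close>)

lemma pak_step_unstep:
  assumes D: "ordered_on (processed i j) D"
  shows "pak_step i j (pak_unstep i j D) = D"
proof (intro ext, clarify)
  fix p q
  have D': "ordered_on (processed i (j + 1)) D"
    using D by (auto simp: processed_Suc[of i j] ordered_on_def)
  have "toggle (pak_unstep i j D) p q = D (p, q)" if pq: "i < p" "p + j = q + i"
  proof -
    have "toggle (pak_unstep i j D) p q =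
       max (D (p + 1, q)) (D (p, q + 1)) + min (D (p - 1, q)) (D (p, q - 1)) - toggle D p q"
      using pq unfolding toggle_def[of "pak_unstep i j D"] by (auto simp: pak_unstep_def)
    moreover have "D (p, q) \<le> max (D (p + 1, q)) (D (p, q + 1)) + min (D (p - 1, q)) (D (p, q - 1))"
      using toggle_bounds(1)[OF D' pq] by (rule trans_le_add2)
    ultimately show ?thesis unfolding toggle_def[of D] by (metis diff_diff_cancel)
  qed
  moreover have "max (D (i + 1, j)) (D (i, j + 1)) \<le> D (i, j)"
    using ordered_onD[OF D, of i j] by (auto simp: processed_def)
  ultimately show "pak_step i j (pak_unstep i j D) (p, q) = D (p, q)"
    by (auto simp: pak_step_def) (auto simp: pak_unstep_def)
qed

lemma pak_unstep_supported:
  assumes "supported l w D" "i < l" "j < w"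
  shows "supported l w (pak_unstep i j D)"
  unfolding supported_def
proof (intro allI impI)
  fix p q assume *: "pak_unstep i j D (p, q) \<noteq> 0"
  show "p < l \<and> q < w"
  proof (rule ccontr)
    assume "\<not> (p < l \<and> q < w)"
    then have "toggle D p q = 0" "D (p, q) = 0" "\<not> (p = i \<and> q = j)"
      using toggle_eq_0[OF assms(1), of p q] supportedD[OF assms(1), of p q] assms(2,3) by auto
    with * show False by (auto simp: pak_unstep_def split: if_splits)
  qed
qed

lemma pak_step_bij_betw:
  assumes "i < l" "j < w"
  shows "bij_betw (pak_step i j) {D. supported l w D \<and> ordered_on (processed i (Suc j)) D}
    {D. supported l w D \<and> ordered_on (processed i j) D}"
  by (rule bij_betw_byWitness[where f' = "pak_unstep i j"])
    (use assms pak_unstep_step pak_step_unstep pak_step_supported pak_unstep_supported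
      ordered_on_pak_step ordered_on_pak_unstep in auto)

text \<open>From column \<open>w\<close> on the entries of row \<open>i\<close> vanish, so a row may
  be started with its infinite tail counted as visited.\<close>

lemma processed_row_end:
  assumes "supported l w D"
  shows "ordered_on (processed i w) D \<longleftrightarrow> ordered_on (processed (Suc i) 0) D"
proof -
  have "processed i w = processed (Suc i) 0 \<union> {(i, q) | q. w \<le> q}"
    by (auto simp: processed_def)
  moreover have "ordered_on {(i, q) | q. w \<le> q} D"
    using supportedD[OF assms] by (auto simp: ordered_on_def)
  ultimately show ?thesis by (simp add: ordered_on_def ball_Un)
qed

lemma pak_rect_bij_betw:
  "bij_betw (pak_rect l w) {D. supported l w D} {D. supported l w D \<and> ordered_on UNIV D}"
proof -
  define S where "S i = {D. supported l w D \<and> ordered_on (processed i 0) D}" for i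
  have "bij_betw (fold (pak_step i) (rev [0..<w])) (S (Suc i)) (S i)" if "i < l" for i
    using fold_rev_upt_bij_betw[of w "pak_step i" "\<lambda>j. {D. supported l w D \<and> ordered_on (processed i j) D}"]
      pak_step_bij_betw[OF that]
    by (simp add: S_def processed_row_end cong: conj_cong)
  from fold_rev_upt_bij_betw[of l "\<lambda>i. fold (pak_step i) (rev [0..<w])" S, OF this]
  have "bij_betw (pak_rect l w) (S l) (S 0)" by (simp add: pak_rect_def)
  moreover have "ordered_on (processed l 0) D" if "supported l w D" for D
    using supportedD[OF that] by (auto simp: ordered_on_def processed_def)
  then have "S l = {D. supported l w D}" by (auto simp: S_def)
  moreover have "processed 0 0 = UNIV" by (auto simp: processed_def)
  ultimately show ?thesis by (simp add: S_def)
qed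



section \<open>Conservation of the size: diagonals against quadrants\<close>

definition diagonal_sum :: "nat \<Rightarrow> diagram \<Rightarrow> nat \<Rightarrow> nat \<Rightarrow> nat" where
  "diagonal_sum N D i j = (\<Sum>c\<le>N. D (i + c, j + c))"

definition rect_sum :: "nat \<Rightarrow> diagram \<Rightarrow> nat \<Rightarrow> nat \<Rightarrow> nat" where
  "rect_sum N D i j = (\<Sum>u\<in>{i..<N}. \<Sum>v\<in>{j..<N}. D (u, v))"

text \<open>Inclusion and exclusion for quadrants; \<open>diagonal_sum_step\<close> is the same
  recurrence for diagonals.\<close>

lemma rect_sum_rec:
  assumes "i < N" "j < N"
  shows "rect_sum N D i j + rect_sum N D (i + 1) (j + 1) =
    D (i, j) + rect_sum N D (i + 1) j + rect_sum N D i (j + 1)"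
  using assms by (simp add: rect_sum_def sum.atLeast_Suc_lessThan sum.distrib)

text \<open>Each \<open>max\<close> of a toggle is paired with the \<open>min\<close> of the next one on the diagonal.\<close>

lemma diagonal_sum_step_partial:
  assumes "ordered_on (processed i (j + 1)) D"
  shows "(\<Sum>c\<le>K. pak_step i j D (i + c, j + c)) + (\<Sum>c<K. D (i + 1 + c, j + 1 + c)) =
    D (i, j) + (\<Sum>c<K. D (i + 1 + c, j + c) + D (i + c, j + 1 + c))
      + max (D (i + 1 + K, j + K)) (D (i + K, j + 1 + K))"
proof (induction K)
  case 0
  show ?case by (simp add: pak_step_def)
next
  case (Suc K)
  let ?p = "i + Suc K" and ?q = "j + Suc K"
  have "D (?p, ?q) \<le> min (D (?p - 1, ?q)) (D (?p, ?q - 1))"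
    by (rule toggle_bounds(1)[OF assms]) auto
  then have "D (?p, ?q) \<le> max (D (?p + 1, ?q)) (D (?p, ?q + 1)) + min (D (?p - 1, ?q)) (D (?p, ?q - 1))"
    by (rule trans_le_add2)
  moreover have "pak_step i j D (?p, ?q) = toggle D ?p ?q" by (simp add: pak_step_def)
  ultimately have "pak_step i j D (?p, ?q) + D (?p, ?q) =
      max (D (?p + 1, ?q)) (D (?p, ?q + 1)) + min (D (?p - 1, ?q)) (D (?p, ?q - 1))"
    unfolding toggle_def by (metis le_add_diff_inverse2)
  moreover have "max a b + min b a = a + b" for a b :: nat by (simp add: max_def min_def)
  ultimately show ?case using Suc.IH by (simp add: algebra_simps)
qed

text \<open>The \<open>max\<close> left over after \<open>N\<close> toggles is zero, as both its
  entries lie outside the square.\<close>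

lemma diagonal_sum_step:
  assumes "supported N N D" "ordered_on (processed i (j + 1)) D"
  shows "diagonal_sum N (pak_step i j D) i j + diagonal_sum N D (i + 1) (j + 1) =
    D (i, j) + diagonal_sum N D (i + 1) j + diagonal_sum N D i (j + 1)"
  using diagonal_sum_step_partial[OF assms(2), of N] supportedD[OF assms(1)]
  by (simp add: diagonal_sum_def sum.distrib lessThan_Suc_atMost[symmetric])

text \<open>The condition on \<open>(p, q)\<close> says that its diagonal enters \<open>R\<close>
  there. Quadrants are taken in the initial diagram \<open>D\<^sub>0\<close>, with which
  \<open>D\<close> still agrees outside \<open>R\<close>.\<close>

definition sums_match :: "nat \<Rightarrow> diagram \<Rightarrow> (nat \<times> nat) set \<Rightarrow> diagram \<Rightarrow> bool" where
  "sums_match N D\<^sub>0 R D \<longleftrightarrow> (\<forall>(p, q)\<in>R. p = 0 \<or> q = 0 \<or> (p - 1, q - 1) \<notin> R \<longrightarrow>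
     diagonal_sum N D p q = rect_sum N D\<^sub>0 p q) \<and> (\<forall>c. c \<notin> R \<longrightarrow> D c = D\<^sub>0 c)"

text \<open>The step makes \<open>(i, j)\<close> the first visited cell of its diagonal in place of
  \<open>(i + 1, j + 1)\<close>. The two adjacent diagonals begin at \<open>(i + 1, j)\<close> and
  \<open>(i, j + 1)\<close>, so the diagonal sums of \<open>D\<close> in
  \<open>diagonal_sum_step\<close> are known quadrant sums. All other diagonals are
  untouched.\<close>

lemma sums_match_pak_step:
  assumes D: "supported N N D" "ordered_on (processed i (j + 1)) D"
    and m: "sums_match N D\<^sub>0 (processed i (j + 1)) D" and ij: "i < N" "j < N"
  shows "sums_match N D\<^sub>0 (processed i j) (pak_step i j D)"
proof -
  have eq: "diagonal_sum N D p q = rect_sum N D\<^sub>0 p q"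
    if "(p, q) \<in> processed i (j + 1)" "p = 0 \<or> q = 0 \<or> (p - 1, q - 1) \<notin> processed i (j + 1)" for p q
    using m that unfolding sums_match_def by blast
  have "D (i, j) = D\<^sub>0 (i, j)" using m by (auto simp: sums_match_def processed_def)
  have corner: "diagonal_sum N (pak_step i j D) i j = rect_sum N D\<^sub>0 i j"
  proof -
    have "diagonal_sum N D (i + 1) j = rect_sum N D\<^sub>0 (i + 1) j"
      by (rule eq) (auto simp: processed_def)
    moreover have "diagonal_sum N D i (j + 1) = rect_sum N D\<^sub>0 i (j + 1)"
      by (cases i; rule eq) (auto simp: processed_def)
    moreover have "diagonal_sum N D (i + 1) (j + 1) = rect_sum N D\<^sub>0 (i + 1) (j + 1)"
      by (rule eq) (auto simp: processed_def)
    ultimately show ?thesis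
      using diagonal_sum_step[OF D] rect_sum_rec[OF ij, of D\<^sub>0] \<open>D (i, j) = D\<^sub>0 (i, j)\<close> by simp
  qed
  have other: "diagonal_sum N (pak_step i j D) p q = rect_sum N D\<^sub>0 p q"
    if pq: "(p, q) \<in> processed i j" "(p, q) \<noteq> (i, j)" "p = 0 \<or> q = 0 \<or> (p - 1, q - 1) \<notin> processed i j" for p q
  proof -
    have "p + j \<noteq> q + i" using pq by (auto simp: processed_def)
    then have "diagonal_sum N (pak_step i j D) p q = diagonal_sum N D p q"
      unfolding diagonal_sum_def by (intro sum.cong) (auto simp: pak_step_def)
    also have "\<dots> = rect_sum N D\<^sub>0 p q"
      using pq by (intro eq) (auto simp: processed_Suc[of i j])
    finally show ?thesis .
  qed
  have "pak_step i j D c = D\<^sub>0 c" if "c \<notin> processed i j" for c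
    using that m by (cases c) (auto simp: sums_match_def processed_def pak_step_def)
  moreover have "diagonal_sum N (pak_step i j D) p q = rect_sum N D\<^sub>0 p q"
    if "(p, q) \<in> processed i j" "p = 0 \<or> q = 0 \<or> (p - 1, q - 1) \<notin> processed i j" for p q
    using corner other[OF that(1) _ that(2)] by (cases "(p, q) = (i, j)") simp_all
  ultimately show ?thesis unfolding sums_match_def by blast
qed

lemma sums_match_row_end:
  assumes "supported N N D" "supported N N D\<^sub>0" "sums_match N D\<^sub>0 (processed (Suc i) 0) D"
  shows "sums_match N D\<^sub>0 (processed i N) D"
  unfolding sums_match_def
proof (intro conjI allI impI ballI, clarify)
  fix p q assume pq: "(p, q) \<in> processed i N" "p = 0 \<or> q = 0 \<or> (p - 1, q - 1) \<notin> processed i N"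
  show "diagonal_sum N D p q = rect_sum N D\<^sub>0 p q"
  proof (cases "(p, q) \<in> processed (Suc i) 0")
    case True
    moreover have "processed (Suc i) 0 \<subseteq> processed i N" by (auto simp: processed_def)
    ultimately show ?thesis using pq(2) assms(3) unfolding sums_match_def by blast
  next
    case False
    then have "N \<le> q" using pq(1) by (auto simp: processed_def)
    then show ?thesis using supportedD[OF assms(1)] by (simp add: diagonal_sum_def rect_sum_def)
  qed
next
  fix c assume "c \<notin> processed i N"
  then show "D c = D\<^sub>0 c" using assms(3) by (cases c) (auto simp: sums_match_def processed_def)
qed

text \<open>In the end every cell has been visited, and the diagonals begin on the two axes.\<close>

lemma pak_rect_sums:
  assumes D: "supported N N D" and pq: "p = 0 \<or> q = 0"
  shows "diagonal_sum N (pak_rect N N D) p q = rect_sum N D p q"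
proof -
  define P where "P i j E \<longleftrightarrow> supported N N E \<and> ordered_on (processed i j) E \<and> sums_match N D (processed i j) E"
    for i j E
  have row: "P i 0 (fold (pak_step i) (rev [0..<N]) E)" if "i < N" "P (Suc i) 0 E" for i E
  proof (rule fold_rev_upt_invariant[of N "P i"])
    show "P i N E" using that(2) sums_match_row_end[OF _ D] processed_row_end unfolding P_def by blast
    show "P i j (pak_step i j E)" if "j < N" "P i (Suc j) E" for j E
      using that \<open>i < N\<close> sums_match_pak_step pak_step_supported ordered_on_pak_step
      unfolding P_def Suc_eq_plus1 by blast
  qed
  have zero: "diagonal_sum N D p q = 0 \<and> rect_sum N D p q = 0" if "N \<le> p" for p q
    using supportedD[OF D] that by (simp add: diagonal_sum_def rect_sum_def)
  have "P N 0 D"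
    using D zero supportedD[OF D] by (auto simp: P_def sums_match_def ordered_on_def processed_def)
  then have "P 0 0 (pak_rect N N D)"
    unfolding pak_rect_def by (intro fold_rev_upt_invariant[of N "\<lambda>i. P i 0"] row)
  moreover have processed_0: "processed 0 0 = UNIV" by (auto simp: processed_def)
  ultimately have "sums_match N D UNIV (pak_rect N N D)"
    using processed_0 by (simp add: P_def)
  then show ?thesis using pq by (auto simp: sums_match_def)
qed

lemma sum_nested_triangle:
  fixes f :: "nat \<Rightarrow> nat"
  shows "(\<Sum>q\<in>{m..<N}. \<Sum>v\<in>{q..<N}. f v) = (\<Sum>v<N. (Suc v - m) * f v)"
proof -
  have "(\<Sum>q\<in>{m..<N}. \<Sum>v\<in>{q..<N}. f v) = (\<Sum>q\<in>{m..<N}. \<Sum>v<N. if q \<le> v then f v else 0)"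
    by (intro sum.cong sum.mono_neutral_cong_left) auto
  also have "\<dots> = (\<Sum>v<N. \<Sum>q\<in>{m..<N}. if q \<le> v then f v else 0)"
    by (rule sum.swap)
  also have "\<dots> = (\<Sum>v<N. (Suc v - m) * f v)"
  proof (rule sum.cong)
    fix v assume "v \<in> {..<N}"
    then have "(\<Sum>q\<in>{m..<N}. if q \<le> v then f v else 0) = (\<Sum>q\<in>{m..<Suc v}. f v)"
      by (intro sum.mono_neutral_cong_right) auto
    then show "(\<Sum>q\<in>{m..<N}. if q \<le> v then f v else 0) = (Suc v - m) * f v" by simp
  qed simp
  finally show ?thesis .
qed

text \<open>The cell \<open>(u, v)\<close> lies in the quadrants of \<open>(0, q)\<close> for the
  \<open>v + 1\<close> values \<open>q \<le> v\<close> and in those of \<open>(p, 0)\<close> for the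
  \<open>u\<close> values \<open>1 \<le> p \<le> u\<close>, which makes up its size
  \<open>u + v + 1\<close>.\<close>

lemma sum_rect_sums:
  "(\<Sum>q<N. rect_sum N D 0 q) + (\<Sum>p\<in>{1..<N}. rect_sum N D p 0) = (\<Sum>u<N. \<Sum>v<N. D (u, v) * (u + v + 1))"
proof -
  have "(\<Sum>q<N. rect_sum N D 0 q) = (\<Sum>u<N. \<Sum>q\<in>{0..<N}. \<Sum>v\<in>{q..<N}. D (u, v))"
    unfolding rect_sum_def by (subst sum.swap) (simp add: lessThan_atLeast0)
  also have "\<dots> = (\<Sum>u<N. \<Sum>v<N. (v + 1) * D (u, v))" by (simp add: sum_nested_triangle)
  finally have 1: "(\<Sum>q<N. rect_sum N D 0 q) = (\<Sum>u<N. \<Sum>v<N. (v + 1) * D (u, v))" .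
  have "(\<Sum>p\<in>{1..<N}. rect_sum N D p 0) = (\<Sum>u<N. u * (\<Sum>v<N. D (u, v)))"
    unfolding rect_sum_def by (simp add: sum_nested_triangle lessThan_atLeast0)
  then show ?thesis unfolding 1 by (simp add: sum_distrib_left sum.distrib[symmetric] algebra_simps)
qed

text \<open>Every cell lies on exactly one diagonal. Those from the row 0, the main diagonal
  included, sweep the cells with \<open>u \<le> v\<close>, and those from the column 0 the cells
  with \<open>v < u\<close>.\<close>

lemma sum_diagonal_sums:
  assumes "supported N N D"
  shows "(\<Sum>q<N. diagonal_sum N D 0 q) + (\<Sum>p\<in>{1..<N}. diagonal_sum N D p 0) = (\<Sum>u<N. \<Sum>v<N. D (u, v))"
proof -
  have shift: "(\<Sum>q\<in>{m..<N}. f (q + c)) = (\<Sum>v\<in>{c + m..<N}. f v)" if "\<And>v. N \<le> v \<Longrightarrow> f v = 0"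
    for f :: "nat \<Rightarrow> nat" and c m
  proof -
    have "(\<Sum>q\<in>{m..<N}. f (q + c)) = (\<Sum>v\<in>{m + c..<N + c}. f v)"
      by (rule sum.shift_bounds_nat_ivl[symmetric])
    also have "\<dots> = (\<Sum>v\<in>{c + m..<N}. f v)"
      using that by (intro sum.mono_neutral_right) (auto simp: not_less)
    finally show ?thesis .
  qed
  have z: "D (u, v) = 0" if "N \<le> u \<or> N \<le> v" for u v using supportedD[OF assms that] .
  have "(\<Sum>q<N. diagonal_sum N D 0 q) = (\<Sum>c\<le>N. \<Sum>q\<in>{0..<N}. D (c, q + c))"
    unfolding diagonal_sum_def by (subst sum.swap) (simp add: lessThan_atLeast0)
  also have "\<dots> = (\<Sum>c\<le>N. \<Sum>v\<in>{c..<N}. D (c, v))"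
    using shift[where m = 0 and f = "\<lambda>v. D (c, v)" and c = c for c] z by simp
  also have "\<dots> = (\<Sum>c<N. \<Sum>v\<in>{c..<N}. D (c, v))"
    using z by (intro sum.mono_neutral_right) auto
  finally have 1: "(\<Sum>q<N. diagonal_sum N D 0 q) = (\<Sum>c<N. \<Sum>v\<in>{c..<N}. D (c, v))" .
  have "(\<Sum>p\<in>{1..<N}. diagonal_sum N D p 0) = (\<Sum>c\<le>N. \<Sum>p\<in>{1..<N}. D (p + c, c))"
    unfolding diagonal_sum_def by (subst sum.swap) simp
  also have "\<dots> = (\<Sum>c\<le>N. \<Sum>u\<in>{Suc c..<N}. D (u, c))"
    using shift[where m = 1 and f = "\<lambda>u. D (u, c)" and c = c for c] z by simp
  also have "\<dots> = (\<Sum>c<N. \<Sum>u\<in>{Suc c..<N}. D (u, c))"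
    using z by (intro sum.mono_neutral_right) auto
  also have "\<dots> = (\<Sum>c<N. \<Sum>u<N. if c < u then D (u, c) else 0)"
    by (intro sum.cong sum.mono_neutral_cong_left) auto
  also have "\<dots> = (\<Sum>u<N. \<Sum>c<N. if c < u then D (u, c) else 0)" by (rule sum.swap)
  also have "\<dots> = (\<Sum>u<N. \<Sum>c<u. D (u, c))"
    by (intro sum.cong sum.mono_neutral_cong_right) auto
  finally have 2: "(\<Sum>p\<in>{1..<N}. diagonal_sum N D p 0) = (\<Sum>u<N. \<Sum>c<u. D (u, c))" .
  have "(\<Sum>c<u. D (u, c)) + (\<Sum>v\<in>{u..<N}. D (u, v)) = (\<Sum>v<N. D (u, v))" if "u < N" for u
    using sum.atLeastLessThan_concat[of 0 u N "\<lambda>v. D (u, v)"] that by (simp add: lessThan_atLeast0)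
  then show ?thesis unfolding 1 2 by (simp add: sum.distrib[symmetric] add.commute)
qed

section \<open>From squares to all diagrams and plane partitions\<close>

lemma supported_finite: "supported l w D \<Longrightarrow> finite {c. D c \<noteq> 0}"
  by (rule finite_subset[of _ "{..<l} \<times> {..<w}"]) (auto simp: supported_def)

lemma finite_supported:
  assumes "finite {c. D c \<noteq> 0}"
  obtains N where "supported N N D"
proof -
  obtain l w where "\<forall>c\<in>{c. D c \<noteq> 0}. fst c < l" "\<forall>c\<in>{c. D c \<noteq> 0}. snd c < w"
    using assms finite_nat_set_iff_bounded[of "fst ` {c. D c \<noteq> 0}"]
      finite_nat_set_iff_bounded[of "snd ` {c. D c \<noteq> 0}"] by auto
  then have "supported (max l w) (max l w) D"
    by (auto simp: supported_def less_max_iff_disj)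
  then show thesis by (rule that)
qed

lemma sum_support_eq:
  assumes "supported N N D"
  shows "(\<Sum>c | D c \<noteq> 0. f c) = (\<Sum>u<N. \<Sum>v<N. if D (u, v) = 0 then 0 else f (u, v))"
proof -
  have "(\<Sum>c | D c \<noteq> 0. f c) = (\<Sum>c\<in>{..<N} \<times> {..<N}. if D c = 0 then 0 else f c)"
    using assms by (intro sum.mono_neutral_cong_left) (auto simp: supported_def)
  also have "\<dots> = (\<Sum>u<N. \<Sum>v<N. if D (u, v) = 0 then 0 else f (u, v))"
    unfolding sum.cartesian_product by (intro sum.cong) auto
  finally show ?thesis .
qed

lemma diagram_size_supported:
  assumes "supported N N D"
  shows "diagram_size D = (\<Sum>u<N. \<Sum>v<N. D (u, v) * (u + v + 1))"
proof -
  have "diagram_size D = (\<Sum>c | D c \<noteq> 0. D c * (fst c + snd c + 1))"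
    unfolding diagram_size_def by (intro sum.cong) auto
  then show ?thesis unfolding sum_support_eq[OF assms] by (auto intro!: sum.cong)
qed

lemma pp_size_supported:
  assumes "supported N N D"
  shows "pp_size D = (\<Sum>u<N. \<Sum>v<N. D (u, v))"
  unfolding pp_size_def sum_support_eq[OF assms] by (auto intro!: sum.cong)

lemma pak_rect_size:
  assumes D: "supported N N D"
  shows "pp_size (pak_rect N N D) = diagram_size D"
proof -
  note P = pak_rect_supported[OF D]
  show ?thesis
    unfolding pp_size_supported[OF P] sum_diagonal_sums[OF P, symmetric] diagram_size_supported[OF D]
      sum_rect_sums[symmetric]
    using pak_rect_sums[OF D] by simp
qed

lemma supported_num:
  assumes "finite {c. D c \<noteq> 0}"
  shows "supported (num_rows D) (num_cols D) D"
proof -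
  obtain N where N: "supported N N D" using finite_supported[OF assms] .
  have "\<forall>i j. D (i, j) \<noteq> 0 \<longrightarrow> i < num_rows D"
    unfolding num_rows_def by (rule LeastI[of _ N]) (use N in \<open>auto simp: supported_def\<close>)
  moreover have "\<forall>i j. D (i, j) \<noteq> 0 \<longrightarrow> j < num_cols D"
    unfolding num_cols_def by (rule LeastI[of _ N]) (use N in \<open>auto simp: supported_def\<close>)
  ultimately show ?thesis by (auto simp: supported_def)
qed

lemma num_le:
  assumes "supported l w D"
  shows "num_rows D \<le> l" "num_cols D \<le> w"
  using assms by (auto simp: num_rows_def num_cols_def supported_def intro!: Least_le)

lemma pak_eq_pak_rect:
  assumes "supported N N D"
  shows "pak D = pak_rect N N D"
  unfolding pak_def
  using pak_rect_mono[OF supported_num[OF supported_finite[OF assms]] num_le[OF assms]] by simp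

lemma plane_partition_iff: "plane_partition a \<longleftrightarrow> finite {c. a c \<noteq> 0} \<and> ordered_on UNIV a"
  by (auto simp: plane_partition_def ordered_on_def)

text \<open>On each square \<open>pak\<close> is the bijection of \<open>pak_rect_bij_betw\<close>.
  Every finite support fits into a square, and for injectivity two diagrams are placed into a common
  one.\<close>

theorem pak_bij_betw: "bij_betw pak {D. finite {c. D c \<noteq> 0}} {a. plane_partition a}"
proof -
  have bij: "bij_betw pak {D. supported N N D} {D. supported N N D \<and> ordered_on UNIV D}" for N
  proof -
    have "bij_betw pak {D. supported N N D} B = bij_betw (pak_rect N N) {D. supported N N D} B" for B
      by (rule bij_betw_cong) (simp add: pak_eq_pak_rect)
    then show ?thesis using pak_rect_bij_betw[of N N] by simp
  qed
  have "inj_on pak {D. finite {c. D c \<noteq> 0}}"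
  proof (rule inj_onI)
    fix D E :: diagram
    assume "D \<in> {D. finite {c. D c \<noteq> 0}}" "E \<in> {D. finite {c. D c \<noteq> 0}}" and eq: "pak D = pak E"
    then have fin: "finite {c. D c \<noteq> 0}" "finite {c. E c \<noteq> 0}" by (simp_all only: mem_Collect_eq)
    obtain M where "supported M M D" using finite_supported[OF fin(1)] .
    moreover obtain N where "supported N N E" using finite_supported[OF fin(2)] .
    ultimately have "supported (max M N) (max M N) D" "supported (max M N) (max M N) E"
      by (auto elim!: supported_mono)
    then show "D = E" using bij[of "max M N"] eq unfolding bij_betw_def inj_on_def by blast
  qed
  moreover have "pak ` {D. finite {c. D c \<noteq> 0}} = {a. plane_partition a}"
  proof (intro equalityI subsetI)
    fix a assume "a \<in> pak ` {D. finite {c. D c \<noteq> 0}}"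
    then obtain D where a: "a = pak D" and fin: "finite {c. D c \<noteq> 0}" by blast
    obtain N where D: "supported N N D" using finite_supported[OF fin] .
    then have "a \<in> {D. supported N N D \<and> ordered_on UNIV D}"
      using bij[of N] unfolding bij_betw_def a by blast
    then show "a \<in> {a. plane_partition a}"
      using supported_finite[of N N a] by (simp only: plane_partition_iff mem_Collect_eq)
  next
    fix a assume "a \<in> {a. plane_partition a}"
    then have a: "finite {c. a c \<noteq> 0}" "ordered_on UNIV a" by (simp_all only: plane_partition_iff mem_Collect_eq)
    obtain N where "supported N N a" using finite_supported[OF a(1)] .
    then have "a \<in> pak ` {D. supported N N D}" using bij[of N] a unfolding bij_betw_def by blast
    then show "a \<in> pak ` {D. finite {c. D c \<noteq> 0}}" using supported_finite by blast
  qed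
  ultimately show ?thesis by (simp add: bij_betw_def)
qed

theorem pp_size_pak:
  assumes "finite {c. D c \<noteq> 0}"
  shows "pp_size (pak D) = diagram_size D"
proof -
  obtain N where "supported N N D" using finite_supported[OF assms] .
  then show ?thesis by (simp add: pak_eq_pak_rect pak_rect_size)
qed

section \<open>The program\<close>

lemma charge_return [simp]: "charge c (return_spmf (x, t)) = return_spmf (x, c + t)"
  by (simp add: charge_def)

lemma charge_charge [simp]: "charge c (charge d m) = charge (c + d) m"
  by (simp add: charge_def spmf.map_comp o_def split_def add.assoc)

lemma bind_prog_return [simp]: "bind_prog (return_spmf (x, t)) f = charge t (f x)"
  by (simp add: bind_prog_def)

text \<open>In the two outer loops of the transform \<open>P\<close> is containment in the
  rectangle, under which the loop bodies compute \<open>pak_step\<close> and its rows.\<close>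

lemma for_each_deterministic:
  assumes "\<And>i s. i \<in> set is \<Longrightarrow> P s \<Longrightarrow> P (f i s) \<and> (\<exists>t\<le>B. body i s = return_spmf (f i s, t))" and "P s"
  shows "\<exists>t\<le>arith_cost M + length is * (2 * arith_cost M + B). for_each M is body s = return_spmf (fold f is s, t)"
  using assms
proof (induction "is" arbitrary: s)
  case Nil
  then show ?case by (simp add: return_prog_def)
next
  case (Cons i "is")
  obtain t where t: "t \<le> B" "body i s = return_spmf (f i s, t)" and P: "P (f i s)"
    using Cons.prems(1)[of i s] Cons.prems(2) by auto
  obtain t' where t': "t' \<le> arith_cost M + length is * (2 * arith_cost M + B)"
    "for_each M is body (f i s) = return_spmf (fold f is (f i s), t')"
    using Cons.IH[OF _ P] Cons.prems(1) by auto
  show ?case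
    by (rule exI[of _ "2 * arith_cost M + (t + t')"]) (use t t' in \<open>simp\<close>)
qed

lemma fold_toggles:
  "fold (\<lambda>c D. D((i + c, j + c) := toggle D (i + c) (j + c))) [1..<m + 1] D =
   (\<lambda>(p, q). if i < p \<and> p \<le> i + m \<and> p + j = q + i then toggle D p q else D (p, q))"
proof (induction m)
  case (Suc m)
  let ?E = "\<lambda>(p, q). if i < p \<and> p \<le> i + m \<and> p + j = q + i then toggle D p q else D (p, q)"
  have upt: "[1..<Suc m + 1] = [1..<m + 1] @ [Suc m]" by simp
  have corner: "toggle ?E (i + Suc m) (j + Suc m) = toggle D (i + Suc m) (j + Suc m)"
    by (simp add: toggle_def)
  have eq: "fold (\<lambda>c D. D((i + c, j + c) := toggle D (i + c) (j + c))) [1..<Suc m + 1] D =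
      ?E((i + Suc m, j + Suc m) := toggle ?E (i + Suc m) (j + Suc m))"
    unfolding upt Suc.IH[symmetric] by simp
  show ?case unfolding eq corner
  proof (intro ext, clarify)
    fix p q
    show "(?E((i + Suc m, j + Suc m) := toggle D (i + Suc m) (j + Suc m))) (p, q) =
      (if i < p \<and> p \<le> i + Suc m \<and> p + j = q + i then toggle D p q else D (p, q))"
      by (cases "p = i + Suc m"; cases "q = j + Suc m") auto
  qed
qed auto

lemma pak_step_eq_fold:
  assumes "supported l w D" "i < l" "j < w"
  shows "fold (\<lambda>c D. D((i + c, j + c) := toggle D (i + c) (j + c))) [1..<min (l - 1 - i) (w - 1 - j) + 1]
    (D((i, j) := D (i, j) + max (D (i + 1, j)) (D (i, j + 1)))) = pak_step i j D"
proof -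
  let ?m = "min (l - 1 - i) (w - 1 - j)" and ?E = "D((i, j) := D (i, j) + max (D (i + 1, j)) (D (i, j + 1)))"
  have "(if i < p \<and> p \<le> i + ?m \<and> p + j = q + i then toggle ?E p q else ?E (p, q)) = pak_step i j D (p, q)" for p q
  proof (cases "i < p \<and> p + j = q + i")
    case True
    have "toggle ?E p q = toggle D p q" using True by (auto simp: toggle_def)
    moreover have "toggle D p q = 0" "D (p, q) = 0" if "\<not> p \<le> i + ?m"
    proof -
      have "l \<le> p \<or> w \<le> q" using that True by auto
      then show "toggle D p q = 0" "D (p, q) = 0"
        using toggle_eq_0[OF assms(1)] supportedD[OF assms(1)] by blast+
    qed
    ultimately show ?thesis using True by (auto simp: pak_step_def)
  qed (auto simp: pak_step_def)
  then show ?thesis unfolding fold_toggles by auto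
qed

text \<open>The ten accesses are 4 for the corner and 6 for a toggle. The \<open>9 + 10\<close>
  operations charged with them are raised to 30, which absorbs the overhead of the three nested
  loops.\<close>

definition pak_const :: "cost_model \<Rightarrow> nat" where
  "pak_const M = 10 * access_cost M + 30 * arith_cost M"


theorem pak_transform_eq:
  assumes D\<^sub>0: "finite {c. D\<^sub>0 c \<noteq> 0}" and d: "num_rows D\<^sub>0 \<le> d" "num_cols D\<^sub>0 \<le> d"
  shows "\<exists>t\<le>pak_const M * (d + 1) ^ 3. pak_transform M D\<^sub>0 = return_spmf (pak D\<^sub>0, t)"
proof -
  let ?l = "num_rows D\<^sub>0" and ?w = "num_cols D\<^sub>0" and ?a = "arith_cost M"
  let ?S = "supported ?l ?w"
  define K where "K = 10 * access_cost M + 22 * ?a"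
  define upd where "upd i j D = D((i, j) := D (i, j) + max (D (i + 1, j)) (D (i, j + 1)))" for i j and D :: diagram
  define inner where "inner i j D = for_each M [1..<min (?l - 1 - i) (?w - 1 - j) + 1] (\<lambda>c D.
             let p = i + c; q = j + c in
               charge (6 * access_cost M + 10 * arith_cost M)
                 (return_prog (D((p, q) :=
                    max (D (p + 1, q)) (D (p, q + 1)) + min (D (p - 1, q)) (D (p, q - 1))
                      - D (p, q))))) D" for i j and D :: diagram
  have inner: "\<exists>t\<le>?a + d * (2 * ?a + (6 * access_cost M + 10 * ?a)). inner i j (upd i j D) = return_spmf (pak_step i j D, t)"
    if "i < ?l" "j < ?w" "?S D" for i j D
  proof -
    let ?L = "[1..<min (?l - 1 - i) (?w - 1 - j) + 1]"
    have "\<exists>t\<le>?a + length ?L * (2 * ?a + (6 * access_cost M + 10 * ?a)).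
      inner i j (upd i j D) = return_spmf (fold (\<lambda>c D. D((i + c, j + c) := toggle D (i + c) (j + c))) ?L (upd i j D), t)"
      unfolding inner_def
      by (rule for_each_deterministic[where P = "\<lambda>_. True"]) (auto simp: toggle_def return_prog_def Let_def)
    moreover have "length ?L * (2 * ?a + (6 * access_cost M + 10 * ?a)) \<le> d * (2 * ?a + (6 * access_cost M + 10 * ?a))"
      using d by (intro mult_right_mono) auto
    moreover have "fold (\<lambda>c D. D((i + c, j + c) := toggle D (i + c) (j + c))) ?L (upd i j D) = pak_step i j D"
      using pak_step_eq_fold[OF that(3,1,2)] unfolding upd_def .
    ultimately show ?thesis by (smt (verit) add_left_mono order_trans)
  qed
  define cell where "cell i j D = bind_prog (charge (4 * access_cost M + 9 * ?a) (return_prog (upd i j D)))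
    (\<lambda>D'. inner i j D')" for i j D
  have cell: "?S (pak_step i j D) \<and> (\<exists>t\<le>K * (d + 1). cell i j D = return_spmf (pak_step i j D, t))"
    if "i < ?l" "j < ?w" "?S D" for i j D
  proof -
    note ijD = that
    obtain t where t: "t \<le> ?a + d * (2 * ?a + (6 * access_cost M + 10 * ?a))"
      "inner i j (upd i j D) = return_spmf (pak_step i j D, t)" using inner[OF ijD] by blast
    have "cell i j D = return_spmf (pak_step i j D, 4 * access_cost M + 9 * ?a + t)"
      unfolding cell_def by (simp add: return_prog_def t(2))
    moreover have "4 * access_cost M + 9 * ?a + t \<le> K * (d + 1)"
      using t(1) by (simp add: K_def algebra_simps)
    ultimately show ?thesis using pak_step_supported[OF ijD(3,1,2)] by blast
  qed
  define row where "row i = for_each M (rev [0..<?w]) (cell i)" for i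
  have row: "?S (fold (pak_step i) (rev [0..<?w]) D) \<and>
    (\<exists>t\<le>(K + 2 * ?a) * (d + 1) ^ 2. row i D = return_spmf (fold (pak_step i) (rev [0..<?w]) D, t))"
    if "i < ?l" "?S D" for i D
  proof -
    have "\<exists>t\<le>?a + length (rev [0..<?w]) * (2 * ?a + K * (d + 1)). row i D = return_spmf (fold (pak_step i) (rev [0..<?w]) D, t)"
      unfolding row_def
      by (rule for_each_deterministic[where P = ?S]) (use cell that in auto)
    moreover have "?a + length (rev [0..<?w]) * (2 * ?a + K * (d + 1)) \<le> ?a + d * (2 * ?a + K * (d + 1))"
      using d by (intro add_left_mono mult_right_mono) auto
    moreover have "?a + d * (2 * ?a + K * (d + 1)) \<le> (K + 2 * ?a) * (d + 1) ^ 2"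
      by (simp add: algebra_simps power2_eq_square)
    ultimately show ?thesis using pak_row_supported[OF that(2,1)] by (meson order_trans)
  qed
  let ?T = "?a + length (rev [0..<?l]) * (2 * ?a + (K + 2 * ?a) * (d + 1) ^ 2)"
  have "\<exists>t\<le>?T. for_each M (rev [0..<?l]) row D\<^sub>0 =
      return_spmf (fold (\<lambda>i. fold (pak_step i) (rev [0..<?w])) (rev [0..<?l]) D\<^sub>0, t)"
    by (rule for_each_deterministic[where P = ?S]) (use row supported_num[OF D\<^sub>0] in auto)
  then obtain t where t: "t \<le> ?T" and eq: "for_each M (rev [0..<?l]) row D\<^sub>0 = return_spmf (pak D\<^sub>0, t)"
    unfolding pak_def pak_rect_def by blast
  have "pak_transform M D\<^sub>0 = for_each M (rev [0..<?l]) row D\<^sub>0"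
    unfolding pak_transform_def row_def cell_def inner_def upd_def Let_def by simp
  moreover have "?T \<le> ?a + d * (2 * ?a + (K + 2 * ?a) * (d + 1) ^ 2)"
    using d by (intro add_left_mono mult_right_mono) auto
  then have "t \<le> ?a + d * (2 * ?a + (K + 2 * ?a) * (d + 1) ^ 2)" using t by (rule order_trans[rotated])
  moreover have "?a + d * (2 * ?a + (K + 2 * ?a) * (d + 1) ^ 2) \<le> pak_const M * (d + 1) ^ 3"
    by (simp add: K_def pak_const_def algebra_simps power2_eq_square power3_eq_cube)
  ultimately show ?thesis using eq by (intro exI[of _ t]) auto
qed

section \<open>The samplers\<close>

text \<open>Raising \<open>c\<close> by one is a bijection from all diagrams onto those with
  \<open>c\<close> occupied, and it multiplies the probability by
  \<open>x ^ cell_size c\<close>.\<close>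

lemma emeasure_entry_nonzero_le:
  assumes x: "0 < x" "x < 1"
  shows "measure_pmf.prob (Gamma_pmf x) {D. finite {c. D c \<noteq> 0} \<and> D c \<noteq> 0} \<le> x ^ cell_size c"
proof -
  let ?F = "{D :: diagram. finite {c. D c \<noteq> 0}}" and ?A = "{D :: diagram. finite {c. D c \<noteq> 0} \<and> D c \<noteq> 0}"
  have bij: "bij_betw (raise_entry c 1) ?F ?A"
  proof (rule bij_betw_byWitness[where f' = "\<lambda>D. D(c := D c - 1)"])
    show "\<forall>D\<in>?F. (raise_entry c 1 D)(c := raise_entry c 1 D c - 1) = D" by (simp add: raise_entry_def)
    show "\<forall>D\<in>?A. raise_entry c 1 (D(c := D c - 1)) = D" by (auto simp: raise_entry_def)
    show "raise_entry c 1 ` ?F \<subseteq> ?A" using finite_support_raise_entry by (fastforce simp: raise_entry_def)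
    show "(\<lambda>D. D(c := D c - 1)) ` ?A \<subseteq> ?F"
    proof (rule image_subsetI)
      fix D assume "D \<in> ?A"
      then have fin: "finite {c'. D c' \<noteq> 0}" by blast
      have "{c'. (D(c := D c - 1)) c' \<noteq> 0} \<subseteq> {c'. D c' \<noteq> 0}" by auto
      then show "D(c := D c - 1) \<in> ?F" using fin by (simp add: finite_subset)
    qed
  qed
  have "emeasure (Gamma_pmf x) ?A = (\<integral>\<^sup>+ D. ennreal (pmf (Gamma_pmf x) D) \<partial>count_space ?A)"
    by (rule nn_integral_pmf[symmetric])
  also have "\<dots> = (\<integral>\<^sup>+ D. ennreal (pmf (Gamma_pmf x) (raise_entry c 1 D)) \<partial>count_space ?F)"
    by (rule nn_integral_bij_count_space[OF bij, symmetric])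
  also have "\<dots> = (\<integral>\<^sup>+ D. ennreal (x ^ cell_size c) * ennreal (pmf (Gamma_pmf x) D) \<partial>count_space ?F)"
  proof (rule nn_integral_cong)
    fix D assume "D \<in> space (count_space ?F)"
    then have fin: "finite {c. D c \<noteq> 0}" by simp
    have "pmf (Gamma_pmf x) (raise_entry c 1 D) = x ^ cell_size c * pmf (Gamma_pmf x) D"
      unfolding pmf_Gamma[OF x fin] pmf_Gamma[OF x finite_support_raise_entry[OF fin]] diagram_size_raise_entry[OF fin]
      by (simp add: power_add)
    then show "ennreal (pmf (Gamma_pmf x) (raise_entry c 1 D)) = ennreal (x ^ cell_size c) * ennreal (pmf (Gamma_pmf x) D)"
      using x by (simp add: ennreal_mult)
  qed
  also have "\<dots> = ennreal (x ^ cell_size c) * emeasure (Gamma_pmf x) ?F"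
    by (simp add: nn_integral_cmult nn_integral_pmf)
  also have "\<dots> \<le> ennreal (x ^ cell_size c) * 1"
    by (intro mult_left_mono measure_pmf.emeasure_le_1) simp
  finally show ?thesis using x by (simp add: measure_pmf.emeasure_eq_measure)
qed

text \<open>A sum over an infinite set is 0 by convention, so arrays of infinite support have
  \<open>diagram_size\<close> 0; a positive size rules them out. This is why 0 is kept out of the
  sets \<open>W\<close> of accepted sizes.\<close>

lemma diagram_size_pos_finite: "0 < diagram_size D \<Longrightarrow> finite {c. D c \<noteq> 0}"
proof (rule ccontr)
  assume "0 < diagram_size D" and inf: "\<not> finite {c. D c \<noteq> 0}"
  have "{(i, j). D (i, j) \<noteq> 0} = {c. D c \<noteq> 0}" by auto
  then have "diagram_size D = 0" unfolding diagram_size_def using inf by simp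
  then show False using \<open>0 < diagram_size D\<close> by simp
qed

lemma supported_diagram_size:
  assumes "finite {c. D c \<noteq> 0}"
  shows "supported (diagram_size D) (diagram_size D) D"
  unfolding supported_def
proof (intro allI impI)
  fix p q assume "D (p, q) \<noteq> 0"
  then have "1 * cell_size (p, q) \<le> D (p, q) * cell_size (p, q)" by (intro mult_le_mono1) simp
  also have "\<dots> \<le> diagram_size D" by (rule entry_le_diagram_size[OF assms])
  finally show "p < diagram_size D \<and> q < diagram_size D" by (simp add: cell_size_def)
qed

lemma pak_image_diagrams: "pak ` diagrams n = {a. plane_partition a \<and> pp_size a = n}"
proof -
  have im: "pak ` {D. finite {c. D c \<noteq> 0}} = {a. plane_partition a}"
    by (rule bij_betw_imp_surj_on[OF pak_bij_betw])
  have Int: "f ` (A \<inter> f -` B) = f ` A \<inter> B" for f :: "diagram \<Rightarrow> diagram" and A B by blast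
  have "diagrams n = {D. finite {c. D c \<noteq> 0}} \<inter> pak -` {a. pp_size a = n}"
  proof (rule set_eqI)
    fix D
    show "D \<in> diagrams n \<longleftrightarrow> D \<in> {D. finite {c. D c \<noteq> 0}} \<inter> pak -` {a. pp_size a = n}"
      by (cases "finite {c. D c \<noteq> 0}") (simp_all add: diagrams_def pp_size_pak)
  qed
  then have "pak ` diagrams n = pak ` {D. finite {c. D c \<noteq> 0}} \<inter> {a. pp_size a = n}"
    by (simp only: Int)
  then show ?thesis unfolding im by (simp only: Collect_conj_eq)
qed

lemma inj_on_pak: "A \<subseteq> {D. finite {c. D c \<noteq> 0}} \<Longrightarrow> inj_on pak A"
  using bij_betw_imp_inj_on[OF pak_bij_betw] by (rule inj_on_subset)

text \<open>Both procedures in one: \<open>W\<close> will be \<open>{n}\<close> or the window of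
  admissible sizes.\<close>

definition sample_sizes :: "cost_model \<Rightarrow> real \<Rightarrow> nat set \<Rightarrow> diagram prog" where
  "sample_sizes M x W = bind_prog (repeat_until M (Gamma_M M x) (\<lambda>D. diagram_size D \<in> W)) (pak_transform M)"

context
  fixes x :: real and W :: "nat set" and M :: cost_model
  assumes x: "0 < x" "x < 1" and W: "finite W" "0 \<notin> W" "W \<noteq> {}"
begin

definition success :: real where "success = (\<Sum>n\<in>W. size_prob x n)"

definition accepted :: "diagram spmf" where
  "accepted = output_law (repeat_until M (Gamma_M M x) (\<lambda>D. diagram_size D \<in> W))"

lemma prob_success: "measure (measure_spmf (output_law (Gamma_M M x))) {D. diagram_size D \<in> W} = success"
proof -
  have "measure (measure_spmf (output_law (Gamma_M M x))) {D. diagram_size D \<in> W} =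
      measure (map_pmf diagram_size (Gamma_pmf x)) W"
    by (simp add: output_law_Gamma_M[OF x] measure_spmf_spmf_of_pmf vimage_def)
  also have "\<dots> = success"
    unfolding measure_measure_pmf_finite[OF W(1)] success_def by (simp add: pmf_size_Gamma[OF x] size_prob_def[OF x])
  finally show ?thesis .
qed

lemma size_prob_pos: "0 < size_prob x n"
  unfolding size_prob_def[OF x] using x num_diagrams_pos[of n] by simp

lemma success_pos: "0 < success"
  unfolding success_def using W by (intro sum_pos size_prob_pos)

lemma lossless_Gamma_M: "lossless_spmf (output_law (Gamma_M M x))"
  by (simp add: output_law_Gamma_M[OF x])

lemma finite_accepted_size: "diagram_size D \<in> W \<Longrightarrow> finite {c. D c \<noteq> 0}"
  using W(2) by (intro diagram_size_pos_finite) (metis gr0I)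

lemma lossless_accepted: "lossless_spmf accepted"
  unfolding accepted_def by (rule spmf_repeat_until(2)[OF lossless_Gamma_M]) (simp only: prob_success success_pos)

lemma spmf_accepted:
  "spmf accepted D = (if diagram_size D \<in> W then x ^ diagram_size D * exp (- suminf (rate x)) / success else 0)"
proof -
  have "spmf accepted D = (if diagram_size D \<in> W then spmf (output_law (Gamma_M M x)) D else 0) / success"
    unfolding accepted_def prob_success[symmetric]
    by (rule spmf_repeat_until(1)[OF lossless_Gamma_M]) (simp only: prob_success success_pos)
  then show ?thesis
    using pmf_Gamma[OF x finite_accepted_size, of D] by (simp add: output_law_Gamma_M[OF x])
qed

lemma set_accepted: "set_spmf accepted = {D. diagram_size D \<in> W}"
  using x success_pos by (auto simp: in_set_spmf_iff_spmf spmf_accepted split: if_splits)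

lemma output_law_sample_sizes: "output_law (sample_sizes M x W) = map_spmf pak accepted"
proof -
  have "output_law (sample_sizes M x W) = bind_spmf accepted (\<lambda>D. output_law (pak_transform M D))"
    by (simp add: sample_sizes_def accepted_def)
  also have "\<dots> = bind_spmf accepted (\<lambda>D. return_spmf (pak D))"
  proof (rule bind_spmf_cong[OF refl])
    fix D assume "D \<in> set_spmf accepted"
    then have "finite {c. D c \<noteq> 0}" unfolding set_accepted by (intro finite_accepted_size) simp
    then obtain t where "pak_transform M D = return_spmf (pak D, t)"
      using pak_transform_eq[OF _ max.cobounded1 max.cobounded2] by blast
    then show "output_law (pak_transform M D) = return_spmf (pak D)" by (simp add: output_law_def)
  qed
  finally show ?thesis by (simp add: map_spmf_conv_bind_spmf)
qed

lemma lossless_sample_sizes: "lossless_spmf (output_law (sample_sizes M x W))"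
  unfolding output_law_sample_sizes by (simp add: lossless_accepted)

lemma set_sample_sizes: "set_spmf (output_law (sample_sizes M x W)) = {a. plane_partition a \<and> pp_size a \<in> W}"
proof -
  have "{D. diagram_size D \<in> W} = (\<Union>n\<in>W. diagrams n)"
    using finite_accepted_size by (auto simp: diagrams_def)
  then show ?thesis
    unfolding output_law_sample_sizes set_map_spmf set_accepted by (simp only: image_UN pak_image_diagrams) auto
qed

lemma spmf_sample_sizes_eq:
  assumes ab: "plane_partition a" "plane_partition b" "pp_size a = pp_size b"
  shows "spmf (output_law (sample_sizes M x W)) a = spmf (output_law (sample_sizes M x W)) b"
proof (cases "pp_size a \<in> W")
  case True
  have inj: "inj_on pak (set_spmf accepted)"
    unfolding set_accepted using finite_accepted_size by (intro inj_on_pak) auto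
  have val: "spmf (output_law (sample_sizes M x W)) c = x ^ n * exp (- suminf (rate x)) / success"
    if c: "plane_partition c" "pp_size c = n" "n \<in> W" for c n
  proof -
    obtain D where D: "D \<in> diagrams n" "c = pak D" using c(1,2) pak_image_diagrams[of n] by blast
    then have size: "diagram_size D = n" by (simp add: diagrams_def)
    then have "D \<in> set_spmf accepted" using c(3) by (simp add: set_accepted)
    then show ?thesis
      unfolding output_law_sample_sizes D(2) spmf_map_inj[OF inj \<open>D \<in> set_spmf accepted\<close>] spmf_accepted
      using size c(3) by simp
  qed
  show ?thesis using val[OF ab(1) refl True] val[OF ab(2) ab(3)[symmetric] True] by simp
next
  case False
  then have "a \<notin> set_spmf (output_law (sample_sizes M x W))" "b \<notin> set_spmf (output_law (sample_sizes M x W))"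
    unfolding set_sample_sizes using ab(3) by auto
  then show ?thesis by (simp add: in_set_spmf_iff_spmf)
qed

lemma output_law_sample_sizes_single:
  assumes "W = {n}"
  shows "output_law (sample_sizes M x W) = spmf_of_set {a. plane_partition a \<and> pp_size a = n}"
proof -
  have n: "0 < n" using W(2) assms by auto
  have "(\<Sum>n\<in>W. size_prob x n) = real (card (diagrams n)) * x ^ n * exp (- suminf (rate x))"
    unfolding assms by (simp add: size_prob_def[OF x] num_diagrams_def)
  then have succ: "success = real (card (diagrams n)) * x ^ n * exp (- suminf (rate x))"
    unfolding success_def .
  have mem: "diagram_size D \<in> W \<longleftrightarrow> D \<in> diagrams n" for D
    using diagram_size_pos_finite[of D] n assms by (auto simp: diagrams_def)
  have "accepted = spmf_of_set (diagrams n)"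
  proof (rule spmf_eqI)
    fix D
    have "diagram_size D = n" if "D \<in> diagrams n" using that by (simp add: diagrams_def)
    then show "spmf accepted D = spmf (spmf_of_set (diagrams n)) D"
      using x unfolding spmf_accepted mem spmf_of_set succ by (simp add: indicator_def)
  qed
  moreover have "inj_on pak (diagrams n)" by (rule inj_on_pak) (auto simp: diagrams_def)
  ultimately show ?thesis
    unfolding output_law_sample_sizes by (simp add: map_spmf_of_set_inj_on pak_image_diagrams)
qed

definition large_support :: "nat \<Rightarrow> diagram set" where
  "large_support B = {D. diagram_size D \<in> W \<and> (\<exists>u v. D (u, v) \<noteq> 0 \<and> (B \<le> u \<or> B \<le> v))}"

text \<open>Union bound over the cells of \<open>{..<N} \<times> {..<N}\<close> outside the square
  of side \<open>B\<close>, each occupied with probability at most \<open>x ^ B\<close>;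
  conditioning on acceptance costs at most the factor \<open>1 / success\<close>.\<close>

lemma emeasure_large_support_le:
  assumes N: "\<And>n. n \<in> W \<Longrightarrow> n \<le> N"
  shows "emeasure (measure_spmf accepted) (large_support B) \<le> ennreal ((real N)\<^sup>2 * x ^ B / success)"
proof -
  let ?B = "large_support B"
  let ?C = "{c \<in> {..<N} \<times> {..<N}. B \<le> fst c \<or> B \<le> snd c}"
  let ?A = "\<lambda>c. {D :: diagram. finite {c. D c \<noteq> 0} \<and> D c \<noteq> 0}"
  have sub: "?B \<subseteq> (\<Union>c\<in>?C. ?A c)"
  proof
    fix D assume "D \<in> ?B"
    then obtain u v where D: "diagram_size D \<in> W" "D (u, v) \<noteq> 0" "B \<le> u \<or> B \<le> v" unfolding large_support_def by blast
    note fin = finite_accepted_size[OF D(1)]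
    have "supported N N D" using supported_mono[OF supported_diagram_size[OF fin] N[OF D(1)] N[OF D(1)]] .
    then have "(u, v) \<in> ?C" using D(2,3) by (auto simp: supported_def)
    then show "D \<in> (\<Union>c\<in>?C. ?A c)" using D(2) fin by blast
  qed
  have "measure_pmf.prob (Gamma_pmf x) ?B \<le> measure_pmf.prob (Gamma_pmf x) (\<Union>c\<in>?C. ?A c)"
    by (intro measure_pmf.finite_measure_mono sub) simp
  also have "\<dots> \<le> (\<Sum>c\<in>?C. measure_pmf.prob (Gamma_pmf x) (?A c))"
    by (intro measure_pmf.finite_measure_subadditive_finite) auto
  also have "\<dots> \<le> (\<Sum>c\<in>?C. x ^ B)"
  proof (rule sum_mono)
    fix c assume c: "c \<in> ?C"
    have "measure_pmf.prob (Gamma_pmf x) (?A c) \<le> x ^ cell_size c" by (rule emeasure_entry_nonzero_le[OF x])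
    also have "\<dots> \<le> x ^ B" using x c by (intro power_decreasing) (auto simp: cell_size_def)
    finally show "measure_pmf.prob (Gamma_pmf x) (?A c) \<le> x ^ B" .
  qed
  also have "\<dots> \<le> (real N)\<^sup>2 * x ^ B"
  proof -
    have "card ?C \<le> card ({..<N} \<times> {..<N})" by (intro card_mono) auto
    then have "card ?C \<le> N * N" by (simp only: card_cartesian_product card_lessThan)
    then have "real (card ?C) \<le> (real N)\<^sup>2" unfolding power2_eq_square of_nat_mult[symmetric] by (simp only: of_nat_le_iff)
    then show ?thesis using x by (simp add: mult_right_mono)
  qed
  finally have prob: "measure_pmf.prob (Gamma_pmf x) ?B \<le> (real N)\<^sup>2 * x ^ B" .
  have "emeasure (measure_spmf accepted) ?B = (\<integral>\<^sup>+ D. ennreal (spmf accepted D) \<partial>count_space ?B)"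
    by (rule nn_integral_spmf[symmetric])
  also have "\<dots> \<le> (\<integral>\<^sup>+ D. ennreal (1 / success) * ennreal (pmf (Gamma_pmf x) D) \<partial>count_space ?B)"
  proof (rule nn_integral_mono)
    fix D
    have "spmf accepted D \<le> 1 / success * pmf (Gamma_pmf x) D"
      using success_pos pmf_Gamma[OF x finite_accepted_size, of D] by (simp add: spmf_accepted)
    then show "ennreal (spmf accepted D) \<le> ennreal (1 / success) * ennreal (pmf (Gamma_pmf x) D)"
      using success_pos by (simp only: ennreal_mult''[symmetric] pmf_nonneg ennreal_leI)
  qed
  also have "\<dots> = ennreal (1 / success) * emeasure (Gamma_pmf x) ?B"
    by (simp add: nn_integral_cmult nn_integral_pmf)
  also have "\<dots> = ennreal (1 / success * measure_pmf.prob (Gamma_pmf x) ?B)"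
    unfolding measure_pmf.emeasure_eq_measure using success_pos by (intro ennreal_mult[symmetric]) simp_all
  also have "\<dots> \<le> ennreal ((real N)\<^sup>2 * x ^ B / success)"
    using success_pos prob by (intro ennreal_leI) (simp add: divide_right_mono)
  finally show ?thesis .
qed

text \<open>The three terms are the repeated runs, the transform in a square of side
  \<open>B\<close>, and the transform in the trivial square of side \<open>N\<close>, weighted by
  the bound for \<open>large_support B\<close>.\<close>

lemma expected_time_sample_sizes_le:
  assumes N: "\<And>n. n \<in> W \<Longrightarrow> n \<le> N"
  shows "expected_time (sample_sizes M x W) \<le> ennreal (
    (32 * total_cost M * (1 + (\<Sum>k. pair_gf (x ^ k))) + 2 * total_cost M) / success +
    real (pak_const M) * (real B + 1) ^ 3 +
    real (pak_const M) * (real N + 1) ^ 3 * ((real N)\<^sup>2 * x ^ B / success))"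
proof -
  let ?S = "\<Sum>k. pair_gf (x ^ k)" and ?K = "real (pak_const M)" and ?w = "total_cost M"
  have S: "0 \<le> ?S" by (intro suminf_nonneg summable_pair_gf[OF x] pair_gf_power_nonneg[OF x])
  let ?T = "32 * ?w * (1 + ?S) + 2 * ?w"
  have T: "0 \<le> ?T" using S by simp
  have time: "expected_time (Gamma_M M x) + of_nat (2 * arith_cost M) \<le> ennreal ?T"
  proof -
    have "expected_time (Gamma_M M x) + of_nat (2 * arith_cost M) \<le> ennreal (32 * ?w * (1 + ?S)) + ennreal (2 * ?w)"
      by (intro add_mono expected_time_Gamma_M_le[OF x])
        (simp only: ennreal_of_nat_eq_real_of_nat, intro ennreal_leI, simp add: total_cost_def)
    also have "\<dots> = ennreal ?T" using S by (subst ennreal_plus) auto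
    finally show ?thesis .
  qed
  have R: "expected_time (repeat_until M (Gamma_M M x) (\<lambda>D. diagram_size D \<in> W)) \<le> ennreal (?T / success)"
    unfolding prob_success[symmetric]
    by (rule expected_time_repeat_until_le[OF lossless_Gamma_M _ time T]) (simp only: prob_success success_pos)
  define Bad where "Bad = large_support B"
  have bad: "emeasure (measure_spmf accepted) Bad \<le> ennreal ((real N)\<^sup>2 * x ^ B / success)"
    unfolding Bad_def by (rule emeasure_large_support_le[OF N])
  have pak_time: "expected_time (pak_transform M D) \<le>
      ennreal (?K * (real B + 1) ^ 3) + ennreal (?K * (real N + 1) ^ 3) * indicator Bad D"
    if D: "D \<in> set_spmf accepted" for D
  proof -
    have DW: "diagram_size D \<in> W" using D by (simp add: set_accepted)
    note fin = finite_accepted_size[OF DW]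
    have le: "expected_time (pak_transform M D) \<le> ennreal (?K * (real d + 1) ^ 3)" if "supported d d D" for d
    proof -
      obtain t where t: "t \<le> pak_const M * (d + 1) ^ 3" "pak_transform M D = return_spmf (pak D, t)"
        using pak_transform_eq[OF fin num_le[OF \<open>supported d d D\<close>]] by blast
      have "real t \<le> real (pak_const M * (d + 1) ^ 3)" using t(1) by (simp only: of_nat_le_iff)
      also have "\<dots> = ?K * (real d + 1) ^ 3" by (simp add: add.commute)
      finally show ?thesis unfolding t(2) by (simp add: ennreal_of_nat_eq_real_of_nat ennreal_leI)
    qed
    show ?thesis
    proof (cases "D \<in> Bad")
      case True
      have "supported N N D"
        using supported_mono[OF supported_diagram_size[OF fin] N[OF DW] N[OF DW]] .
      from le[OF this] show ?thesis using True by (simp add: add_increasing)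
    next
      case False
      then have "supported B B D"
        using DW unfolding Bad_def large_support_def supported_def mem_Collect_eq by (meson not_le)
      from le[OF this] show ?thesis using False by simp
    qed
  qed
  have "expected_time (sample_sizes M x W) \<le> ennreal (?T / success) +
      (\<integral>\<^sup>+ D. ennreal (?K * (real B + 1) ^ 3) + ennreal (?K * (real N + 1) ^ 3) * indicator Bad D \<partial>measure_spmf accepted)"
    unfolding sample_sizes_def expected_time_bind accepted_def[symmetric]
    by (intro add_mono R nn_integral_mono_AE) (simp only: AE_measure_spmf_iff pak_time ball_simps, simp add: pak_time)
  also have "\<dots> = ennreal (?T / success) +
      ((\<integral>\<^sup>+ D. ennreal (?K * (real B + 1) ^ 3) \<partial>measure_spmf accepted) +
       ennreal (?K * (real N + 1) ^ 3) * emeasure (measure_spmf accepted) Bad)"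
    by (subst nn_integral_add) (auto simp: nn_integral_cmult_indicator)
  also have "\<dots> \<le> ennreal (?T / success) + (ennreal (?K * (real B + 1) ^ 3) +
       ennreal (?K * (real N + 1) ^ 3) * ennreal ((real N)\<^sup>2 * x ^ B / success))"
    by (intro add_left_mono add_mono nn_integral_measure_spmf_const_le mult_left_mono bad) simp
  also have "\<dots> = ennreal (?T / success + ?K * (real B + 1) ^ 3 + ?K * (real N + 1) ^ 3 * ((real N)\<^sup>2 * x ^ B / success))"
    using T success_pos x by (simp add: ennreal_mult[symmetric] ennreal_plus[symmetric] add.assoc del: ennreal_plus)
  finally show ?thesis .
qed

end

section \<open>Asymptotics\<close>

text \<open>The upper bound is \<open>1 + 1 / 8\<close> plus a telescoping bound
  \<open>1 / 8\<close> for the remaining terms. From \<open>2 * riemann_zeta 3 < 3\<close> it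
  follows that \<open>xi n\<close> lies in (0,1) for all \<open>n \<ge> 3\<close>, and from
  \<open>2 * (5 / 4) / 20 = (1 / 2) ^ 3\<close> that \<open>tilt n \<le> 1 / 2\<close> for
  \<open>n \<ge> 20\<close>.\<close>

lemma riemann_zeta_3_bounds: "1 \<le> riemann_zeta 3" "riemann_zeta 3 \<le> 5 / 4"
proof -
  let ?f = "\<lambda>k. 1 / real (Suc k) ^ 3"
  have "(\<Sum>k<1. ?f k) \<le> (\<Sum>k. ?f k)"
    by (rule sum_le_suminf[OF summable_inverse_powers(2)]) auto
  then show "1 \<le> riemann_zeta 3" unfolding riemann_zeta_3 by simp
  have partial: "(\<Sum>k<Suc (Suc m). ?f k) \<le> 5 / 4 - 1 / (2 * (real m + 2)\<^sup>2)" for m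
  proof (induction m)
    case 0
    show ?case by (simp add: eval_nat_numeral)
  next
    case (Suc m)
    have step: "1 / (a + 1) ^ 3 \<le> 1 / (2 * a\<^sup>2) - 1 / (2 * (a + 1)\<^sup>2)" if "0 < a" for a :: real
    proof -
      have diff: "1 / (2 * a\<^sup>2) - 1 / (2 * (a + 1)\<^sup>2) = (2 * a + 1) / (2 * a\<^sup>2 * (a + 1)\<^sup>2)"
        using that by (simp add: divide_simps) (simp add: algebra_simps power2_eq_square)
      have "1 / (a + 1) ^ 3 = (2 * a\<^sup>2 / (a + 1)) / (2 * a\<^sup>2 * (a + 1)\<^sup>2)"
        using that by (simp add: power2_eq_square power3_eq_cube)
      also have "\<dots> \<le> (2 * a + 1) / (2 * a\<^sup>2 * (a + 1)\<^sup>2)"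
      proof (rule divide_right_mono)
        show "2 * a\<^sup>2 / (a + 1) \<le> 2 * a + 1"
          using that by (simp add: divide_le_eq) (simp add: algebra_simps power2_eq_square)
      qed simp
      finally show ?thesis unfolding diff .
    qed
    have "?f (Suc (Suc m)) = 1 / (real m + 2 + 1) ^ 3" by (simp add: add.commute)
    moreover have "1 / (real m + 2 + 1) ^ 3 \<le> 1 / (2 * (real m + 2)\<^sup>2) - 1 / (2 * (real m + 2 + 1)\<^sup>2)"
      by (rule step) simp
    moreover have "real (Suc m) + 2 = real m + 2 + 1" by simp
    ultimately show ?case
      using Suc.IH unfolding sum.lessThan_Suc[of _ "Suc (Suc m)"] by (simp only:)
  qed
  have "(\<Sum>k<n. ?f k) \<le> 5 / 4" for n
  proof -
    have "(\<Sum>k<n. ?f k) \<le> (\<Sum>k<Suc (Suc n). ?f k)" by (intro sum_mono2) auto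
    also have "\<dots> \<le> 5 / 4 - 1 / (2 * (real n + 2)\<^sup>2)" by (rule partial)
    also have "\<dots> \<le> 5 / 4" by simp
    finally show ?thesis .
  qed
  then show "riemann_zeta 3 \<le> 5 / 4"
    unfolding riemann_zeta_3 by (intro suminf_le_const summable_inverse_powers)
qed

definition tilt :: "nat \<Rightarrow> real" where
  "tilt n = (2 * riemann_zeta 3 / real n) powr (1 / 3)"

lemma xi_eq: "xi n = 1 - tilt n"
  by (simp add: xi_def tilt_def)

lemma tilt_cube: "3 \<le> n \<Longrightarrow> tilt n ^ 3 = 2 * riemann_zeta 3 / real n"
  unfolding tilt_def using riemann_zeta_3_bounds(1) by (subst powr_realpow[symmetric]) (auto simp: powr_powr)

lemma tilt_bounds:
  assumes "3 \<le> n"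
  shows "0 < tilt n" "tilt n < 1" "20 \<le> n \<Longrightarrow> tilt n \<le> 1 / 2" "1 / tilt n \<le> real n powr (1 / 3)"
proof -
  have z: "1 \<le> riemann_zeta 3" "riemann_zeta 3 \<le> 5 / 4" by (rule riemann_zeta_3_bounds)+
  have n: "0 < real n" using assms by simp
  show pos: "0 < tilt n" using z n by (simp add: tilt_def)
  have "tilt n ^ 3 < 1 ^ 3" unfolding tilt_cube[OF assms] using z assms by (simp add: divide_less_eq)
  then show "tilt n < 1" by (rule power_less_imp_less_base) simp
  show "tilt n \<le> 1 / 2" if "20 \<le> n"
  proof -
    have "tilt n ^ 3 \<le> (1 / 2) ^ 3" unfolding tilt_cube[OF assms] using z that n by (simp add: divide_le_eq power3_eq_cube)
    moreover have "(1 / 2) ^ 3 < tilt n ^ 3" if "1 / 2 < tilt n" using that by (intro power_strict_mono) auto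
    ultimately show ?thesis by (meson not_le)
  qed
  have "1 / real n \<le> 2 * riemann_zeta 3 / real n" using z by (intro divide_right_mono) auto
  then have "(1 / real n) powr (1 / 3) \<le> tilt n"
    unfolding tilt_def by (rule powr_mono2[rotated 2]) simp_all
  moreover have "(1 / real n) powr (1 / 3) = 1 / real n powr (1 / 3)" by (simp add: powr_divide)
  moreover have "0 < 1 / real n powr (1 / 3)" using n by simp
  ultimately have "1 / tilt n \<le> 1 / (1 / real n powr (1 / 3))" by (intro frac_le) simp_all
  then show "1 / tilt n \<le> real n powr (1 / 3)" by simp
qed

lemma sample_partitions_eq: "sample_partitions M n = sample_sizes M (xi n) {n}"
  by (simp add: sample_partitions_def sample_sizes_def)

definition window :: "nat \<Rightarrow> real \<Rightarrow> nat set" where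
  "window n \<epsilon> = {m. real m \<in> {real n * (1 - \<epsilon>)..real n * (1 + \<epsilon>)}}"

lemma sample_partitions_approx_eq: "sample_partitions_approx M n \<epsilon> = sample_sizes M (xi n) (window n \<epsilon>)"
  by (simp add: sample_partitions_approx_def sample_sizes_def window_def)

lemma window_props:
  assumes "3 \<le> n" "0 < \<epsilon>" "\<epsilon> < 1"
  shows "finite (window n \<epsilon>)" "0 \<notin> window n \<epsilon>" "n \<in> window n \<epsilon>" "\<And>m. m \<in> window n \<epsilon> \<Longrightarrow> m \<le> 2 * n"
proof -
  show le: "m \<le> 2 * n" if "m \<in> window n \<epsilon>" for m
  proof -
    have "real m \<le> real n * (1 + \<epsilon>)" using that by (simp add: window_def)
    also have "\<dots> \<le> real n * 2" using assms by (intro mult_left_mono) auto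
    finally show ?thesis by simp
  qed
  then have "window n \<epsilon> \<subseteq> {..2 * n}" by (simp only: subset_iff atMost_iff) blast
  then show "finite (window n \<epsilon>)" by (rule finite_subset) simp
  have "0 < real n * (1 - \<epsilon>)" using assms by (intro mult_pos_pos) auto
  then show "0 \<notin> window n \<epsilon>" unfolding window_def mem_Collect_eq atLeastAtMost_iff of_nat_0 by linarith
  have "real n * (1 - \<epsilon>) \<le> real n * 1" "real n * 1 \<le> real n * (1 + \<epsilon>)"
    using assms(2) by (intro mult_left_mono; simp)+
  then show "n \<in> window n \<epsilon>" unfolding window_def mem_Collect_eq atLeastAtMost_iff mult_1_right by blast
qed

lemma xi_bounds: "3 \<le> n \<Longrightarrow> 0 < xi n" "3 \<le> n \<Longrightarrow> xi n < 1"
  using tilt_bounds(1,2) by (auto simp: xi_eq)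

text \<open>The radius 7 given to \<open>local_limit\<close> is 6 for the bias of the mean in
  \<open>size_mean_estimate\<close> plus 1 for the distance from \<open>n\<close>. The sequence
  starts at 20 to have \<open>tilt n \<le> 1 / 2\<close>.\<close>

lemma local_limit_tilt:
  "\<exists>c>0. \<exists>n\<^sub>0\<ge>20. \<forall>n\<ge>n\<^sub>0. \<forall>m. \<bar>real m - real n\<bar> \<le> 1 / (tilt n)\<^sup>2 \<longrightarrow> c * (tilt n)\<^sup>2 \<le> size_prob (xi n) m"
proof -
  have "(\<lambda>n. tilt n) \<longlonglongrightarrow> 0"
    unfolding tilt_def using riemann_zeta_3_bounds by real_asymp
  then have lim: "(\<lambda>j. tilt (j + 20)) \<longlonglongrightarrow> 0" by (rule LIMSEQ_ignore_initial_segment)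
  have "\<exists>c>0. \<forall>\<^sub>F j in sequentially. \<forall>m. \<bar>real m - size_mean (1 - tilt (j + 20))\<bar> \<le> 7 / (tilt (j + 20))\<^sup>2 \<longrightarrow>
      c * (tilt (j + 20))\<^sup>2 \<le> size_prob (1 - tilt (j + 20)) m"
    by (rule local_limit) (use tilt_bounds lim in auto)
  then obtain c J where c: "0 < c" and J: "\<And>j m. J \<le> j \<Longrightarrow> \<bar>real m - size_mean (1 - tilt (j + 20))\<bar> \<le> 7 / (tilt (j + 20))\<^sup>2 \<Longrightarrow>
      c * (tilt (j + 20))\<^sup>2 \<le> size_prob (1 - tilt (j + 20)) m"
    unfolding eventually_sequentially by blast
  show ?thesis
  proof (intro exI[of _ c] conjI exI[of _ "J + 20"] allI impI)
    fix n m assume n: "J + 20 \<le> n" and m: "\<bar>real m - real n\<bar> \<le> 1 / (tilt n)\<^sup>2"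
    have t: "0 < tilt n" "tilt n < 1" using tilt_bounds[of n] n by auto
    have "2 * riemann_zeta 3 / tilt n ^ 3 = real n"
      using tilt_cube[of n] n riemann_zeta_3_bounds(1) by simp
    then have "\<bar>size_mean (1 - tilt n) - real n\<bar> \<le> 6 / (tilt n)\<^sup>2"
      using size_mean_estimate(2)[OF t] by simp
    moreover have "7 / (tilt n)\<^sup>2 = 6 / (tilt n)\<^sup>2 + 1 / (tilt n)\<^sup>2" by (simp add: add_divide_distrib[symmetric])
    ultimately have "\<bar>real m - size_mean (1 - tilt n)\<bar> \<le> 7 / (tilt n)\<^sup>2" using m by linarith
    then show "c * (tilt n)\<^sup>2 \<le> size_prob (xi n) m"
      using J[of "n - 20" m] n by (simp add: xi_eq)
  qed (use c in auto)
qed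

text \<open>The constants: \<open>98 = 32 * 3 + 2\<close> bounds a run, as
  \<open>1 + 2 * N\<^sup>2 \<le> 3 * N\<^sup>2\<close>; \<open>729 = 9 ^ 3\<close> comes from
  \<open>B + 1 \<le> 9 * N * L\<close>; and \<open>108 = 3 ^ 3 * 2\<^sup>2\<close> from
  \<open>2 * n + 1 \<le> 3 * n\<close> and the square of \<open>2 * n\<close>.\<close>

lemma expected_time_bound:
  assumes n: "3 \<le> n" and W: "finite W" "0 \<notin> W" "W \<noteq> {}" "\<And>m. m \<in> W \<Longrightarrow> m \<le> 2 * n"
    and q: "0 < q" "q \<le> (\<Sum>m\<in>W. size_prob (xi n) m)"
  shows "expected_time (sample_sizes M (xi n) W) \<le> ennreal (98 * total_cost M * real n powr (2 / 3) / q +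
    729 * real (pak_const M) * real n * ln (real n) ^ 3 + 108 * real (pak_const M) / q)"
proof -
  define N where "N = real n powr (1 / 3)"
  define t where "t = tilt n"
  define L where "L = ln (real n)"
  \<comment> \<open>As \<open>N \<ge> 1 / t\<close>, this gives
    \<open>xi n ^ B \<le> exp (- (7 * L)) = 1 / n ^ 7\<close>, which beats the cost of order
    \<open>n ^ 3\<close> of a full transform times the order \<open>n\<^sup>2\<close> of cells in
    the union bound.\<close>
  define B where "B = nat \<lceil>7 * N * L\<rceil>"
  define p where "p = (\<Sum>m\<in>W. size_prob (xi n) m)"
  let ?w = "total_cost M" and ?K = "real (pak_const M)"
  have t: "0 < t" "t < 1" "1 / t \<le> N" using tilt_bounds(1,2,4)[OF n] by (auto simp: t_def N_def)
  have N1: "1 \<le> N" unfolding N_def using n by (intro ge_one_powr_ge_zero) auto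
  have N2: "N\<^sup>2 = real n powr (2 / 3)" and N3: "N ^ 3 = real n"
    unfolding N_def using n by (simp_all add: powr_powr powr_realpow[symmetric])
  have "exp 1 \<le> real n" using exp_le n by linarith
  then have L: "1 \<le> L" unfolding L_def using n by (subst ln_ge_iff) auto
  have NL: "1 \<le> N * L" using mult_mono[OF N1 L] N1 by simp
  have p: "q \<le> p" "0 < p" using q by (auto simp: p_def)
  have x: "0 < xi n" "xi n < 1" using xi_bounds[OF n] by auto
  have "(1 / t)\<^sup>2 \<le> N\<^sup>2" using t by (intro power_mono) auto
  then have "1 / t\<^sup>2 \<le> N\<^sup>2" by (simp add: power_divide)
  moreover have "(\<Sum>k. pair_gf (xi n ^ k)) \<le> 2 / t\<^sup>2"
    using suminf_pair_gf_le[OF t(1,2)] by (simp add: xi_eq t_def)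
  ultimately have S: "(\<Sum>k. pair_gf (xi n ^ k)) \<le> 2 * N\<^sup>2" by simp
  have N21: "1 \<le> N\<^sup>2" using N1 by simp
  have A: "(32 * ?w * (1 + (\<Sum>k. pair_gf (xi n ^ k))) + 2 * ?w) / p \<le> 98 * ?w * real n powr (2 / 3) / q"
  proof (rule frac_le)
    have "32 * ?w * (1 + (\<Sum>k. pair_gf (xi n ^ k))) + 2 * ?w \<le> 32 * ?w * (N\<^sup>2 + 2 * N\<^sup>2) + 2 * ?w * N\<^sup>2"
    proof (rule add_mono)
      show "32 * ?w * (1 + (\<Sum>k. pair_gf (xi n ^ k))) \<le> 32 * ?w * (N\<^sup>2 + 2 * N\<^sup>2)"
        using S N21 by (intro mult_left_mono) auto
      show "2 * ?w \<le> 2 * ?w * N\<^sup>2" using mult_left_mono[OF N21, of "2 * ?w"] by simp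
    qed
    then show "32 * ?w * (1 + (\<Sum>k. pair_gf (xi n ^ k))) + 2 * ?w \<le> 98 * ?w * real n powr (2 / 3)"
      unfolding N2[symmetric] by (simp add: algebra_simps)
  qed (use p q in auto)
  have B: "real B \<le> 7 * N * L + 1" "7 * N * L \<le> real B"
  proof -
    have "0 \<le> 7 * N * L" using N1 L by (intro mult_nonneg_nonneg) auto
    then show "real B \<le> 7 * N * L + 1" "7 * N * L \<le> real B" unfolding B_def by linarith+
  qed
  have "(real B + 1) ^ 3 \<le> (9 * (N * L)) ^ 3" using B NL by (intro power_mono) auto
  also have "\<dots> = 729 * real n * L ^ 3" by (simp add: power_mult_distrib N3)
  finally have B3: "?K * (real B + 1) ^ 3 \<le> 729 * ?K * real n * L ^ 3"
    using mult_left_mono[of "(real B + 1) ^ 3" "729 * real n * L ^ 3" ?K] by (simp add: mult_ac)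
  have "xi n ^ B \<le> exp (- t) ^ B"
    using x exp_ge_add_one_self[of "- t"] by (intro power_mono) (auto simp: xi_eq t_def)
  also have "\<dots> = exp (- (t * real B))" by (simp add: exp_of_nat_mult[symmetric] mult.commute)
  also have "\<dots> \<le> exp (- (7 * L))"
  proof -
    have "1 \<le> N * t" using t by (simp add: divide_le_eq)
    then have "7 * L * 1 \<le> 7 * L * (N * t)" using L by (intro mult_left_mono) auto
    also have "\<dots> = t * (7 * N * L)" by simp
    also have "\<dots> \<le> t * real B" using B(2) t by (intro mult_left_mono) auto
    finally show ?thesis by simp
  qed
  also have "\<dots> = 1 / real n ^ 7"
    using n exp_of_nat_mult[of 7 L] by (simp add: L_def exp_minus inverse_eq_divide)
  finally have xB: "xi n ^ B \<le> 1 / real n ^ 7" .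
  have "(real (2 * n) + 1) ^ 3 * ((real (2 * n))\<^sup>2 * xi n ^ B / p) \<le> (3 * real n) ^ 3 * ((real (2 * n))\<^sup>2 * (1 / real n ^ 7) / q)"
    using n xB p q x by (intro mult_mono power_mono frac_le mult_left_mono) auto
  also have "\<dots> = 108 / (real n)\<^sup>2 / q"
    using n q by (simp add: power_mult_distrib eval_nat_numeral)
  also have "\<dots> \<le> 108 / 1 / q" using n q by (intro divide_right_mono divide_left_mono) auto
  finally have C: "?K * (real (2 * n) + 1) ^ 3 * ((real (2 * n))\<^sup>2 * xi n ^ B / p) \<le> 108 * ?K / q"
    using mult_left_mono[of _ _ ?K] by (fastforce simp: mult_ac)
  have "expected_time (sample_sizes M (xi n) W) \<le> ennreal (
    (32 * ?w * (1 + (\<Sum>k. pair_gf (xi n ^ k))) + 2 * ?w) / p + ?K * (real B + 1) ^ 3 +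
    ?K * (real (2 * n) + 1) ^ 3 * ((real (2 * n))\<^sup>2 * xi n ^ B / p))"
    using expected_time_sample_sizes_le[OF x W(1,2,3) W(4), of M B] unfolding success_def[OF x W(1,2,3)] p_def by simp
  also have "\<dots> \<le> ennreal (98 * ?w * real n powr (2 / 3) / q + 729 * ?K * real n * ln (real n) ^ 3 + 108 * ?K / q)"
    using A B3 C unfolding L_def by (intro ennreal_leI add_mono)
  finally show ?thesis .
qed

text \<open>At most \<open>1 / (c * t\<^sup>2)\<close> runs on average, each of cost
  \<open>O(1 / t\<^sup>2)\<close>, with \<open>1 / t \<le> N\<close>, give the order
  \<open>N ^ 4\<close>; the transform is smaller because eventually
  \<open>ln n ^ 3 \<le> N\<close>.\<close>

theorem expected_time_exact:
  "\<exists>c>0. \<exists>n\<^sub>0. \<forall>n\<ge>n\<^sub>0. expected_time (sample_partitions M n) \<le> ennreal (c * real n powr (4 / 3))"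
proof -
  obtain c n\<^sub>0 where c: "0 < c" "20 \<le> n\<^sub>0"
    and llt: "\<And>n m. n\<^sub>0 \<le> n \<Longrightarrow> \<bar>real m - real n\<bar> \<le> 1 / (tilt n)\<^sup>2 \<Longrightarrow> c * (tilt n)\<^sup>2 \<le> size_prob (xi n) m"
    using local_limit_tilt by blast
  let ?w = "total_cost M" and ?K = "real (pak_const M)"
  have "\<forall>\<^sub>F n in sequentially. ln (real n) ^ 3 \<le> real n powr (1 / 3)" by real_asymp
  then obtain n\<^sub>1 where n1: "\<And>n. n\<^sub>1 \<le> n \<Longrightarrow> ln (real n) ^ 3 \<le> real n powr (1 / 3)"
    unfolding eventually_sequentially by blast
  have "expected_time (sample_partitions M n) \<le> ennreal ((98 * ?w / c + 729 * ?K + 108 * ?K / c + 1) * real n powr (4 / 3))"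
    if n: "max n\<^sub>0 n\<^sub>1 \<le> n" for n
  proof -
    define N where "N = real n powr (1 / 3)"
    have n3: "3 \<le> n" "n\<^sub>0 \<le> n" "n\<^sub>1 \<le> n" using n c(2) by auto
    have N1: "1 \<le> N" unfolding N_def using n3 by (intro ge_one_powr_ge_zero) auto
    have N2: "N\<^sup>2 = real n powr (2 / 3)" and N3: "N ^ 3 = real n" and N4: "N ^ 4 = real n powr (4 / 3)"
      unfolding N_def using n3 by (simp_all add: powr_powr powr_realpow[symmetric])
    have t: "0 < tilt n" "1 / tilt n \<le> N" using tilt_bounds(1,4)[OF n3(1)] by (auto simp: N_def)
    have "1 / N \<le> tilt n" using t N1 by (simp add: field_simps)
    then have "(1 / N)\<^sup>2 \<le> (tilt n)\<^sup>2" using N1 by (intro power_mono) auto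
    then have "c / N\<^sup>2 \<le> c * (tilt n)\<^sup>2" using mult_left_mono[of "(1 / N)\<^sup>2" "(tilt n)\<^sup>2" c] c by (simp add: power_divide)
    also have "\<dots> \<le> size_prob (xi n) n" using n3 t by (intro llt) auto
    finally have q: "c / N\<^sup>2 \<le> (\<Sum>m\<in>{n}. size_prob (xi n) m)" by simp
    have "expected_time (sample_partitions M n) \<le> ennreal (98 * ?w * real n powr (2 / 3) / (c / N\<^sup>2) +
        729 * ?K * real n * ln (real n) ^ 3 + 108 * ?K / (c / N\<^sup>2))"
      unfolding sample_partitions_eq
      by (rule expected_time_bound[OF n3(1) _ _ _ _ _ q]) (use n3 c N1 in auto)
    also have "\<dots> \<le> ennreal ((98 * ?w / c + 729 * ?K + 108 * ?K / c + 1) * real n powr (4 / 3))"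
    proof (rule ennreal_leI)
      have "98 * ?w * real n powr (2 / 3) / (c / N\<^sup>2) = 98 * ?w / c * N ^ 4"
        unfolding N2[symmetric] by (simp add: eval_nat_numeral)
      moreover have "729 * ?K * real n * ln (real n) ^ 3 \<le> 729 * ?K * N ^ 4"
      proof -
        have "729 * ?K * (real n * ln (real n) ^ 3) \<le> 729 * ?K * (N ^ 3 * N)"
          using n1[OF n3(3)] N1 unfolding N3[symmetric] by (intro mult_left_mono) (auto simp: N_def[symmetric] N3)
        then show ?thesis by (simp add: eval_nat_numeral mult_ac)
      qed
      moreover have "108 * ?K / (c / N\<^sup>2) \<le> 108 * ?K / c * N ^ 4"
      proof -
        have "N\<^sup>2 \<le> N ^ 4" using N1 by (intro power_increasing) auto
        then have "108 * ?K / c * N\<^sup>2 \<le> 108 * ?K / c * N ^ 4" using c by (intro mult_left_mono) auto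
        then show ?thesis by simp
      qed
      moreover have "0 \<le> N ^ 4" by simp
      ultimately show "98 * ?w * real n powr (2 / 3) / (c / N\<^sup>2) + 729 * ?K * real n * ln (real n) ^ 3 + 108 * ?K / (c / N\<^sup>2)
        \<le> (98 * ?w / c + 729 * ?K + 108 * ?K / c + 1) * real n powr (4 / 3)"
        unfolding N4[symmetric] distrib_right by linarith
    qed
    finally show ?thesis .
  qed
  moreover have "0 < 98 * ?w / c + 729 * ?K + 108 * ?K / c + 1"
    using c total_cost_nonneg[of M] by (intro add_nonneg_pos add_nonneg_nonneg divide_nonneg_nonneg) auto
  ultimately show ?thesis by blast
qed

text \<open>The success probability is at least \<open>c\<close>: the window contains the sizes from
  \<open>n\<close> to \<open>n + k\<close> with \<open>k + 1 \<ge> 1 / t\<^sup>2\<close>, each of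
  probability at least \<open>c * t\<^sup>2\<close>. So \<open>\<epsilon>\<close> decides only from
  which \<open>n\<close> on these sizes fit into the window, and \<open>?C\<close> is free of
  it.\<close>

theorem expected_time_approx:
  "\<exists>c>0. \<forall>\<epsilon>\<in>{0<..<1}. \<exists>n\<^sub>0. \<forall>n\<ge>n\<^sub>0.
    expected_time (sample_partitions_approx M n \<epsilon>) \<le> ennreal (c * real n * ln (real n) ^ 3)"
proof -
  obtain c n\<^sub>0 where c: "0 < c" "20 \<le> n\<^sub>0"
    and llt: "\<And>n m. n\<^sub>0 \<le> n \<Longrightarrow> \<bar>real m - real n\<bar> \<le> 1 / (tilt n)\<^sup>2 \<Longrightarrow> c * (tilt n)\<^sup>2 \<le> size_prob (xi n) m"
    using local_limit_tilt by blast
  let ?w = "total_cost M" and ?K = "real (pak_const M)"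
  let ?C = "98 * ?w / c + 729 * ?K + 108 * ?K / c + 1"
  have "\<exists>n\<^sub>1. \<forall>n\<ge>n\<^sub>1. expected_time (sample_partitions_approx M n \<epsilon>) \<le> ennreal (?C * real n * ln (real n) ^ 3)"
    if \<epsilon>: "0 < \<epsilon>" "\<epsilon> < 1" for \<epsilon>
  proof -
    have "\<forall>\<^sub>F n in sequentially. real n powr (2 / 3) \<le> \<epsilon> * real n" using \<epsilon> by real_asymp
    then obtain n\<^sub>1 where n1: "\<And>n. n\<^sub>1 \<le> n \<Longrightarrow> real n powr (2 / 3) \<le> \<epsilon> * real n"
      unfolding eventually_sequentially by blast
    have "expected_time (sample_partitions_approx M n \<epsilon>) \<le> ennreal (?C * real n * ln (real n) ^ 3)"
      if n: "max n\<^sub>0 n\<^sub>1 \<le> n" for n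
    proof -
      define N where "N = real n powr (1 / 3)"
      define t where "t = tilt n"
      have n3: "3 \<le> n" "n\<^sub>0 \<le> n" "n\<^sub>1 \<le> n" using n c(2) by auto
      note win = window_props[OF n3(1) \<epsilon>]
      have t: "0 < t" "1 / t \<le> N" using tilt_bounds(1,4)[OF n3(1)] by (auto simp: N_def t_def)
      have N2: "N\<^sup>2 = real n powr (2 / 3)" unfolding N_def using n3 by (simp add: powr_powr powr_realpow[symmetric])
      have "(1 / t)\<^sup>2 \<le> N\<^sup>2" using t by (intro power_mono) auto
      then have t2: "1 / t\<^sup>2 \<le> real n powr (2 / 3)" by (simp add: power_divide N2)
      define k where "k = nat \<lfloor>1 / t\<^sup>2\<rfloor>"
      have k: "real k \<le> 1 / t\<^sup>2" "1 / t\<^sup>2 \<le> real k + 1" unfolding k_def using t by (auto; linarith)+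
      have sub: "{n..n + k} \<subseteq> window n \<epsilon>"
      proof
        fix m assume m: "m \<in> {n..n + k}"
        then have "real n \<le> real m" "real m \<le> real n + real k" by auto
        moreover have "real k \<le> \<epsilon> * real n" using k(1) t2 n1[OF n3(3)] by linarith
        moreover have "0 \<le> real n * \<epsilon>" using \<epsilon> by simp
        ultimately show "m \<in> window n \<epsilon>" unfolding window_def by (simp add: algebra_simps)
      qed
      have "c * 1 \<le> c * ((real k + 1) * t\<^sup>2)"
        using k(2) t c by (intro mult_left_mono) (auto simp: divide_le_eq)
      also have "\<dots> = (\<Sum>m\<in>{n..n + k}. c * t\<^sup>2)" by simp
      also have "\<dots> \<le> (\<Sum>m\<in>{n..n + k}. size_prob (xi n) m)"
        using k(1) unfolding t_def by (intro sum_mono llt[OF n3(2)]) auto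
      also have "\<dots> \<le> (\<Sum>m\<in>window n \<epsilon>. size_prob (xi n) m)"
        using size_prob_nonneg[OF xi_bounds[OF n3(1)]] by (intro sum_mono2 win sub) auto
      finally have q: "c \<le> (\<Sum>m\<in>window n \<epsilon>. size_prob (xi n) m)" by simp
      have "expected_time (sample_partitions_approx M n \<epsilon>) \<le> ennreal (98 * ?w * real n powr (2 / 3) / c +
          729 * ?K * real n * ln (real n) ^ 3 + 108 * ?K / c)"
        unfolding sample_partitions_approx_eq
        by (rule expected_time_bound[OF n3(1) win(1,2) _ win(4) c(1) q]) (use win(3) in auto)
      also have "\<dots> \<le> ennreal (?C * real n * ln (real n) ^ 3)"
      proof (rule ennreal_leI)
        define Z where "Z = real n * ln (real n) ^ 3"
        have "exp 1 \<le> real n" using exp_le n3(1) by linarith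
        then have "1 \<le> ln (real n)" using n3(1) by (subst ln_ge_iff) auto
        then have "1 \<le> ln (real n) ^ 3" by simp
        then have nZ: "real n \<le> Z" using mult_left_mono[of 1 "ln (real n) ^ 3" "real n"] by (simp add: Z_def)
        have "real n powr (2 / 3) \<le> real n powr 1" using n3(1) by (intro powr_mono) auto
        then have "real n powr (2 / 3) \<le> Z" using nZ n3(1) by simp
        then have "98 * ?w / c * real n powr (2 / 3) \<le> 98 * ?w / c * Z" using c by (intro mult_left_mono) auto
        moreover have "108 * ?K / c * 1 \<le> 108 * ?K / c * Z" using nZ n3(1) c by (intro mult_left_mono) auto
        moreover have "0 \<le> Z" using nZ by linarith
        ultimately show "98 * ?w * real n powr (2 / 3) / c + 729 * ?K * real n * ln (real n) ^ 3 + 108 * ?K / c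
          \<le> ?C * real n * ln (real n) ^ 3"
          unfolding mult.assoc[of _ "real n"] Z_def[symmetric] distrib_right by simp
      qed
      finally show ?thesis .
    qed
    then show ?thesis by blast
  qed
  moreover have "0 < ?C"
    using c total_cost_nonneg[of M] by (intro add_nonneg_pos add_nonneg_nonneg divide_nonneg_nonneg) auto
  ultimately show ?thesis by (intro exI[of _ ?C]) auto
qed

theorem theorem9:
  fixes M :: cost_model
  shows
    "(\<forall>n\<ge>3.
        lossless_spmf (output_law (sample_partitions M n)) \<and>
        output_law (sample_partitions M n) = spmf_of_set {a. plane_partition a \<and> pp_size a = n}) \<and>
     (\<exists>c>0. \<exists>n\<^sub>0. \<forall>n\<ge>n\<^sub>0.
        expected_time (sample_partitions M n) \<le> ennreal (c * real n powr (4 / 3))) \<and>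
     (\<forall>n\<ge>3. \<forall>\<epsilon>\<in>{0<..<1}.
        lossless_spmf (output_law (sample_partitions_approx M n \<epsilon>)) \<and>
        set_spmf (output_law (sample_partitions_approx M n \<epsilon>)) \<subseteq>
          {a. plane_partition a \<and> real (pp_size a) \<in> {real n * (1 - \<epsilon>)..real n * (1 + \<epsilon>)}} \<and>
        (\<forall>a b. plane_partition a \<and> plane_partition b \<and> pp_size a = pp_size b \<longrightarrow>
           spmf (output_law (sample_partitions_approx M n \<epsilon>)) a =
           spmf (output_law (sample_partitions_approx M n \<epsilon>)) b)) \<and>
     (\<exists>c>0. \<forall>\<epsilon>\<in>{0<..<1}. \<exists>n\<^sub>0. \<forall>n\<ge>n\<^sub>0.
        expected_time (sample_partitions_approx M n \<epsilon>) \<le> ennreal (c * real n * ln (real n) ^ 3))"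
proof (intro conjI allI ballI impI)
  fix n :: nat assume n: "3 \<le> n"
  have W: "finite {n}" "0 \<notin> {n}" "{n} \<noteq> {}" using n by auto
  show "lossless_spmf (output_law (sample_partitions M n))"
    unfolding sample_partitions_eq by (rule lossless_sample_sizes[OF xi_bounds[OF n] W])
  show "output_law (sample_partitions M n) = spmf_of_set {a. plane_partition a \<and> pp_size a = n}"
    unfolding sample_partitions_eq by (rule output_law_sample_sizes_single[OF xi_bounds[OF n] W refl])
next
  fix n :: nat and \<epsilon> :: real assume n: "3 \<le> n" and "\<epsilon> \<in> {0<..<1}"
  then have "0 < \<epsilon>" "\<epsilon> < 1" by auto
  note win = window_props[OF n this]
  then have ne: "window n \<epsilon> \<noteq> {}" by blast
  show "lossless_spmf (output_law (sample_partitions_approx M n \<epsilon>))"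
    unfolding sample_partitions_approx_eq by (rule lossless_sample_sizes[OF xi_bounds[OF n] win(1,2) ne])
  show "set_spmf (output_law (sample_partitions_approx M n \<epsilon>)) \<subseteq>
      {a. plane_partition a \<and> real (pp_size a) \<in> {real n * (1 - \<epsilon>)..real n * (1 + \<epsilon>)}}"
    unfolding sample_partitions_approx_eq set_sample_sizes[OF xi_bounds[OF n] win(1,2) ne]
    by (auto simp: window_def)
  fix a b assume "plane_partition a \<and> plane_partition b \<and> pp_size a = pp_size b"
  then show "spmf (output_law (sample_partitions_approx M n \<epsilon>)) a = spmf (output_law (sample_partitions_approx M n \<epsilon>)) b"
    unfolding sample_partitions_approx_eq using spmf_sample_sizes_eq[OF xi_bounds[OF n] win(1,2) ne] by blast
qed (rule expected_time_exact, rule expected_time_approx)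

end
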